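(* Let $\sigma>0$, $\Gamma>0$, $\alpha>0$ be constants, let $(h,\alpha,k,K)$ be an admissible reward structure, and let $\mu\in C^1(\mathbb{R},\mathbb{R})$. For $\gamma\in\{\Gamma,\alpha+\Gamma\}$ let $(\varphi_\gamma,\eta_\gamma)$ be a pair of functions satisfying the homogeneous system for the generator $\mathcal{L}_\gamma[f]=\frac{\sigma^2}{2}f''+\mu f'-\gamma f$, that is, $\mathcal{L}_\gamma[\varphi_\gamma]=\mathcal{L}_\gamma[\eta_\gamma]=0$ on $\mathbb{R}$, $W[\varphi_\gamma,\eta_\gamma](x)\neq 0$ for all $x\in\mathbb{R}$, $\lim_{x\to+\infty}\varphi_\gamma(x)=0$ and $\lim_{x\to-\infty}\eta_\gamma(x)=0$. Let $p,q\in\mathbb{R}$ be constants such that $$F_\Gamma(x):=p\,\varphi_\Gamma(x)+q\,\eta_\Gamma(x)>0\quad\text{for all }x\in\mathbb{R}.$$ Let $(X_t)_{t\ge 0}$ be the solution of the SDE $$dX_t=m(X_t)\,dt+\sigma\,dW_t,\qquad m(x):=\mu(x)+\sigma^2\,\partial_x\{\ln F_\Gamma(x)\},$$ where $(W_t)_{t\geq 0}$ is a standard Wiener process, and suppose that there are positive constants $\alpha_0,b>0$ such that $$0<\alpha_0<\alpha-m'(x)<b\quad\text{for all }x\in\mathbb{R}.$$ Then the Gittins index $M_{\alpha,\Gamma}$ of $(X_t)_{t\ge0}$ (with respect to the reward structure $(h,\alpha,k,K)$) is, for every $x\in\mathbb{R}$, $$M_{\alpha,\Gamma}(x)=\fr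ac{W[\varphi_{\alpha+\Gamma},\eta_{\alpha+\Gamma}](x)}{W[\varphi_{\alpha+\Gamma},F_\Gamma](x)}\int_x^\infty\frac{2\,h(s)\,\varphi_{\alpha+\Gamma}(s)\,F_\Gamma(s)}{\sigma^2\,W[\varphi_{\alpha+\Gamma},\eta_{\alpha+\Gamma}](s)}\,ds.$$
   Context: Wronskian: for $f,g\in C^1(\mathbb{R})$, $W[f,g](x):=f(x)g'(x)-f'(x)g(x)$. Admissible reward structure: a 4-tuple $(h,\alpha,k,K)$ where $\alpha>0$ (the discounting factor) and $h:\mathbb{R}\to[\alpha k,\alpha K]$ is a strictly increasing function with bounded first and second derivatives such that $\lim_{x\to-\infty}h(x)=\alpha k$, $\lim_{x\to+\infty}h(x)=\alpha K$ and $\lim_{|x|\to\infty}|h'(x)|=0$. Gittins index: for a real-valued diffusion $X$ adapted to a filtration $(\mathcal{F}_t)_{t\ge0}$ (with respect to which the driving Wiener process is a Brownian motion), the Gittins index at $x\in\mathbb{R}$ is $$M(x):=\sup_\tau\frac{\mathbb{E}_x\int_0^\tau h(X_s)e^{-\alpha s}\,ds}{1-\mathbb{E}_x e^{-\alpha\tau}},$$ where $\mathbb{E}_x$ is expectation for the process started at $X_0=x$ and the supremum is over all stopping times $\tau$ with respect to $(\mathcal{F}_t)$. *)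

theory Defs
  imports "HOL-Probability.Probability"
begin

section \<open>Wronskian, generator and reward structure\<close>

definition wronskian :: "(real \<Rightarrow> real) \<Rightarrow> (real \<Rightarrow> real) \<Rightarrow> real \<Rightarrow> real" where
  "wronskian f g x = f x * deriv g x - deriv f x * g x"

definition generator ::
    "real \<Rightarrow> (real \<Rightarrow> real) \<Rightarrow> real \<Rightarrow> (real \<Rightarrow> real) \<Rightarrow> real \<Rightarrow> real" where
  "generator \<sigma> \<mu> \<gamma> f x = \<sigma>\<^sup>2 / 2 * deriv (deriv f) x + \<mu> x * deriv f x - \<gamma> * f x"

text \<open>Twice differentiability is demanded explicitly because \<^const>\<open>deriv\<close> is total; continuity of
  the second derivative then follows from the equation when \<open>\<mu>\<close> is continuous and \<open>\<sigma> \<noteq> 0\<close>.\<close>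

definition homogeneous_solution ::
    "real \<Rightarrow> (real \<Rightarrow> real) \<Rightarrow> real \<Rightarrow> (real \<Rightarrow> real) \<Rightarrow> bool" where
  "homogeneous_solution \<sigma> \<mu> \<gamma> f \<longleftrightarrow>
     (\<forall>x. f differentiable at x) \<and> (\<forall>x. deriv f differentiable at x) \<and>
     (\<forall>x. generator \<sigma> \<mu> \<gamma> f x = 0)"

definition homogeneous_system ::
    "real \<Rightarrow> (real \<Rightarrow> real) \<Rightarrow> real \<Rightarrow> (real \<Rightarrow> real) \<Rightarrow> (real \<Rightarrow> real) \<Rightarrow> bool" where
  "homogeneous_system \<sigma> \<mu> \<gamma> \<phi> \<eta> \<longleftrightarrow>
     homogeneous_solution \<sigma> \<mu> \<gamma> \<phi> \<and> homogeneous_solution \<sigma> \<mu> \<gamma> \<eta> \<and>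
     (\<forall>x. wronskian \<phi> \<eta> x \<noteq> 0) \<and>
     (\<phi> \<longlongrightarrow> 0) at_top \<and> (\<eta> \<longlongrightarrow> 0) at_bot"

definition admissible_reward :: "(real \<Rightarrow> real) \<Rightarrow> real \<Rightarrow> real \<Rightarrow> real \<Rightarrow> bool" where
  "admissible_reward h \<alpha> k K \<longleftrightarrow>
     0 < \<alpha> \<and> range h \<subseteq> {\<alpha> * k..\<alpha> * K} \<and> strict_mono h \<and>
     (\<forall>x. h differentiable at x) \<and> (\<forall>x. deriv h differentiable at x) \<and>
     bounded (range (deriv h)) \<and> bounded (range (deriv (deriv h))) \<and>
     (h \<longlongrightarrow> \<alpha> * k) at_bot \<and> (h \<longlongrightarrow> \<alpha> * K) at_top \<and>
     ((\<lambda>x. \<bar>deriv h x\<bar>) \<longlongrightarrow> 0) at_infinity"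

section \<open>Diffusions with constant diffusion coefficient\<close>

text \<open>Filtrations are indexed by \<^typ>\<open>ennreal\<close>, so that the library's \<^const>\<open>stopping_time\<close> covers
  stopping times that may be infinite. The member at \<open>\<infinity>\<close> is only required to contain the others;
  the stopping time condition at \<open>\<infinity>\<close> is void. Processes are indexed by \<^typ>\<open>real\<close> and used only at
  nonnegative times.\<close>

definition filtered_prob_space :: "'a measure \<Rightarrow> (ennreal \<Rightarrow> 'a measure) \<Rightarrow> bool" where
  "filtered_prob_space P \<F> \<longleftrightarrow>
     prob_space P \<and> filtration (space P) \<F> \<and> (\<forall>t. sets (\<F> t) \<subseteq> sets P)"

definition adapted :: "(ennreal \<Rightarrow> 'a measure) \<Rightarrow> (real \<Rightarrow> 'a \<Rightarrow> real) \<Rightarrow> bool" where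
  "adapted \<F> X \<longleftrightarrow> (\<forall>t\<ge>0. X t \<in> borel_measurable (\<F> (ennreal t)))"

definition continuous_paths :: "'a measure \<Rightarrow> (real \<Rightarrow> 'a \<Rightarrow> real) \<Rightarrow> bool" where
  "continuous_paths P X \<longleftrightarrow> (\<forall>\<omega>\<in>space P. continuous_on {0..} (\<lambda>t. X t \<omega>))"

text \<open>The second parameter of \<^const>\<open>normal_density\<close> is the standard deviation.\<close>

definition wiener_process ::
    "'a measure \<Rightarrow> (ennreal \<Rightarrow> 'a measure) \<Rightarrow> (real \<Rightarrow> 'a \<Rightarrow> real) \<Rightarrow> bool" where
  "wiener_process P \<F> W \<longleftrightarrow>
     adapted \<F> W \<and> continuous_paths P W \<and> (AE \<omega> in P. W 0 \<omega> = 0) \<and>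
     (\<forall>s t. 0 \<le> s \<and> s < t \<longrightarrow>
        distributed P lborel (\<lambda>\<omega>. W t \<omega> - W s \<omega>) (normal_density 0 (sqrt (t - s))) \<and>
        prob_space.indep_set P (sets (\<F> (ennreal s)))
          (sets (vimage_algebra (space P) (\<lambda>\<omega>. W t \<omega> - W s \<omega>) borel)))"

text \<open>\<open>X\<close> solves \<open>dX = m(X) dt + \<sigma> dW\<close> with \<open>X 0 = x\<close>. As \<open>\<sigma>\<close> is constant and \<open>W 0 = 0\<close>, the
  stochastic integral of \<open>\<sigma>\<close> up to time \<open>t\<close> is \<open>\<sigma> * W t\<close>.\<close>

definition sde_solution ::
    "'a measure \<Rightarrow> (ennreal \<Rightarrow> 'a measure) \<Rightarrow> (real \<Rightarrow> real) \<Rightarrow> real \<Rightarrow> (real \<Rightarrow> 'a \<Rightarrow> real) \<Rightarrow> real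
      \<Rightarrow> (real \<Rightarrow> 'a \<Rightarrow> real) \<Rightarrow> bool" where
  "sde_solution P \<F> m \<sigma> W x X \<longleftrightarrow>
     filtered_prob_space P \<F> \<and> wiener_process P \<F> W \<and>
     adapted \<F> X \<and> continuous_paths P X \<and> (AE \<omega> in P. X 0 \<omega> = x) \<and>
     (AE \<omega> in P. \<forall>t\<ge>0. X t \<omega> = X 0 \<omega> + (LINT s:{0..t}|lborel. m (X s \<omega>)) + \<sigma> * W t \<omega>)"

section \<open>Gittins index\<close>

definition discount :: "real \<Rightarrow> ennreal \<Rightarrow> real" where
  "discount \<alpha> t = (if t = \<infinity> then 0 else exp (- \<alpha> * enn2real t))"

definition discounted_reward ::
    "(real \<Rightarrow> real) \<Rightarrow> real \<Rightarrow> (real \<Rightarrow> 'a \<Rightarrow> real) \<Rightarrow> ('a \<Rightarrow> ennreal) \<Rightarrow> 'a \<Rightarrow> real" where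
  "discounted_reward h \<alpha> X \<tau> \<omega> =
     (LINT s:{s. 0 \<le> s \<and> ennreal s \<le> \<tau> \<omega>}|lborel. h (X s \<omega>) * exp (- \<alpha> * s))"

text \<open>\<open>P x\<close> is the law under which the process starts at \<open>x\<close>, so integration with respect to \<open>P x\<close>
  is the expectation \<open>E\<^sub>x\<close>. Stopping times that vanish \<open>P x\<close>-almost surely are the ones for which
  the quotient is \<open>0 / 0\<close>; they are left out of the supremum. The value is extended real, hence
  the supremum is never a default value.\<close>

definition gittins_index ::
    "(real \<Rightarrow> 'a measure) \<Rightarrow> (ennreal \<Rightarrow> 'a measure) \<Rightarrow> (real \<Rightarrow> 'a \<Rightarrow> real) \<Rightarrow>
      (real \<Rightarrow> real) \<Rightarrow> real \<Rightarrow> real \<Rightarrow> ereal" where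
  "gittins_index P \<F> X h \<alpha> x =
     (SUP \<tau>\<in>{\<tau>. stopping_time \<F> \<tau> \<and> 1 - (\<integral>\<omega>. discount \<alpha> (\<tau> \<omega>) \<partial>P x) \<noteq> 0}.
        ereal ((\<integral>\<omega>. discounted_reward h \<alpha> X \<tau> \<omega> \<partial>P x)
               / (1 - (\<integral>\<omega>. discount \<alpha> (\<tau> \<omega>) \<partial>P x))))"

end

theory Submission
  imports Defs
begin

text \<open>Dividing the equation for \<open>\<alpha> + \<Gamma>\<close> by \<open>F\<close> turns \<open>\<phi>\<close> into a positive decreasing solution \<open>u\<close> of
  \<open>L u = \<alpha> u\<close>, \<open>L\<close> being the generator of \<open>X\<close>, and the claimed value at \<open>a\<close> into the average
  \<open>M(a)\<close> of \<open>h / \<alpha>\<close> over \<open>[a, \<infinity>)\<close> with respect to \<open>u\<close> times the speed density. For each threshold \<open>a\<close> the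
  equation \<open>(L - \<alpha>) V = \<alpha> M(a) - h\<close> with \<open>V = V' = 0\<close> at \<open>a\<close> has an explicit solution, which is
  nonnegative everywhere and bounded on \<open>[a, \<infinity>)\<close>. Dynkin's formula for \<open>a = x\<close> and an arbitrary stopping
  time gives the upper bound \<open>M(x)\<close>. For \<open>a < x\<close> and the first passage to \<open>a\<close> it gives the lower
  bound \<open>M(a)\<close>, which tends to \<open>M(x)\<close> as \<open>a\<close> increases to \<open>x\<close>.\<close>

section \<open>Second-order equations on the line\<close>

text \<open>The value function may be unbounded below the threshold. The upper bound therefore uses
  only its sign, and the lower bound stops \<open>X\<close> before it can pass below
  \<open>a\<close>. The bound on \<open>m'\<close> enters through linear growth of \<open>m\<close>:
  it forces the flux \<open>- u' / s\<close> to vanish at +\<infinity>, and only then does the total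
  mass equal the flux, which makes M(a) an average. The threshold of the lower bound lies strictly
  below x because first passage to x from x is immediate and its quotient is 0/0; continuity of M
  closes the gap. Since the diffusion coefficient is constant, Dynkin's formula can be obtained from
  Taylor expansions over short steps with Gaussian increments, without stochastic integrals. Such an
  expansion wants bounded drift and bounded derivatives, hence the clipped drift, the cutoff of the
  test function and the exhaustion by exits from [-n, n].\<close>

text \<open>Half of the second-derivative test, from the derivative of \<open>f'\<close> at the
  single point \<open>z\<close>: just to the right of \<open>z\<close> the function
  \<open>f'\<close> is positive, so \<open>f\<close> rises. The bound \<open>b\<close> keeps the
  larger value inside the interval on which a maximum was taken.\<close>

lemma DERIV_pos_not_local_max:
  fixes f f' :: "real \<Rightarrow> real"
  assumes "\<And>y. (f has_real_derivative f' y) (at y)"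
    and "f' z = 0" and "(f' has_real_derivative d) (at z)" and "d > 0" and "z < b"
  obtains y where "z < y" "y < b" "f z < f y"
proof -
  obtain e where e: "e > 0" "\<And>t. t > 0 \<Longrightarrow> t < e \<Longrightarrow> f' z < f' (z + t)"
    using DERIV_pos_inc_right[OF assms(3,4)] by blast
  define t where "t = min e (b - z) / 2"
  have t: "t > 0" "t < e" "z + t < b"
    using e(1) assms(5) by (auto simp: t_def min_def field_simps)
  have "f z < f (z + t)"
  proof (rule DERIV_pos_imp_increasing_open[of z "z + t" f])
    show "\<exists>y. DERIV f s :> y \<and> y > 0" if "z < s" "s < z + t" for s
      using e(2)[of "s - z"] that t assms(1)[of s] assms(2) by auto
    show "continuous_on {z..z + t} f"
      using assms(1) by (intro continuous_at_imp_continuous_on) (auto intro: DERIV_isCont)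
  qed (use t in auto)
  with that[of "z + t"] t show thesis
    by simp
qed

text \<open>A positive value would exceed \<open>f\<close> near infinity and so produce a positive
  interior maximum on a compact interval; there \<open>f'\<close> vanishes, and the positive second
  derivative contradicts maximality. The condition at infinity is one-sided, so that a positive
  function of unknown growth may be subtracted.\<close>

lemma maximum_principle_at_top:
  fixes f f' :: "real \<Rightarrow> real"
  assumes f: "\<And>y. (f has_real_derivative f' y) (at y)"
    and f': "\<And>y. f' y = 0 \<Longrightarrow> f y > 0 \<Longrightarrow> \<exists>d>0. (f' has_real_derivative d) (at y)"
    and lim: "\<And>e. e > 0 \<Longrightarrow> eventually (\<lambda>y. f y < e) at_top"
    and "f a \<le> 0" and "a \<le> y"
  shows "f y \<le> 0"
proof (rule ccontr)
  assume "\<not> f y \<le> 0"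
  then obtain c where c: "\<And>z. z \<ge> c \<Longrightarrow> f z < f y"
    using lim[of "f y"] by (auto simp: eventually_at_top_linorder)
  define b where "b = max c y + 1"
  have cont: "continuous_on S f" for S
    using f by (intro continuous_at_imp_continuous_on) (auto intro: DERIV_isCont)
  have "{a..b} \<noteq> {}"
    using assms(5) by (auto simp: b_def)
  then obtain z where z: "z \<in> {a..b}" "\<And>t. t \<in> {a..b} \<Longrightarrow> f t \<le> f z"
    using continuous_attains_sup[of "{a..b}" f, OF _ _ cont] by auto
  have fz: "f y \<le> f z"
    using z(2)[of y] assms(5) by (auto simp: b_def)
  have "z \<noteq> a"
    using fz assms(4) \<open>\<not> f y \<le> 0\<close> by auto
  moreover have "z \<noteq> b"
    using fz c[of b] by (auto simp: b_def max_def not_less split: if_splits)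
  ultimately have ab: "a < z" "z < b"
    using z(1) by auto
  define r where "r = min (z - a) (b - z)"
  have "f' z = 0"
  proof (rule DERIV_local_max[OF f])
    show "r > 0" using ab by (auto simp: r_def)
    show "\<forall>t. \<bar>z - t\<bar> < r \<longrightarrow> f t \<le> f z"
      using z(2) by (auto simp: r_def abs_if split: if_splits)
  qed
  moreover have "f z > 0"
    using fz \<open>\<not> f y \<le> 0\<close> by auto
  ultimately obtain d where d: "d > 0" "(f' has_real_derivative d) (at z)"
    using f' by blast
  obtain t where "z < t" "t < b" "f z < f t"
    using DERIV_pos_not_local_max[OF f \<open>f' z = 0\<close> d(2,1) ab(2)] .
  then show False
    using z(2)[of t] ab by auto
qed

section \<open>Antiderivatives, integrals over half-lines and a comparison argument\<close>

lemma continuous_has_antiderivative: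
  fixes f :: "real \<Rightarrow> real"
  assumes "\<And>y. isCont f y"
  obtains F where "\<And>y. (F has_real_derivative f y) (at y)" "F a = 0"
proof -
  have "\<exists>F. \<forall>x :: real. -\<infinity> < ereal x \<longrightarrow> ereal x < \<infinity> \<longrightarrow> (F has_vector_derivative f x) (at x)"
    using assms by (intro einterval_antiderivative) auto
  then obtain F where F: "\<And>x. (F has_real_derivative f x) (at x)"
    by (auto simp: has_real_derivative_iff_has_vector_derivative)
  show thesis
    by (rule that[of "\<lambda>y. F y - F a"]) (auto intro!: derivative_eq_intros F)
qed

lemma integral_FTC_at_top_nonneg:
  fixes F f :: "real \<Rightarrow> real"
  assumes F: "\<And>y. (F has_real_derivative f y) (at y)" and f: "\<And>y. isCont f y"
    and nonneg: "\<And>y. 0 \<le> f y" and lim: "(F \<longlongrightarrow> T) at_top"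
  shows "set_integrable lborel {a..} f" and "(LINT y:{a..}|lborel. f y) = T - F a"
proof -
  have meas [measurable]: "f \<in> borel_measurable borel"
    using f by (intro borel_measurable_continuous_onI continuous_at_imp_continuous_on) auto
  have mono: "F a \<le> F y" if "a \<le> y" for y
    using that F nonneg by (intro DERIV_nonneg_imp_nondecreasing[of a y F]) auto
  have "F a \<le> T"
    by (rule tendsto_lowerbound[OF lim]) (auto intro!: mono eventually_at_top_linorderI[of a])
  have nn: "(\<integral>\<^sup>+x. ennreal (indicator {a..} x * f x) \<partial>lborel) = ennreal (T - F a)"
  proof -
    have "(\<integral>\<^sup>+x. ennreal (indicator {a..} x * f x) \<partial>lborel)
        = (\<integral>\<^sup>+x. ennreal (f x) * indicator {a ..} x \<partial>lborel)"
      by (intro nn_integral_cong) (auto simp: indicator_def)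
    also have "\<dots> = ennreal (T - F a)"
      using F nonneg lim by (intro nn_integral_FTC_atLeast) auto
    finally show ?thesis .
  qed
  have "has_bochner_integral lborel (\<lambda>x. indicator {a..} x * f x) (T - F a)"
    using nn nonneg \<open>F a \<le> T\<close> by (intro has_bochner_integral_nn_integral) auto
  then show "set_integrable lborel {a..} f" "(LINT y:{a..}|lborel. f y) = T - F a"
    by (auto simp: set_integrable_def set_lebesgue_integral_def has_bochner_integral_iff)
qed

text \<open>Counterpart of the preceding lemma for integrands of either sign: here integrability is
  given and convergence of the antiderivative follows.\<close>

lemma antiderivative_tendsto_at_top:
  fixes F f :: "real \<Rightarrow> real"
  assumes F: "\<And>y. (F has_real_derivative f y) (at y)" and f: "\<And>y. isCont f y"
    and int: "set_integrable lborel {a..} f"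
  shows "(F \<longlongrightarrow> F a + (LINT y:{a..}|lborel. f y)) at_top"
proof -
  have "((\<lambda>y. \<integral>x. indicator {..y} x *\<^sub>R (indicator {a..} x *\<^sub>R f x) \<partial>lborel)
      \<longlongrightarrow> (\<integral>x. indicator {a..} x *\<^sub>R f x \<partial>lborel)) at_top"
    using int by (intro tendsto_integral_at_top) (auto simp: set_integrable_def)
  then have "((\<lambda>y. F a + (\<integral>x. indicator {..y} x *\<^sub>R (indicator {a..} x *\<^sub>R f x) \<partial>lborel))
      \<longlongrightarrow> F a + (LINT y:{a..}|lborel. f y)) at_top"
    unfolding set_lebesgue_integral_def by (intro tendsto_add tendsto_const)
  moreover have "eventually (\<lambda>y. F a + (\<integral>x. indicator {..y} x *\<^sub>R (indicator {a..} x *\<^sub>R f x) \<partial>lborel) = F y) at_top"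
  proof (rule eventually_at_top_linorderI[of a])
    fix y assume "a \<le> y"
    have "(\<integral>x. indicator {..y} x *\<^sub>R (indicator {a..} x *\<^sub>R f x) \<partial>lborel)
        = (\<integral>x. f x * indicator {a..y} x \<partial>lborel)"
      by (intro Bochner_Integration.integral_cong) (auto simp: indicator_def)
    also have "\<dots> = F y - F a"
      using F f \<open>a \<le> y\<close> by (intro integral_FTC_Icc_real) auto
    finally show "F a + (\<integral>x. indicator {..y} x *\<^sub>R (indicator {a..} x *\<^sub>R f x) \<partial>lborel) = F y"
      by simp
  qed
  ultimately show ?thesis
    by (rule Lim_transform_eventually)
qed

text \<open>The slope is controlled only where \<open>g\<close> is at most \<open>c\<close>, so
  \<open>g\<close> must first be shown to stay trapped there; after that \<open>g y + d * y\<close>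
  is nonincreasing.\<close>

lemma decreasing_below_threshold:
  fixes g g' :: "real \<Rightarrow> real"
  assumes g: "\<And>y. y \<ge> a \<Longrightarrow> (g has_real_derivative g' y) (at y)"
    and g': "\<And>y. y \<ge> a \<Longrightarrow> g y \<le> c \<Longrightarrow> g' y \<le> - d"
    and "d > 0" and "g a \<le> c" and "a \<le> y"
  shows "g y \<le> c - d * (y - a)"
proof -
  have cont: "continuous_on {s..t} g" if "a \<le> s" for s t
    using that by (intro continuous_at_imp_continuous_on) (auto intro!: DERIV_isCont[OF g])
  have below: "g z \<le> c" if "a \<le> z" for z
  proof (rule ccontr)
    assume "\<not> g z \<le> c"
    have ne: "compact {s\<in>{a..z}. g s \<le> c}" "{s\<in>{a..z}. g s \<le> c} \<noteq> {}"
    proof -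
      have "closed ({a..z} \<inter> g -` {..c})"
        using cont[of a z] by (intro continuous_closed_preimage) auto
      then have "compact ({a..z} \<inter> ({a..z} \<inter> g -` {..c}))"
        by (intro compact_Int_closed) auto
      moreover have "{a..z} \<inter> ({a..z} \<inter> g -` {..c}) = {s\<in>{a..z}. g s \<le> c}"
        by auto
      ultimately show "compact {s\<in>{a..z}. g s \<le> c}" by simp
    qed (use assms(4) that in auto)
    \<comment> \<open>The last time in \<open>{a..z}\<close> at which \<open>g\<close> is at most
      \<open>c\<close>. The negative derivative at this time produces a later one.\<close>
    obtain s where s: "a \<le> s" "s \<le> z" "g s \<le> c" "\<And>t. a \<le> t \<Longrightarrow> t \<le> z \<Longrightarrow> g t \<le> c \<Longrightarrow> t \<le> s"
      using compact_attains_sup[OF ne] by auto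
    have "s < z"
      using s \<open>\<not> g z \<le> c\<close> by (cases "s = z") auto
    have "g' s < 0"
      using g'[OF s(1,3)] \<open>d > 0\<close> by auto
    from DERIV_neg_dec_right[OF g[OF s(1)] this]
    obtain e where e: "e > 0" "\<And>t. t > 0 \<Longrightarrow> t < e \<Longrightarrow> g (s + t) < g s"
      by blast
    define t where "t = min e (z - s) / 2"
    have "t > 0" "t < e" "s + t \<le> z"
      using e(1) \<open>s < z\<close> by (auto simp: t_def min_def field_simps)
    then show False
      using e(2)[of t] s(4)[of "s + t"] s(1,3) by auto
  qed
  have "(\<lambda>y. g y + d * y) y \<le> (\<lambda>y. g y + d * y) a"
  proof (rule DERIV_nonpos_imp_nonincreasing[where f = "\<lambda>y. g y + d * y", OF assms(5)])
    fix s assume "a \<le> s" "s \<le> y"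
    then show "\<exists>y. ((\<lambda>y. g y + d * y) has_real_derivative y) (at s) \<and> y \<le> 0"
      using g'[of s] below[of s]
      by (intro exI[of _ "g' s + d"] conjI) (auto intro!: derivative_eq_intros g)
  qed
  then show ?thesis
    using assms(4) by (simp add: algebra_simps)
qed

section \<open>Solutions of the homogeneous equation\<close>

lemma homogeneous_solutionD:
  assumes "homogeneous_solution \<sigma> \<mu> \<gamma> f" and "0 < \<sigma>"
  shows "(f has_real_derivative deriv f y) (at y)"
    and "(deriv f has_real_derivative 2 / \<sigma>\<^sup>2 * (\<gamma> * f y - \<mu> y * deriv f y)) (at y)"
proof -
  show "(f has_real_derivative deriv f y) (at y)"
    using assms(1) by (simp add: homogeneous_solution_def DERIV_deriv_iff_real_differentiable)
  have "(deriv f has_real_derivative deriv (deriv f) y) (at y)"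
    using assms(1) by (simp add: homogeneous_solution_def DERIV_deriv_iff_real_differentiable)
  moreover have "deriv (deriv f) y = 2 / \<sigma>\<^sup>2 * (\<gamma> * f y - \<mu> y * deriv f y)"
  proof -
    have "\<sigma>\<^sup>2 / 2 * deriv (deriv f) y = \<gamma> * f y - \<mu> y * deriv f y"
      using assms(1) by (auto simp: homogeneous_solution_def generator_def algebra_simps)
    then have "2 / \<sigma>\<^sup>2 * (\<sigma>\<^sup>2 / 2 * deriv (deriv f) y) = 2 / \<sigma>\<^sup>2 * (\<gamma> * f y - \<mu> y * deriv f y)"
      by (rule arg_cong)
    then show ?thesis
      using assms(2) by simp
  qed
  ultimately show "(deriv f has_real_derivative 2 / \<sigma>\<^sup>2 * (\<gamma> * f y - \<mu> y * deriv f y)) (at y)"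
    by simp
qed

lemma nonvanishing_imp_constant_sign:
  fixes f :: "real \<Rightarrow> real"
  assumes "continuous_on UNIV f" "\<And>y. f y \<noteq> 0"
  shows "0 < sgn (f 0) * f y"
proof (rule ccontr)
  assume *: "\<not> 0 < sgn (f 0) * f y"
  have conn: "is_interval (f ` UNIV)"
    using connected_continuous_image[OF assms(1) connected_UNIV] by (simp add: is_interval_connected_1)
  have "0 \<in> range f"
    using mem_is_interval_1_I[OF conn, of "f 0" "f y" 0] mem_is_interval_1_I[OF conn, of "f y" "f 0" 0] * assms(2)[of 0]
    by (auto simp: sgn_if split: if_splits)
  then show False
    using assms(2) by auto
qed

text \<open>If \<phi> vanished at \<open>a\<close>, the maximum principle for both \<phi> and its
  negative would make it vanish on all of \<open>[a, \<infinity>)\<close>. At the interior point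
  \<open>a + 1\<close> its derivative would be zero as well, and so would the Wronskian.\<close>

lemma homogeneous_solution_nonvanishing:
  assumes \<sigma>: "0 < \<sigma>" and \<gamma>: "0 < \<gamma>" and sol: "homogeneous_solution \<sigma> \<mu> \<gamma> \<phi>"
    and W: "\<And>y. wronskian \<phi> \<eta> y \<noteq> 0" and lim: "(\<phi> \<longlongrightarrow> 0) at_top"
  shows "\<phi> a \<noteq> 0"
proof
  assume a: "\<phi> a = 0"
  note d = homogeneous_solutionD[OF sol \<sigma>]
  have le: "c * \<phi> y \<le> 0" if "a \<le> y" for c y
  proof (rule maximum_principle_at_top[where f = "\<lambda>y. c * \<phi> y" and f' = "\<lambda>y. c * deriv \<phi> y", OF _ _ _ _ that])
    show "((\<lambda>y. c * \<phi> y) has_real_derivative c * deriv \<phi> y) (at y)" for y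
      by (intro DERIV_cmult d)
    show "\<exists>e>0. ((\<lambda>y. c * deriv \<phi> y) has_real_derivative e) (at y)"
      if "c * deriv \<phi> y = 0" "0 < c * \<phi> y" for y
    proof (intro exI conjI)
      have "c * (2 / \<sigma>\<^sup>2 * (\<gamma> * \<phi> y - \<mu> y * deriv \<phi> y)) = 2 / \<sigma>\<^sup>2 * (\<gamma> * (c * \<phi> y))"
        using that by (auto simp: algebra_simps)
      also have "0 < 2 / \<sigma>\<^sup>2 * (\<gamma> * (c * \<phi> y))"
        using that \<gamma> \<sigma> by simp
      finally show "0 < c * (2 / \<sigma>\<^sup>2 * (\<gamma> * \<phi> y - \<mu> y * deriv \<phi> y))" .
    qed (intro DERIV_cmult d)
    show "eventually (\<lambda>y. c * \<phi> y < e) at_top" if "0 < e" for e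
      using order_tendstoD(2)[OF tendsto_mult_left[OF lim, of c], of e] that by simp
    show "c * \<phi> a \<le> 0" using a by simp
  qed
  have zero: "\<phi> y = 0" if "a \<le> y" for y
    using le[OF that, of 1] le[OF that, of "-1"] by simp
  have "deriv \<phi> (a + 1) = 0"
  proof (rule DERIV_local_const[OF d(1), of 1])
    show "\<forall>y. \<bar>a + 1 - y\<bar> < 1 \<longrightarrow> \<phi> (a + 1) = \<phi> y"
      using zero by auto
  qed simp
  then show False
    using W[of "a + 1"] zero[of "a + 1"] by (simp add: wronskian_def)
qed

text \<open>Abel's identity: the terms with \<gamma> cancel because both functions solve the
  equation for the same \<gamma>.\<close>

lemma wronskian_DERIV:
  assumes \<sigma>: "0 < \<sigma>" and f: "homogeneous_solution \<sigma> \<mu> \<gamma> f" and g: "homogeneous_solution \<sigma> \<mu> \<gamma> g"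
  shows "(wronskian f g has_real_derivative - (2 * \<mu> y / \<sigma>\<^sup>2) * wronskian f g y) (at y)"
proof -
  note df = homogeneous_solutionD[OF f \<sigma>] and dg = homogeneous_solutionD[OF g \<sigma>]
  show ?thesis
    unfolding wronskian_def[abs_def]
    by (rule DERIV_cong[OF DERIV_diff[OF DERIV_mult[OF df(1) dg(2)] DERIV_mult[OF df(2) dg(1)]]])
      (simp add: algebra_simps diff_divide_distrib)
qed

section \<open>Doob's transform by \<open>F\<close>\<close>

locale transformed_system =
  fixes \<sigma> \<Gamma> \<alpha> :: real and \<mu> F \<phi> \<eta> :: "real \<Rightarrow> real"
  assumes \<sigma>: "0 < \<sigma>" and \<Gamma>: "0 < \<Gamma>" and \<alpha>: "0 < \<alpha>"
    and system: "homogeneous_system \<sigma> \<mu> (\<alpha> + \<Gamma>) \<phi> \<eta>"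
    and F: "homogeneous_solution \<sigma> \<mu> \<Gamma> F" and F_pos: "\<And>y. 0 < F y"
begin

lemma \<phi>: "homogeneous_solution \<sigma> \<mu> (\<alpha> + \<Gamma>) \<phi>" and \<eta>: "homogeneous_solution \<sigma> \<mu> (\<alpha> + \<Gamma>) \<eta>"
  and W_nz: "wronskian \<phi> \<eta> y \<noteq> 0" and \<phi>_lim: "(\<phi> \<longlongrightarrow> 0) at_top"
  using system by (auto simp: homogeneous_system_def)

lemma \<phi>_nz: "\<phi> y \<noteq> 0"
  using \<alpha> \<Gamma> by (intro homogeneous_solution_nonvanishing[OF \<sigma> _ \<phi> W_nz \<phi>_lim]) simp

lemmas D\<phi> = homogeneous_solutionD[OF \<phi> \<sigma>]
lemmas DF = homogeneous_solutionD[OF F \<sigma>]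

definition drift :: "real \<Rightarrow> real" where
  "drift y = \<mu> y + \<sigma>\<^sup>2 * (deriv F y / F y)"

text \<open>Dividing a solution of the equation for \<open>\<alpha> + \<Gamma>\<close> by \<open>F\<close> (Doob's transform) gives a solution of
  \<open>\<sigma>\<^sup>2/2 u'' + m u' = \<alpha> u\<close>, where \<open>m\<close> is the drift of the process. Likewise \<open>s\<close> is the density of its
  scale function. The signs make both positive.\<close>

definition u :: "real \<Rightarrow> real" where
  "u y = sgn (\<phi> 0) * \<phi> y / F y"

definition u' :: "real \<Rightarrow> real" where
  "u' y = sgn (\<phi> 0) * (deriv \<phi> y * F y - \<phi> y * deriv F y) / (F y)\<^sup>2"

definition s :: "real \<Rightarrow> real" where
  "s y = sgn (wronskian \<phi> \<eta> 0) * wronskian \<phi> \<eta> y / (F y)\<^sup>2"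

lemma F_nz [simp]: "F y \<noteq> 0"
  using F_pos[of y] by simp

lemma u: "(u has_real_derivative u' y) (at y)"
  unfolding u_def[abs_def] u'_def
  by (rule DERIV_cong[OF DERIV_divide[OF DERIV_cmult[OF D\<phi>(1)] DF(1)]])
    (simp_all add: power2_eq_square algebra_simps)

text \<open>In the quotient rule the zeroth-order coefficients subtract,
  \<open>(\<alpha> + \<Gamma>) - \<Gamma> = \<alpha>\<close>, and the cross term with
  \<open>deriv F / F\<close> is exactly what \<open>drift\<close> adds to \<mu>.\<close>

lemma u': "(u' has_real_derivative 2 / \<sigma>\<^sup>2 * (\<alpha> * u y - drift y * u' y)) (at y)"
proof -
  have "((\<lambda>y. sgn (\<phi> 0) * (deriv \<phi> y * F y - \<phi> y * deriv F y) / (F y)\<^sup>2) has_real_derivative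
    ((sgn (\<phi> 0) * ((2 / \<sigma>\<^sup>2 * ((\<alpha> + \<Gamma>) * \<phi> y - \<mu> y * deriv \<phi> y)) * F y + deriv F y * deriv \<phi> y
       - (deriv \<phi> y * deriv F y + (2 / \<sigma>\<^sup>2 * (\<Gamma> * F y - \<mu> y * deriv F y)) * \<phi> y))) * (F y)\<^sup>2
      - (sgn (\<phi> 0) * (deriv \<phi> y * F y - \<phi> y * deriv F y)) * (of_nat 2 * (deriv F y * F y ^ (2 - Suc 0))))
      / ((F y)\<^sup>2 * (F y)\<^sup>2)) (at y)"
    by (intro DERIV_divide DERIV_cmult DERIV_diff DERIV_mult D\<phi> DF DERIV_power) simp
  then show ?thesis
    unfolding u'_def[abs_def] u_def drift_def
    by (rule DERIV_cong) (use \<sigma> in \<open>simp add: divide_simps power2_eq_square, simp add: algebra_simps\<close>)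
qed

text \<open>Abel's identity supplies the part with \<mu>; the factor \<open>1 / (F y)^2\<close>
  contributes the logarithmic derivative \<open>- 2 * deriv F y / F y\<close>, which is the
  remaining part of the drift.\<close>

lemma s: "(s has_real_derivative - (2 * drift y / \<sigma>\<^sup>2) * s y) (at y)"
proof -
  have "((\<lambda>y. sgn (wronskian \<phi> \<eta> 0) * wronskian \<phi> \<eta> y / (F y)\<^sup>2) has_real_derivative
    ((sgn (wronskian \<phi> \<eta> 0) * (- (2 * \<mu> y / \<sigma>\<^sup>2) * wronskian \<phi> \<eta> y)) * (F y)\<^sup>2
      - (sgn (wronskian \<phi> \<eta> 0) * wronskian \<phi> \<eta> y) * (of_nat 2 * (deriv F y * F y ^ (2 - Suc 0))))
      / ((F y)\<^sup>2 * (F y)\<^sup>2)) (at y)"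
    by (intro DERIV_divide DERIV_cmult wronskian_DERIV[OF \<sigma> \<phi> \<eta>] DF DERIV_power) simp
  then show ?thesis
    unfolding s_def[abs_def] drift_def
    by (rule DERIV_cong) (use \<sigma> in \<open>simp add: divide_simps power2_eq_square, simp add: algebra_simps\<close>)
qed

lemma continuous_\<phi>: "continuous_on UNIV \<phi>"
  using DERIV_isCont[OF D\<phi>(1)] by (intro continuous_at_imp_continuous_on) auto

lemma u_pos: "0 < u y"
  using nonvanishing_imp_constant_sign[OF continuous_\<phi> \<phi>_nz] F_pos[of y] by (simp add: u_def)

lemma s_pos: "0 < s y"
proof -
  have "continuous_on UNIV (wronskian \<phi> \<eta>)"
    using DERIV_isCont[OF wronskian_DERIV[OF \<sigma> \<phi> \<eta>]] by (intro continuous_at_imp_continuous_on) auto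
  from nonvanishing_imp_constant_sign[OF this W_nz] show ?thesis
    using F_pos[of y] by (simp add: s_def)
qed

text \<open>Maximum principle for \<open>\<bar>\<phi>\<bar> - u a * F\<close>, a subsolution of the equation for \<open>\<Gamma>\<close> that vanishes at \<open>a\<close>
  and is dominated by \<open>\<bar>\<phi>\<bar> \<rightarrow> 0\<close> at infinity; nothing is assumed about \<open>F\<close> there.\<close>

lemma u_antimono:
  assumes "a \<le> y"
  shows "u y \<le> u a"
proof -
  define e where "e = sgn (\<phi> 0)"
  define c where "c = u a"
  define f where "f y = e * \<phi> y - c * F y" for y
  have e\<phi>: "0 < e * \<phi> y" for y
    unfolding e_def by (rule nonvanishing_imp_constant_sign[OF continuous_\<phi> \<phi>_nz])
  have "c > 0"
    using u_pos by (simp add: c_def)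
  have "f y \<le> 0"
  proof (rule maximum_principle_at_top[where f = f and f' = "\<lambda>y. e * deriv \<phi> y - c * deriv F y", OF _ _ _ _ assms])
    show "(f has_real_derivative e * deriv \<phi> y - c * deriv F y) (at y)" for y
      unfolding f_def[abs_def] by (intro DERIV_diff DERIV_cmult D\<phi> DF)
    show "\<exists>d>0. ((\<lambda>y. e * deriv \<phi> y - c * deriv F y) has_real_derivative d) (at y)"
      if "e * deriv \<phi> y - c * deriv F y = 0" "0 < f y" for y
    proof (intro exI conjI)
      have "e * (2 / \<sigma>\<^sup>2 * ((\<alpha> + \<Gamma>) * \<phi> y - \<mu> y * deriv \<phi> y)) - c * (2 / \<sigma>\<^sup>2 * (\<Gamma> * F y - \<mu> y * deriv F y))
        = 2 / \<sigma>\<^sup>2 * (\<alpha> * (e * \<phi> y) + \<Gamma> * f y - \<mu> y * (e * deriv \<phi> y - c * deriv F y))"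
        by (simp add: f_def algebra_simps add_divide_distrib)
      also have "\<dots> > 0"
        unfolding that(1) using e\<phi>[of y] that(2) \<alpha> \<Gamma> \<sigma> by (simp add: add_pos_pos)
      finally show "0 < e * (2 / \<sigma>\<^sup>2 * ((\<alpha> + \<Gamma>) * \<phi> y - \<mu> y * deriv \<phi> y)) - c * (2 / \<sigma>\<^sup>2 * (\<Gamma> * F y - \<mu> y * deriv F y))" .
    qed (intro DERIV_diff DERIV_cmult D\<phi> DF)
    show "eventually (\<lambda>y. f y < \<epsilon>) at_top" if "0 < \<epsilon>" for \<epsilon>
    proof (rule eventually_mono)
      show "eventually (\<lambda>y. e * \<phi> y < \<epsilon>) at_top"
        using order_tendstoD(2)[OF tendsto_mult_left[OF \<phi>_lim, of e], of \<epsilon>] that by simp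
      show "f y < \<epsilon>" if "e * \<phi> y < \<epsilon>" for y
        using that mult_pos_pos[OF \<open>c > 0\<close> F_pos[of y]] by (simp add: f_def)
    qed
    show "f a \<le> 0"
      by (simp add: f_def c_def u_def e_def)
  qed
  then show ?thesis
    using F_pos[of y] by (simp add: f_def c_def[symmetric] u_def[of y] e_def[symmetric] field_simps)
qed

text \<open>Strictness matters because \<open>u'\<close> is divided by later. At a zero of
  \<open>u'\<close> the equation gives a positive second derivative, so \<open>u\<close> would rise
  to the right, against monotonicity.\<close>

lemma u'_neg: "u' a < 0"
proof -
  have "u' a \<le> 0"
  proof (rule ccontr)
    assume "\<not> u' a \<le> 0"
    then obtain d where "0 < d" "\<And>t. 0 < t \<Longrightarrow> t < d \<Longrightarrow> u a < u (a + t)"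
      using DERIV_pos_inc_right[OF u, of a] by auto
    from this(2)[of "d / 2"] this(1) show False
      using u_antimono[of a "a + d / 2"] by simp
  qed
  moreover have "u' a \<noteq> 0"
  proof
    assume z: "u' a = 0"
    have "0 < 2 / \<sigma>\<^sup>2 * (\<alpha> * u a - drift a * u' a)"
      using z u_pos[of a] \<alpha> \<sigma> by simp
    from DERIV_pos_not_local_max[OF u z u' this, of "a + 1"]
    obtain y where "a < y" "u a < u y"
      by auto
    then show False
      using u_antimono[of a y] by simp
  qed
  ultimately show ?thesis by simp
qed

text \<open>This and the two following identities translate the ingredients of the claimed formula
  into \<open>u\<close>, \<open>u'\<close> and \<open>s\<close>. The signs that they introduce
  cancel between the prefactor and the integral.\<close>

lemma wronskian_\<phi>_F: "wronskian \<phi> F y = - sgn (\<phi> 0) * (F y)\<^sup>2 * u' y"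
  using \<phi>_nz[of 0] by (simp add: wronskian_def u'_def sgn_if)

lemma wronskian_\<phi>_\<eta>: "wronskian \<phi> \<eta> y = sgn (wronskian \<phi> \<eta> 0) * (F y)\<^sup>2 * s y"
  using W_nz[of 0] by (simp add: s_def sgn_if)

lemma \<phi>_eq: "\<phi> y = sgn (\<phi> 0) * F y * u y"
  using \<phi>_nz[of 0] by (simp add: u_def sgn_if)

end

section \<open>The decreasing solution and the value function\<close>

lemma DERIV_at_imp_deriv_bound:
  fixes f f' :: "real \<Rightarrow> real"
  assumes "\<And>y. (f has_real_derivative f' y) (at y)" and "\<And>y. \<bar>f' y\<bar> \<le> B"
  shows "\<bar>f x - f y\<bar> \<le> B * \<bar>x - y\<bar>"
  using field_differentiable_bound[of UNIV f f' B x y] assms by auto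

locale decreasing_solution =
  fixes \<sigma> \<alpha> B H :: real and m m' u u' s h h' :: "real \<Rightarrow> real"
  assumes \<sigma>: "0 < \<sigma>" and \<alpha>: "0 < \<alpha>"
    and m: "\<And>y. (m has_real_derivative m' y) (at y)" and m'_bound: "\<And>y. \<bar>m' y\<bar> \<le> B"
    and u: "\<And>y. (u has_real_derivative u' y) (at y)"
    and u': "\<And>y. (u' has_real_derivative 2 / \<sigma>\<^sup>2 * (\<alpha> * u y - m y * u' y)) (at y)"
    and u_pos: "\<And>y. 0 < u y" and u'_neg: "\<And>y. u' y < 0"
    and s: "\<And>y. (s has_real_derivative - (2 * m y / \<sigma>\<^sup>2) * s y) (at y)"
    and s_pos: "\<And>y. 0 < s y"
    and h: "\<And>y. (h has_real_derivative h' y) (at y)"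
    and h_mono: "mono h" and h_bound: "\<And>y. \<bar>h y\<bar> \<le> H"
begin

lemma \<sigma>2_pos: "0 < \<sigma>\<^sup>2"
  using \<sigma> by simp

lemma isCont [simp]:
  "isCont m y" "isCont u y" "isCont u' y" "isCont s y" "isCont h y"
  by (rule DERIV_isCont[OF m] DERIV_isCont[OF u] DERIV_isCont[OF u'] DERIV_isCont[OF s] DERIV_isCont[OF h])+

lemma nz [simp]: "u y \<noteq> 0" "s y \<noteq> 0" "u' y \<noteq> 0" "\<sigma> \<noteq> 0"
  using u_pos[of y] s_pos[of y] u'_neg[of y] \<sigma> by auto

text \<open>Divergence form of the equation for \<open>u\<close>: \<open>1 / s\<close> is the
  integrating factor that absorbs the drift.\<close>

lemma DERIV_u'_over_s:
  "((\<lambda>y. u' y / s y) has_real_derivative 2 * \<alpha> * u y / (\<sigma>\<^sup>2 * s y)) (at y)"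
  by (auto intro!: derivative_eq_intros u' s simp: field_simps power2_eq_square)

text \<open>The ratio \<open>r = u / (- u')\<close> solves the Riccati equation \<open>r' = - 1 + 2/\<sigma>\<^sup>2 r (\<alpha> r + m)\<close>. As \<open>m\<close> grows at
  most linearly, \<open>r'\<close> is bounded away from zero once \<open>r\<close> is below \<open>c / (1 + y)\<close>, and \<open>r\<close> would reach
  zero in finite time.\<close>

lemma quotient_lower_bound:
  obtains c where "0 < c" "c \<le> 1" "\<And>y. y \<ge> 0 \<Longrightarrow> c * (- u' y) \<le> u y * (1 + y)"
proof -
  define C where "C = \<bar>m 0\<bar> + B + 1"
  have "B \<ge> 0"
    using m'_bound[of 0] by linarith
  then have C: "C > 0"
    by (auto simp: C_def)
  have mC: "m y \<le> C * (1 + y)" if "y \<ge> 0" for y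
  proof -
    have "m y \<le> \<bar>m 0\<bar> + B * y"
      using DERIV_at_imp_deriv_bound[OF m m'_bound, of y 0] that by auto
    also have "\<dots> \<le> C * (1 + y)"
      using that \<open>B \<ge> 0\<close> by (auto simp: C_def algebra_simps)
    finally show ?thesis .
  qed
  \<comment> \<open>While \<open>r y * (1 + y)\<close> is at most \<open>c\<close>, the second entry
    of the minimum keeps the positive part of \<open>r'\<close> below 1/2, so \<open>r'\<close> is
    at most -1/2. The entry 1/4 bounds the term \<open>r y\<close> of the product rule, which leaves
    a slope of at most -1/4 for \<open>r y * (1 + y)\<close>.\<close>
  define c where "c = min (1/4) (\<sigma>\<^sup>2 / (4 * (\<alpha> + C)))"
  have c: "0 < c" "c \<le> 1 / 4"
    using \<sigma>2_pos \<alpha> C unfolding c_def by (simp, metis min.cobounded1)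
  have "c \<le> \<sigma>\<^sup>2 / (4 * (\<alpha> + C))"
    unfolding c_def by (rule min.cobounded2)
  then have c2: "2 / \<sigma>\<^sup>2 * (c * (\<alpha> + C)) \<le> 1 / 2"
    using \<sigma>2_pos \<alpha> C by (simp add: field_simps)
  define r where "r = (\<lambda>y. u y / (- u' y))"
  have r_pos: "r y > 0" for y
    using u_pos[of y] u'_neg[of y] by (auto simp: r_def divide_pos_neg)
  define r' where "r' = (\<lambda>y. - 1 + 2 / \<sigma>\<^sup>2 * (r y * (\<alpha> * r y + m y)))"
  have r: "(r has_real_derivative r' y) (at y)" for y
    unfolding r_def r'_def
    by (auto intro!: derivative_eq_intros u u' simp: field_simps power2_eq_square)
  have bound: "c \<le> r a * (1 + a)" if "a \<ge> 0" for a
  proof (rule ccontr)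
    assume *: "\<not> c \<le> r a * (1 + a)"
    let ?g = "\<lambda>y. r y * (1 + y)" and ?g' = "\<lambda>y. r' y * (1 + y) + r y"
    have le: "?g y \<le> c - 1 / 4 * (y - a)" if "a \<le> y" for y
    proof (rule decreasing_below_threshold[where g = ?g and g' = ?g'])
      fix y assume "a \<le> y"
      then have y: "y \<ge> 0" using \<open>a \<ge> 0\<close> by simp
      show "(?g has_real_derivative ?g' y) (at y)"
        by (auto intro!: derivative_eq_intros r)
      show "?g' y \<le> - (1 / 4)" if "?g y \<le> c"
      proof -
        have ry: "r y \<le> c"
        proof -
          have "r y * 1 \<le> r y * (1 + y)"
            using r_pos[of y] y by (intro mult_left_mono) auto
          with that show ?thesis by linarith
        qed
        have "r y * (\<alpha> * r y + m y) \<le> c * (\<alpha> + C)"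
        proof -
          have "r y * (\<alpha> * r y) \<le> c * \<alpha>"
            using ry r_pos[of y] c \<alpha> mult_mono[of "r y" c "\<alpha> * r y" \<alpha>] by auto
          moreover have "r y * m y \<le> r y * (C * (1 + y))"
            using mC[OF y] r_pos[of y] by auto
          moreover have "r y * (C * (1 + y)) = C * ?g y"
            by simp
          moreover have "C * ?g y \<le> C * c"
            using that C by auto
          ultimately show ?thesis
            by (simp add: algebra_simps)
        qed
        then have "2 / \<sigma>\<^sup>2 * (r y * (\<alpha> * r y + m y)) \<le> 2 / \<sigma>\<^sup>2 * (c * (\<alpha> + C))"
          using \<sigma>2_pos by (intro mult_left_mono) auto
        then have "r' y \<le> - (1 / 2)"
          using c2 unfolding r'_def by linarith
        then have "r' y * (1 + y) \<le> - (1 / 2) * (1 + y)"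
          using y by (intro mult_right_mono) auto
        also have "- (1 / 2) * (1 + y) \<le> - (1 / 2)"
          using y by simp
        finally show ?thesis
          using order.trans[OF ry c(2)] by linarith
      qed
    qed (use * that in auto)
    \<comment> \<open>A function below \<open>c\<close> that falls with slope at most -1/4 is used
      up after time \<open>4 * c\<close>; but \<open>?g\<close> is positive.\<close>
    have "?g (a + 4 * c) \<le> 0"
      using le[of "a + 4 * c"] c by auto
    then show False
    proof -
      have "0 < r (a + 4 * c) * (1 + (a + 4 * c))"
        using r_pos c that by (intro mult_pos_pos) auto
      with \<open>?g (a + 4 * c) \<le> 0\<close> show False by linarith
    qed
  qed
  show thesis
  proof (rule that[OF c(1)])
    show "c \<le> 1" using c by auto
    show "c * (- u' y) \<le> u y * (1 + y)" if "y \<ge> 0" for y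
      using bound[OF that] u'_neg[of y] by (simp add: r_def field_simps)
  qed
qed

text \<open>This says that \<open>+\<infinity>\<close> is not an exit boundary. By the previous bound the logarithmic derivative of
  \<open>- u' / s\<close> is at most \<open>- \<kappa> / (1 + y)\<close>, which gives polynomial decay.\<close>

lemma u'_over_s_tendsto_0: "((\<lambda>y. u' y / s y) \<longlongrightarrow> 0) at_top"
proof -
  obtain c where c: "0 < c" "c \<le> 1" and bound: "\<And>y. y \<ge> 0 \<Longrightarrow> c * (- u' y) \<le> u y * (1 + y)"
    using quotient_lower_bound by metis
  \<comment> \<open>The exponent for which the two terms in the derivative of \<open>?q\<close>
    combine into a nonnegative multiple of \<open>c * (- u' t) - u t * (1 + t)\<close>, which
    \<open>bound\<close> makes nonpositive.\<close>
  define \<kappa> where "\<kappa> = 2 * \<alpha> * c / \<sigma>\<^sup>2"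
  have \<kappa>: "\<kappa> > 0"
    using c \<alpha> \<sigma>2_pos by (auto simp: \<kappa>_def)
  let ?q = "\<lambda>y. - (u' y / s y) * (1 + y) powr \<kappa>"
  have le: "?q y \<le> ?q 0" if "0 \<le> y" for y
  proof (rule DERIV_nonpos_imp_nonincreasing[where f = ?q, OF that])
    fix t assume t: "0 \<le> t" "t \<le> y"
    have "(?q has_real_derivative - (2 * \<alpha> * u t / (\<sigma>\<^sup>2 * s t)) * (1 + t) powr \<kappa>
        + - (u' t / s t) * (\<kappa> * (1 + t) powr (\<kappa> - 1))) (at t)"
    proof -
      have "((\<lambda>y. (1 + y) powr \<kappa>) has_real_derivative \<kappa> * (1 + t) powr (\<kappa> - 1)) (at t)"
        using t by (auto intro!: derivative_eq_intros)
      from DERIV_mult[OF DERIV_minus[OF DERIV_u'_over_s] this] show ?thesis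
        by (simp add: algebra_simps)
    qed
    moreover have "- (2 * \<alpha> * u t / (\<sigma>\<^sup>2 * s t)) * (1 + t) powr \<kappa>
        + - (u' t / s t) * (\<kappa> * (1 + t) powr (\<kappa> - 1)) \<le> 0"
    proof -
      have eq: "(1 + t) powr \<kappa> = (1 + t) * (1 + t) powr (\<kappa> - 1)"
        using t powr_mult_base[of "1 + t" "\<kappa> - 1"] by auto
      have "- (2 * \<alpha> * u t / (\<sigma>\<^sup>2 * s t)) * (1 + t) powr \<kappa>
          + - (u' t / s t) * (\<kappa> * (1 + t) powr (\<kappa> - 1))
        = (2 * \<alpha> / (\<sigma>\<^sup>2 * s t)) * (1 + t) powr (\<kappa> - 1) * (c * (- u' t) - u t * (1 + t))"
      proof -
        define P where "P = (1 + t) powr (\<kappa> - 1)"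
        show ?thesis
          unfolding eq P_def[symmetric] by (simp add: \<kappa>_def field_simps)
      qed
      also have "\<dots> \<le> 0"
        using bound[of t] t \<alpha> s_pos[of t] \<sigma>2_pos by (intro mult_nonneg_nonpos) auto
      finally show ?thesis .
    qed
    ultimately show "\<exists>z. (?q has_real_derivative z) (at t) \<and> z \<le> 0"
      by blast
  qed
  have "((\<lambda>y. ?q 0 * (1 + y) powr - \<kappa>) \<longlongrightarrow> 0) at_top"
    using \<kappa> by (intro tendsto_mult_right_zero tendsto_neg_powr filterlim_tendsto_add_at_top[of _ 1])
      (auto intro: filterlim_ident)
  moreover have "eventually (\<lambda>y. norm (u' y / s y) \<le> ?q 0 * (1 + y) powr - \<kappa>) at_top"
  proof (rule eventually_at_top_linorderI[of 0])
    fix y :: real assume y: "0 \<le> y"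
    have "norm (u' y / s y) = - (u' y / s y)"
      using u'_neg[of y] s_pos[of y] by (auto simp: divide_neg_pos abs_of_neg)
    also have "\<dots> = ?q y * (1 + y) powr - \<kappa>"
      using y by (simp add: mult.assoc powr_add[symmetric])
    also have "\<dots> \<le> ?q 0 * (1 + y) powr - \<kappa>"
      using le[OF y] by (intro mult_right_mono) auto
    finally show "norm (u' y / s y) \<le> ?q 0 * (1 + y) powr - \<kappa>" .
  qed
  ultimately show ?thesis
    by (rule Lim_null_comparison[rotated])
qed

section \<open>The speed density, the index and its continuity\<close>

text \<open>The speed density of the diffusion is \<open>2 / (\<sigma>\<^sup>2 * s y)\<close>; the
  weight \<open>u\<close> is already included here.\<close>

definition speed :: "real \<Rightarrow> real" where
  "speed y = 2 * u y / (\<sigma>\<^sup>2 * s y)"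

lemma speed_pos: "speed y > 0"
  using u_pos[of y] s_pos[of y] \<sigma>2_pos by (auto simp: speed_def)

lemma isCont_speed [simp]: "isCont speed y"
  unfolding speed_def by (intro isCont_divide isCont_mult isCont continuous_const) auto

text \<open>The divergence form makes \<open>u' / s / \<alpha>\<close> an antiderivative. Its limit
  0 at infinity turns the tail mass into the local quantity \<open>- u' / s\<close>; a positive
  limit of the flux would leave a deficit.\<close>

lemma
  shows set_integrable_speed: "set_integrable lborel {a..} speed"
    and integral_speed: "(LINT y:{a..}|lborel. speed y) = - (u' a / s a) / \<alpha>"
proof -
  have F: "((\<lambda>y. u' y / s y / \<alpha>) has_real_derivative speed y) (at y)" for y
    using DERIV_cdivide[OF DERIV_u'_over_s, of \<alpha> y] \<alpha> by (simp add: speed_def)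
  have lim: "((\<lambda>y. u' y / s y / \<alpha>) \<longlongrightarrow> 0) at_top"
    using tendsto_divide[OF u'_over_s_tendsto_0 tendsto_const[of \<alpha>]] \<alpha> by simp
  from integral_FTC_at_top_nonneg[OF F isCont_speed less_imp_le[OF speed_pos] lim, of a]
  show "set_integrable lborel {a..} speed" "(LINT y:{a..}|lborel. speed y) = - (u' a / s a) / \<alpha>"
    by auto
qed

lemma set_integrable_h_speed: "set_integrable lborel {a..} (\<lambda>y. h y * speed y)"
proof -
  have "isCont (\<lambda>y. h y * speed y) y" for y
    by (intro isCont_mult isCont isCont_speed)
  then have meas: "(\<lambda>y. h y * speed y) \<in> borel_measurable lborel"
    by (auto intro!: borel_measurable_continuous_onI continuous_at_imp_continuous_on)
  have "set_integrable lborel {a..} (\<lambda>y. H * speed y)"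
    using set_integrable_speed[of a] by auto
  then show ?thesis
  proof (rule set_integrable_bound)
    show "set_borel_measurable lborel {a..} (\<lambda>y. h y * speed y)"
      unfolding set_borel_measurable_def
      by (intro borel_measurable_scaleR borel_measurable_indicator meas) auto
    have "norm (h y * speed y) \<le> norm (H * speed y)" for y
      using h_bound[of y] speed_pos[of y] by (auto simp: abs_mult intro!: mult_right_mono)
    then show "AE y in lborel. y \<in> {a..} \<longrightarrow> norm (h y * speed y) \<le> norm (H * speed y)"
      by auto
  qed
qed

text \<open>By \<open>integral_speed\<close> the prefactor is the reciprocal of \<alpha> times the
  mass of \<open>speed\<close> on \<open>{a..}\<close>.\<close>

definition index :: "real \<Rightarrow> real" where
  "index a = s a / (- u' a) * (LINT y:{a..}|lborel. h y * speed y)"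

lemma isCont_index: "isCont index a"
proof -
  have c: "isCont (\<lambda>y. h y * speed y) y" for y
    by (intro isCont_mult isCont isCont_speed)
  then obtain G where G: "\<And>y. (G has_real_derivative h y * speed y) (at y)"
    using continuous_has_antiderivative[of "\<lambda>y. h y * speed y" 0] by metis
  define A where "A = (LINT y:{0..}|lborel. h y * speed y)"
  have "(LINT y:{a..}|lborel. h y * speed y) = A + G 0 - G a" for a
  proof -
    \<comment> \<open>Both sides are the limit of \<open>G\<close> at infinity, so the tail integral
      depends on \<open>a\<close> only through \<open>G a\<close>.\<close>
    have "G a + (LINT y:{a..}|lborel. h y * speed y) = G 0 + (LINT y:{0..}|lborel. h y * speed y)"
      by (rule tendsto_unique[OF _ antiderivative_tendsto_at_top[OF G c set_integrable_h_speed]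
            antiderivative_tendsto_at_top[OF G c set_integrable_h_speed]])
        (rule trivial_limit_at_top_linorder)
    then show ?thesis by (simp add: A_def)
  qed
  then have "index = (\<lambda>a. s a / (- u' a) * (A + G 0 - G a))"
    by (auto simp: index_def fun_eq_iff)
  moreover have "isCont G a"
    by (rule DERIV_isCont[OF G])
  ultimately show ?thesis
    by (auto intro!: isCont_mult isCont_divide isCont_minus isCont_diff isCont_add)
qed

lemma index_balance: "(LINT y:{a..}|lborel. (\<alpha> * index a - h y) * speed y) = 0"
  and set_integrable_balance: "set_integrable lborel {a..} (\<lambda>y. (c - h y) * speed y)"
proof -
  have 1: "set_integrable lborel {a..} (\<lambda>y. c * speed y)" for c
    using set_integrable_speed[of a] by auto
  have 2: "(\<lambda>y. (c - h y) * speed y) = (\<lambda>y. c * speed y - h y * speed y)" for c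
    by (auto simp: algebra_simps)
  show "set_integrable lborel {a..} (\<lambda>y. (c - h y) * speed y)"
    unfolding 2 using 1[of c] set_integrable_h_speed[of a] by (rule set_integral_diff)
  have "(LINT y:{a..}|lborel. (\<alpha> * index a - h y) * speed y)
      = \<alpha> * index a * (LINT y:{a..}|lborel. speed y) - (LINT y:{a..}|lborel. h y * speed y)"
    unfolding 2 using 1[of "\<alpha> * index a"] set_integrable_h_speed[of a]
    by (subst set_integral_diff) auto
  also have "\<dots> = 0"
    using \<alpha> by (simp add: integral_speed index_def field_simps)
  finally show "(LINT y:{a..}|lborel. (\<alpha> * index a - h y) * speed y) = 0" .
qed

text \<open>The average of an increasing function over \<open>[a, \<infinity>)\<close> is at least
  its first value. This fixes the sign of the right-hand side to the left of \<open>a\<close>, where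
  the value function must be nonnegative too.\<close>

lemma h_le_index: "h a \<le> \<alpha> * index a"
proof -
  have "(LINT y:{a..}|lborel. h a * speed y) \<le> (LINT y:{a..}|lborel. h y * speed y)"
  proof (rule set_integral_mono)
    show "set_integrable lborel {a..} (\<lambda>y. h a * speed y)"
      using set_integrable_speed[of a] by auto
    show "h a * speed y \<le> h y * speed y" if "y \<in> {a..}" for y
      using monoD[OF h_mono, of a y] that speed_pos[of y] by auto
  qed (rule set_integrable_h_speed)
  then have "h a * (- u' a / s a / \<alpha>) \<le> (LINT y:{a..}|lborel. h y * speed y)"
    using integral_speed[of a] by simp
  then have "h a * (- u' a / s a / \<alpha>) * (\<alpha> * (s a / (- u' a)))
      \<le> (LINT y:{a..}|lborel. h y * speed y) * (\<alpha> * (s a / (- u' a)))"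
    using \<alpha> s_pos[of a] u'_neg[of a] by (intro mult_right_mono) (auto simp: divide_pos_neg less_imp_le)
  also have "h a * (- u' a / s a / \<alpha>) * (\<alpha> * (s a / (- u' a))) = h a"
    using \<alpha> by simp
  also have "(LINT y:{a..}|lborel. h y * speed y) * (\<alpha> * (s a / (- u' a))) = \<alpha> * index a"
    by (simp add: index_def)
  finally show ?thesis .
qed

text \<open>Reduction of order: \<open>V = u z\<close> with \<open>(u\<^sup>2 z' / s)' = (\<alpha> M - h) * speed\<close>, where \<open>M\<close> is the value
  of \<open>index\<close> at \<open>a\<close>, started with smooth fit \<open>V a = V' a = 0\<close>. The choice of \<open>M\<close> makes the total mass of the
  right-hand side over \<open>[a, \<infinity>)\<close> zero, which is what keeps \<open>V\<close> nonnegative and bounded on \<open>[a, \<infinity>)\<close>.\<close>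

lemma value_function:
  obtains V V' C where
    "\<And>y. (V has_real_derivative V' y) (at y)"
    "\<And>y. (V' has_real_derivative 2 / \<sigma>\<^sup>2 * (\<alpha> * V y - m y * V' y + \<alpha> * index a - h y)) (at y)"
    "V a = 0" "\<And>y. 0 \<le> V y" "\<And>y. a \<le> y \<Longrightarrow> V y \<le> C"
proof -
  define lam where "lam = \<alpha> * index a"
  define i where "i = (\<lambda>y. (lam - h y) * speed y)"
  have isCont_i: "isCont i y" for y
    unfolding i_def by (intro isCont_mult isCont_diff isCont isCont_speed continuous_const)
  obtain I where I: "\<And>y. (I has_real_derivative i y) (at y)" and I_a: "I a = 0"
    using continuous_has_antiderivative[OF isCont_i, where a = a] by metis
  have isCont_I: "isCont I y" for y
    by (rule DERIV_isCont[OF I])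
  have I_lim: "(I \<longlongrightarrow> 0) at_top"
    using antiderivative_tendsto_at_top[OF I isCont_i, of a] set_integrable_balance[of a lam] index_balance[of a] I_a
    by (simp add: i_def lam_def)
  have h_a: "h a \<le> lam"
    using h_le_index by (simp add: lam_def)
  \<comment> \<open>As \<open>h\<close> is monotone, \<open>i\<close> changes sign at most once.
    Before the change \<open>I\<close> has only risen from 0; after it \<open>I\<close> is still
    falling towards its limit 0.\<close>
  have I_nonneg: "0 \<le> I y" if "a \<le> y" for y
  proof (cases "h y \<le> lam")
    case True
    have "I a \<le> I y"
    proof (rule DERIV_nonneg_imp_nondecreasing[OF that])
      fix t assume "a \<le> t" "t \<le> y"
      then have "0 \<le> i t"
        using True monoD[OF h_mono, of t y] speed_pos[of t] by (simp add: i_def)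
      then show "\<exists>z. (I has_real_derivative z) (at t) \<and> 0 \<le> z"
        using I by blast
    qed
    then show ?thesis using I_a by simp
  next
    case False
    have "I z \<le> I y" if "y \<le> z" for z
    proof (rule DERIV_nonpos_imp_nonincreasing[OF that])
      fix t assume "y \<le> t" "t \<le> z"
      then have "i t \<le> 0"
        using False monoD[OF h_mono, of y t] speed_pos[of t] by (simp add: i_def mult_nonpos_nonneg)
      then show "\<exists>z. (I has_real_derivative z) (at t) \<and> z \<le> 0"
        using I by blast
    qed
    then show ?thesis
      by (intro tendsto_upperbound[OF I_lim]) (auto intro!: eventually_at_top_linorderI[of y])
  qed
  have I_nonpos: "I y \<le> 0" if "y \<le> a" for y
  proof -
    have "I y \<le> I a"
    proof (rule DERIV_nonneg_imp_nondecreasing[OF that])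
      fix t assume "y \<le> t" "t \<le> a"
      then have "0 \<le> i t"
        using h_a monoD[OF h_mono, of t a] speed_pos[of t] by (simp add: i_def)
      then show "\<exists>z. (I has_real_derivative z) (at t) \<and> 0 \<le> z"
        using I by blast
    qed
    then show ?thesis using I_a by simp
  qed
  \<comment> \<open>With this constant the derivative of \<open>C * (u' y / s y)\<close> is
    \<open>(\<bar>lam\<bar> + H) * speed y\<close>, which dominates \<open>i\<close> in absolute
    value. Both \<open>I\<close> and \<open>u' / s\<close> vanish at infinity, so the comparison can
    be integrated from there.\<close>
  define C where "C = (\<bar>lam\<bar> + H) / \<alpha>"
  have "H \<ge> 0"
    using h_bound[of 0] by linarith
  then have C: "C \<ge> 0"
    using \<alpha> by (simp add: C_def)
  have I_le: "I y \<le> C * (- (u' y / s y))" for y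
  proof -
    let ?g = "\<lambda>y. I y + C * (u' y / s y)"
    have g: "(?g has_real_derivative i t + C * (2 * \<alpha> * u t / (\<sigma>\<^sup>2 * s t))) (at t)" for t
      by (intro DERIV_add I DERIV_cmult DERIV_u'_over_s)
    have "0 \<le> i t + C * (2 * \<alpha> * u t / (\<sigma>\<^sup>2 * s t))" for t
    proof -
      have "i t + C * (2 * \<alpha> * u t / (\<sigma>\<^sup>2 * s t)) = (lam - h t + (\<bar>lam\<bar> + H)) * speed t"
        using \<alpha> by (simp add: i_def C_def speed_def field_simps)
      moreover have "0 \<le> lam - h t + (\<bar>lam\<bar> + H)"
        using h_bound[of t] by linarith
      ultimately show ?thesis
        using speed_pos[of t] by simp
    qed
    then have "?g y \<le> ?g z" if "y \<le> z" for z
      using g by (intro DERIV_nonneg_imp_nondecreasing[where f = ?g, OF that]) blast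
    moreover have "(?g \<longlongrightarrow> 0 + C * 0) at_top"
      by (intro tendsto_add tendsto_mult tendsto_const I_lim u'_over_s_tendsto_0)
    ultimately have "?g y \<le> 0 + C * 0"
      by (intro tendsto_lowerbound[where f = ?g and F = at_top]) (auto intro!: eventually_at_top_linorderI[of y])
    then show ?thesis
      by simp
  qed
  define z' where "z' = (\<lambda>y. s y * I y / (u y)\<^sup>2)"
  have "isCont z' y" for y
    unfolding z'_def by (intro isCont_divide isCont_mult isCont isCont_I isCont_power) auto
  then obtain z where z: "\<And>y. (z has_real_derivative z' y) (at y)" and z_a: "z a = 0"
    using continuous_has_antiderivative[of z' a] by metis
  have z_nonneg: "0 \<le> z y" for y
  proof (cases "a \<le> y")
    case True
    have "z a \<le> z y"
    proof (rule DERIV_nonneg_imp_nondecreasing[OF True])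
      fix t assume "a \<le> t" "t \<le> y"
      then have "0 \<le> z' t"
        using I_nonneg[of t] s_pos[of t] by (simp add: z'_def)
      then show "\<exists>w. (z has_real_derivative w) (at t) \<and> 0 \<le> w"
        using z by blast
    qed
    then show ?thesis using z_a by simp
  next
    case False
    then have "y \<le> a" by simp
    have "z a \<le> z y"
    proof (rule DERIV_nonpos_imp_nonincreasing[OF \<open>y \<le> a\<close>])
      fix t assume "y \<le> t" "t \<le> a"
      then have "z' t \<le> 0"
        using I_nonpos[of t] s_pos[of t] by (simp add: z'_def mult_nonneg_nonpos divide_nonpos_nonneg)
      then show "\<exists>w. (z has_real_derivative w) (at t) \<and> w \<le> 0"
        using z by blast
    qed
    then show ?thesis using z_a by simp
  qed
  \<comment> \<open>By \<open>I_le\<close> the derivative of \<open>z\<close> is at most that of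
    \<open>C / u\<close>, and at \<open>a\<close> the difference is nonpositive. Multiplication by
    \<open>u\<close> bounds the value function by \<open>C\<close>.\<close>
  have z_le: "z y \<le> C / u y" if "a \<le> y" for y
  proof -
    let ?g = "\<lambda>y. z y - C / u y"
    have g: "(?g has_real_derivative z' t + C * u' t / (u t)\<^sup>2) (at t)" for t
      by (auto intro!: derivative_eq_intros z u simp: power2_eq_square)
    have "z' t + C * u' t / (u t)\<^sup>2 \<le> 0" for t
    proof -
      have "s t * I t \<le> s t * (C * (- (u' t / s t)))"
        using I_le[of t] s_pos[of t] by (intro mult_left_mono) auto
      then have "s t * I t + C * u' t \<le> 0"
        by simp
      then have "(s t * I t + C * u' t) / (u t)\<^sup>2 \<le> 0"
        by (intro divide_nonpos_nonneg) auto
      then show ?thesis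
        by (simp add: z'_def add_divide_distrib)
    qed
    then have "?g y \<le> ?g a"
      using g by (intro DERIV_nonpos_imp_nonincreasing[where f = ?g, OF that]) blast
    then show ?thesis
      using z_a C u_pos[of a] by (simp add: divide_nonneg_pos)
         (smt (verit) divide_nonneg_pos)
  qed
  show thesis
  proof (rule that[of "\<lambda>y. u y * z y" "\<lambda>y. u' y * z y + s y * I y / u y" C])
    show "((\<lambda>y. u y * z y) has_real_derivative u' y * z y + s y * I y / u y) (at y)" for y
      by (auto intro!: derivative_eq_intros u z simp: z'_def power2_eq_square)
    show "((\<lambda>y. u' y * z y + s y * I y / u y) has_real_derivative
        2 / \<sigma>\<^sup>2 * (\<alpha> * (u y * z y) - m y * (u' y * z y + s y * I y / u y) + \<alpha> * index a - h y)) (at y)" for y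
      unfolding lam_def[symmetric]
      by (auto intro!: derivative_eq_intros u u' s I z
          simp: z'_def i_def speed_def field_simps power2_eq_square)
    show "u a * z a = 0"
      using z_a by simp
    show "0 \<le> u y * z y" for y
      using z_nonneg[of y] u_pos[of y] by simp
    show "u y * z y \<le> C" if "a \<le> y" for y
      using z_le[OF that] u_pos[of y] by (simp add: field_simps)
  qed
qed

end

section \<open>Dynkin's formula for processes with bounded drift\<close>

text \<open>Time is rounded down to a grid of mesh \<open>1 / Suc n\<close>. The rounded process
  takes countably many times only, hence is jointly measurable, and continuity of the paths gives
  the limit.\<close>

lemma measurable_continuous_process:
  fixes Z :: "real \<Rightarrow> 'a \<Rightarrow> real"
  assumes Z [measurable]: "\<And>t. Z t \<in> borel_measurable M"
    and cont: "\<And>w. w \<in> space M \<Longrightarrow> continuous_on UNIV (\<lambda>t. Z t w)"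
  shows "(\<lambda>p. Z (snd p) (fst p)) \<in> borel_measurable (M \<Otimes>\<^sub>M borel)"
proof (rule borel_measurable_LIMSEQ_real)
  define r where "r = (\<lambda>(n::nat) t. real_of_int \<lfloor>t * real (Suc n)\<rfloor> / real (Suc n))"
  have r: "(\<lambda>n. r n t) \<longlonglongrightarrow> t" for t
  proof (rule tendsto_sandwich)
    show "eventually (\<lambda>n. t - 1 / real (Suc n) \<le> r n t) sequentially"
    proof (intro always_eventually allI)
      fix n
      have "t * real (Suc n) - 1 \<le> real_of_int \<lfloor>t * real (Suc n)\<rfloor>"
        by linarith
      then have "(t * real (Suc n) - 1) / real (Suc n) \<le> r n t"
        unfolding r_def by (intro divide_right_mono) auto
      then show "t - 1 / real (Suc n) \<le> r n t"
        by (simp add: diff_divide_distrib)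
    qed
    show "eventually (\<lambda>n. r n t \<le> t) sequentially"
    proof (intro always_eventually allI)
      fix n
      have "real_of_int \<lfloor>t * real (Suc n)\<rfloor> / real (Suc n) \<le> t * real (Suc n) / real (Suc n)"
        by (intro divide_right_mono) auto
      then show "r n t \<le> t"
        by (simp add: r_def)
    qed
    have "(\<lambda>n. t - 1 / real (Suc n)) \<longlonglongrightarrow> t - 0"
      by (intro tendsto_diff tendsto_const LIMSEQ_Suc lim_1_over_n)
    then show "(\<lambda>n. t - 1 / real (Suc n)) \<longlonglongrightarrow> t" by simp
  qed auto
  show "(\<lambda>n. Z (r n (snd p)) (fst p)) \<longlonglongrightarrow> Z (snd p) (fst p)"
    if "p \<in> space (M \<Otimes>\<^sub>M borel)" for p
  proof -
    have "isCont (\<lambda>t. Z t (fst p)) (snd p)"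
      using cont[of "fst p"] that by (auto simp: space_pair_measure continuous_on_eq_continuous_at)
    then show ?thesis
      by (rule isCont_tendsto_compose[OF _ r])
  qed
  show "(\<lambda>p. Z (r n (snd p)) (fst p)) \<in> borel_measurable (M \<Otimes>\<^sub>M borel)" for n
    unfolding r_def
    by (rule measurable_compose_countable[where f = "\<lambda>i p. Z (real_of_int i / real (Suc n)) (fst p)"
          and g = "\<lambda>p. \<lfloor>snd p * real (Suc n)\<rfloor>"]) measurable
qed

lemma measurable_set_integral_process:
  fixes Z :: "real \<Rightarrow> 'a \<Rightarrow> real"
  assumes "\<And>t. Z t \<in> borel_measurable M"
    and "\<And>w. w \<in> space M \<Longrightarrow> continuous_on UNIV (\<lambda>t. Z t w)"
  shows "(\<lambda>w. LINT t:{a..b}|lborel. Z t w) \<in> borel_measurable M"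
proof -
  have [measurable]: "(\<lambda>p. Z (snd p) (fst p)) \<in> borel_measurable (M \<Otimes>\<^sub>M borel)"
    by (rule measurable_continuous_process[OF assms])
  show ?thesis
    unfolding set_lebesgue_integral_def
    by (intro lborel.borel_measurable_lebesgue_integral) (simp add: split_beta', measurable)
qed

lemma set_integrable_Icc_continuous:
  fixes g :: "real \<Rightarrow> real"
  assumes "continuous_on UNIV g"
  shows "set_integrable lborel {a..b} g"
  using assms by (intro borel_integrable_atLeastAtMost') (auto intro: continuous_on_subset)

lemma set_integral_Icc_split:
  fixes g :: "real \<Rightarrow> real"
  assumes "continuous_on UNIV g" "a \<le> b" "b \<le> c"
  shows "(LINT t:{a..c}|lborel. g t) = (LINT t:{a..b}|lborel. g t) + (LINT t:{b..c}|lborel. g t)"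
proof -
  have "(LINT t:{a..b} \<union> {b<..c}|lborel. g t)
      = (LINT t:{a..b}|lborel. g t) + (LINT t:{b<..c}|lborel. g t)"
    by (intro set_integral_Un set_integrable_subset[OF set_integrable_Icc_continuous[OF assms(1), of a c]])
      (use assms in auto)
  moreover have "{a..b} \<union> {b<..c} = {a..c}"
    using assms by auto
  moreover have "(LINT t:{b<..c}|lborel. g t) = (LINT t:{b..c}|lborel. g t)"
  proof -
    have [measurable]: "g \<in> borel_measurable borel"
      using assms(1) by (rule borel_measurable_continuous_onI)
    show ?thesis
      unfolding set_lebesgue_integral_def
    proof (rule integral_cong_AE)
      show "AE t in lborel. indicator {b<..c} t *\<^sub>R g t = indicator {b..c} t *\<^sub>R g t"
        using AE_lborel_singleton[of b] by eventually_elim (auto simp: indicator_def)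
    qed measurable
  qed
  ultimately show ?thesis by simp
qed

lemma set_integral_Icc_const: "a \<le> b \<Longrightarrow> (LINT t:{a..b}|lborel. (c::real)) = c * (b - a)"
  by (simp add: set_integral_const)

lemma set_integral_Icc_abs_le:
  fixes g B :: "real \<Rightarrow> real"
  assumes "continuous_on UNIV g" "continuous_on UNIV B" "\<And>t. t \<in> {a..b} \<Longrightarrow> \<bar>g t\<bar> \<le> B t"
  shows "\<bar>LINT t:{a..b}|lborel. g t\<bar> \<le> (LINT t:{a..b}|lborel. B t)"
proof -
  have "\<bar>LINT t:{a..b}|lborel. g t\<bar> \<le> (LINT t:{a..b}|lborel. \<bar>g t\<bar>)"
    using set_integral_norm_bound[OF set_integrable_Icc_continuous[OF assms(1), of a b]] by simp
  also have "\<dots> \<le> (LINT t:{a..b}|lborel. B t)"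
    using assms by (intro set_integral_mono set_integrable_Icc_continuous continuous_on_rabs) auto
  finally show ?thesis .
qed

lemma continuous_on_set_integral:
  fixes g :: "real \<Rightarrow> real"
  assumes "continuous_on UNIV g"
  shows "continuous_on {0..T} (\<lambda>t. LINT s:{0..t}|lborel. g s)"
proof -
  have "continuous_on {0..T} (\<lambda>t. integral {0..t} g)"
    using assms by (intro indefinite_integral_continuous_1 integrable_continuous_real)
      (auto intro: continuous_on_subset)
  then show ?thesis
    by (simp add: set_borel_integral_eq_integral(2)[OF set_integrable_Icc_continuous[OF assms]])
qed

section \<open>Gaussian increments, independence and Taylor's formula\<close>

text \<open>The exact first and second moments annihilate the leading terms of a time step; the
  absolute moments measure the remainders.\<close>

lemma (in prob_space) centered_normal_moments:
  assumes D: "distributed M lborel D (normal_density 0 (sqrt d))" and d: "0 < d"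
  shows "integrable M D" "expectation D = 0"
    "integrable M (\<lambda>w. (D w)\<^sup>2)" "expectation (\<lambda>w. (D w)\<^sup>2) = d"
    "integrable M (\<lambda>w. \<bar>D w\<bar>)" "expectation (\<lambda>w. \<bar>D w\<bar>) \<le> sqrt d"
    "integrable M (\<lambda>w. \<bar>D w\<bar> ^ 3)" "expectation (\<lambda>w. \<bar>D w\<bar> ^ 3) \<le> 2 * (d * sqrt d)"
proof -
  have s: "0 < sqrt d" using d by simp
  have transfer: "integrable M (\<lambda>w. g (D w)) \<and> expectation (\<lambda>w. g (D w)) = c"
    if "has_bochner_integral lborel (\<lambda>x. normal_density 0 (sqrt d) x * g x) c"
      and [measurable]: "g \<in> borel_measurable borel" for g :: "real \<Rightarrow> real" and c
    using that distributed_integrable[OF D, of g] distributed_integral[OF D, of g]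
    by (auto simp: has_bochner_integral_iff)
  \<comment> \<open>The odd absolute moments carry the factor \<open>sqrt (2 / pi)\<close>, which
    this bound removes.\<close>
  have pi: "sqrt (2 / pi) \<le> 1"
    using pi_ge_two by (simp add: real_sqrt_le_1_iff)
  note T1 = transfer[of "\<lambda>x. x", OF normal_moment_odd[OF s, of 0 0, simplified]]
  note T2 = transfer[of "\<lambda>x. x\<^sup>2", OF normal_moment_even[OF s, of 0 1, simplified]]
  note T3 = transfer[of "\<lambda>x. \<bar>x\<bar>", OF normal_moment_abs_odd[OF s, of 0 0, simplified]]
  have "has_bochner_integral lborel (\<lambda>x. normal_density 0 (sqrt d) x * \<bar>x\<bar> ^ 3)
      (2 * (sqrt d) ^ 3 * sqrt (2 / pi))"
    using normal_moment_abs_odd[OF s, of 0 1] by simp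
  note T4 = transfer[of "\<lambda>x. \<bar>x\<bar> ^ 3", OF this]
  show "integrable M D" "expectation D = 0"
    using T1 by simp_all
  show "integrable M (\<lambda>w. (D w)\<^sup>2)" "expectation (\<lambda>w. (D w)\<^sup>2) = d"
    using T2 d by simp_all
  show "integrable M (\<lambda>w. \<bar>D w\<bar>)" "expectation (\<lambda>w. \<bar>D w\<bar>) \<le> sqrt d"
    using T3 pi d mult_left_mono[OF pi, of "sqrt d"] by simp_all
  have "(sqrt d) ^ 3 = d * sqrt d"
    using d by (simp add: power3_eq_cube)
  then show "integrable M (\<lambda>w. \<bar>D w\<bar> ^ 3)" "expectation (\<lambda>w. \<bar>D w\<bar> ^ 3) \<le> 2 * (d * sqrt d)"
    using T4 d mult_left_mono[OF pi, of "2 * (d * sqrt d)"] by simp_all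
qed

text \<open>Independence is given for \<sigma>-algebras. The ones generated by \<open>Z\<close> and
  by \<open>g\<close> of the increment are contained in them, so the two variables are independent
  and the expectation factorizes.\<close>

lemma (in prob_space) indep_set_expectation_mult:
  assumes indep: "indep_set (sets N) (sets (vimage_algebra (space M) D borel))"
    and N: "space N = space M" "sets N \<subseteq> sets M"
    and D: "D \<in> borel_measurable M"
    and Z: "Z \<in> borel_measurable N" and Z_int: "integrable M Z"
    and g: "g \<in> borel_measurable borel" and g_int: "integrable M (\<lambda>w. g (D w))"
  shows "integrable M (\<lambda>w. Z w * g (D w) :: real)"
    "expectation (\<lambda>w. Z w * g (D w)) = expectation Z * expectation (\<lambda>w. g (D w))"
proof -
  have ZM: "Z \<in> borel_measurable M"
    using Z_int by auto
  have gD: "(\<lambda>w. g (D w)) \<in> borel_measurable M"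
    using g D by measurable
  have "indep_var borel Z borel (\<lambda>w. g (D w))"
    unfolding indep_var_eq
  proof (intro conjI ZM gD)
    have 1: "sigma_sets (space M) {Z -` A \<inter> space M |A. A \<in> sets borel} \<subseteq> sets N"
      unfolding N(1)[symmetric] using measurable_sets[OF Z] by (intro sets.sigma_sets_subset) auto
    have "(\<lambda>w. g (D w)) -` A \<inter> space M \<in> sets (vimage_algebra (space M) D borel)" if "A \<in> sets borel" for A
    proof -
      have "(\<lambda>w. g (D w)) -` A \<inter> space M = D -` (g -` A) \<inter> space M"
        by auto
      moreover have "g -` A \<in> sets borel"
        using measurable_sets[OF g that] by simp
      ultimately show ?thesis
        by (metis in_vimage_algebra)
    qed
    then have 2: "sigma_sets (space M) {(\<lambda>w. g (D w)) -` A \<inter> space M |A. A \<in> sets borel}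
        \<subseteq> sets (vimage_algebra (space M) D borel)"
      by (intro sets.sigma_sets_subset[where M = "vimage_algebra (space M) D borel", simplified]) auto
    show "indep_set (sigma_sets (space M) {Z -` A \<inter> space M |A. A \<in> sets borel})
       (sigma_sets (space M) {(\<lambda>w. g (D w)) -` A \<inter> space M |A. A \<in> sets borel})"
      using indep unfolding indep_set_def
      by (rule indep_sets_mono_sets) (use 1 2 in \<open>auto split: bool.split\<close>)
  qed
  from indep_var_integrable[OF this Z_int g_int] indep_var_lebesgue_integral[OF this Z_int g_int]
  show "integrable M (\<lambda>w. Z w * g (D w))"
    "expectation (\<lambda>w. Z w * g (D w)) = expectation Z * expectation (\<lambda>w. g (D w))"
    by auto
qed

lemma taylor2_bound:
  fixes f f' f'' f''' :: "real \<Rightarrow> real"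
  assumes f: "\<And>y. (f has_real_derivative f' y) (at y)"
    and f': "\<And>y. (f' has_real_derivative f'' y) (at y)"
    and f'': "\<And>y. (f'' has_real_derivative f''' y) (at y)"
    and K: "\<And>y. \<bar>f''' y\<bar> \<le> K"
  shows "\<bar>f (y + d) - f y - f' y * d - f'' y * d\<^sup>2 / 2\<bar> \<le> K * \<bar>d\<bar> ^ 3"
proof -
  have "K \<ge> 0" using K[of 0] by linarith
  define df where "df = (\<lambda>n::nat. if n = 0 then f else if n = 1 then f' else if n = 2 then f'' else f''')"
  show ?thesis
  proof (cases "d = 0")
    case False
    have "\<exists>t. \<bar>t\<bar> \<le> \<bar>d\<bar> \<and> f (y + d) = (\<Sum>m<3. (df m (y + 0)) / fact m * d ^ m) + df 3 (y + t) / fact 3 * d ^ 3"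
      by (rule Maclaurin_bi_le[where diff = "\<lambda>n t. df n (y + t)"])
         (auto simp: df_def less_Suc_eq numeral_3_eq_3 intro!: DERIV_chain2[of _ _ "\<lambda>t. y + t", THEN DERIV_cong] f f' f'' derivative_eq_intros)
    then obtain t where "f (y + d) = f y + f' y * d + f'' y * d\<^sup>2 / 2 + f''' (y + t) / 6 * d ^ 3"
      by (auto simp: df_def numeral_3_eq_3 power2_eq_square fact_reduce)
    then have "\<bar>f (y + d) - f y - f' y * d - f'' y * d\<^sup>2 / 2\<bar> = \<bar>f''' (y + t)\<bar> / 6 * \<bar>d\<bar> ^ 3"
      by (simp add: abs_mult power_abs)
    also have "\<dots> \<le> K * \<bar>d\<bar> ^ 3"
      using K[of "y + t"] \<open>K \<ge> 0\<close> by (intro mult_right_mono) auto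
    finally show ?thesis .
  qed simp
qed

section \<open>Processes with bounded drift and a single time step\<close>

text \<open>The drift is a given bounded process and not a function of \<open>Y\<close>: it will be
  the clipped drift evaluated along \<open>X\<close>, from which \<open>Y\<close> may differ after
  the exit. Paths live on the whole time axis, so that continuity and integrability over intervals
  carry no sign conditions.\<close>

locale bounded_drift_process = prob_space P for P :: "'a measure" +
  fixes \<F> :: "ennreal \<Rightarrow> 'a measure" and \<sigma> R :: real and W Y \<beta> :: "real \<Rightarrow> 'a \<Rightarrow> real"
  assumes filt: "filtration (space P) \<F>" and sub: "\<And>t. sets (\<F> t) \<subseteq> sets P"
    and \<sigma>_pos: "0 < \<sigma>"
    and W_meas [measurable]: "\<And>t. W t \<in> borel_measurable P"
    and W_cont: "\<And>w. w \<in> space P \<Longrightarrow> continuous_on UNIV (\<lambda>t. W t w)"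
    and W_dist: "\<And>s t. 0 \<le> s \<Longrightarrow> s < t \<Longrightarrow>
      distributed P lborel (\<lambda>w. W t w - W s w) (normal_density 0 (sqrt (t - s)))"
    and W_indep: "\<And>s t. 0 \<le> s \<Longrightarrow> s < t \<Longrightarrow> indep_set (sets (\<F> (ennreal s)))
      (sets (vimage_algebra (space P) (\<lambda>w. W t w - W s w) borel))"
    and \<beta>_meas [measurable]: "\<And>t. \<beta> t \<in> borel_measurable P"
    and \<beta>_cont: "\<And>w. w \<in> space P \<Longrightarrow> continuous_on UNIV (\<lambda>t. \<beta> t w)"
    and \<beta>_bound: "\<And>t w. \<bar>\<beta> t w\<bar> \<le> R"
    and Y_adapted: "\<And>t. 0 \<le> t \<Longrightarrow> Y t \<in> borel_measurable (\<F> (ennreal t))"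
    and Y_meas [measurable]: "\<And>t. Y t \<in> borel_measurable P"
    and Y_cont: "\<And>w. w \<in> space P \<Longrightarrow> continuous_on UNIV (\<lambda>t. Y t w)"
    and Y_eq: "\<And>w s t. w \<in> space P \<Longrightarrow> 0 \<le> s \<Longrightarrow> s \<le> t \<Longrightarrow>
      Y t w - Y s w = (LINT r:{s..t}|lborel. \<beta> r w) + \<sigma> * (W t w - W s w)"
begin

lemma space_\<F>: "space (\<F> t) = space P"
  using filt by (simp add: filtration_def)

lemma \<F>_measurable_imp: "f \<in> borel_measurable (\<F> t) \<Longrightarrow> f \<in> borel_measurable P"
  using sub[of t] space_\<F>[of t] by (auto simp: measurable_def)

lemma R_nonneg: "0 \<le> R"
  using \<beta>_bound[of 0 undefined] by linarith

text \<open>Tonelli's theorem reduces this to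
  \<open>E \<bar>W s - W t\<bar> \<le> sqrt (s - t)\<close>. It measures the error of freezing the
  coefficients at the start of a step.\<close>

lemma integrated_increment:
  assumes t: "0 \<le> t" and d: "0 < d"
  shows "integrable P (\<lambda>w. LINT s:{t..t + d}|lborel. \<bar>W s w - W t w\<bar>)" (is "integrable P ?I")
    and "expectation (\<lambda>w. LINT s:{t..t + d}|lborel. \<bar>W s w - W t w\<bar>) \<le> d * sqrt d"
proof -
  have cont: "continuous_on UNIV (\<lambda>s. \<bar>W s w - W t w\<bar>)" if "w \<in> space P" for w
    using W_cont[OF that] by (intro continuous_intros)
  have [measurable]: "(\<lambda>p. \<bar>W (snd p) (fst p) - W t (fst p)\<bar>) \<in> borel_measurable (P \<Otimes>\<^sub>M borel)"
    using measurable_continuous_process[OF W_meas W_cont] by measurable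
  have meas: "?I \<in> borel_measurable P"
    by (rule measurable_set_integral_process[OF _ cont]) measurable
  have nonneg: "0 \<le> ?I w" for w
    by (auto simp: set_lebesgue_integral_def intro!: integral_nonneg_AE)
  have "(\<integral>\<^sup>+w. ennreal (?I w) \<partial>P)
      = (\<integral>\<^sup>+w. \<integral>\<^sup>+s. ennreal (indicator {t..t+d} s * \<bar>W s w - W t w\<bar>) \<partial>lborel \<partial>P)"
    unfolding set_lebesgue_integral_def
    using set_integrable_Icc_continuous[OF cont, of _ t "t + d"]
    by (intro nn_integral_cong) (simp add: nn_integral_eq_integral set_integrable_def)
  also have "\<dots> = (\<integral>\<^sup>+s. \<integral>\<^sup>+w. ennreal (indicator {t..t+d} s * \<bar>W s w - W t w\<bar>) \<partial>P \<partial>lborel)"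
  proof -
    interpret pair_sigma_finite P lborel ..
    show ?thesis
      by (subst Fubini') (auto simp: split_beta')
  qed
  also have "\<dots> \<le> (\<integral>\<^sup>+s. ennreal (sqrt d) * indicator {t..t+d} s \<partial>lborel)"
  proof (intro nn_integral_mono)
    fix s :: real
    show "(\<integral>\<^sup>+w. ennreal (indicator {t..t+d} s * \<bar>W s w - W t w\<bar>) \<partial>P) \<le> ennreal (sqrt d) * indicator {t..t+d} s"
    proof (cases "s \<in> {t<..t+d}")
      case True
      then have s: "t < s" "s \<le> t + d" by auto
      note M = centered_normal_moments[OF W_dist[OF t s(1)]]
      have "(\<integral>\<^sup>+w. ennreal (indicator {t..t+d} s * \<bar>W s w - W t w\<bar>) \<partial>P)
          = ennreal (expectation (\<lambda>w. \<bar>W s w - W t w\<bar>))"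
        using s M(5) by (subst nn_integral_eq_integral[symmetric]) auto
      also have "\<dots> \<le> ennreal (sqrt (s - t))"
        using M(6) s by (intro ennreal_leI) auto
      also have "\<dots> \<le> ennreal (sqrt d)"
        using s by (intro ennreal_leI) auto
      finally show ?thesis using s by simp
    qed (cases "s = t", auto)
  qed
  also have "\<dots> = ennreal (d * sqrt d)"
    using d by (simp add: nn_integral_cmult_indicator ennreal_mult' mult.commute)
  finally have le: "(\<integral>\<^sup>+w. ennreal (?I w) \<partial>P) \<le> ennreal (d * sqrt d)" .
  show int: "integrable P ?I"
    using le meas nonneg by (intro integrableI_nonneg) (auto intro: le_less_trans)
  show "expectation ?I \<le> d * sqrt d"
    using le d nn_integral_eq_integral[OF int] nonneg by (simp add: ennreal_le_iff)
qed

end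

text \<open>The bounded third derivative makes the Taylor remainder cubic in the increment, of
  expected size \<open>d * sqrt d\<close>; a merely quadratic remainder would not vanish after
  summation over the steps.\<close>

locale bounded_drift_test_function = bounded_drift_process +
  fixes \<alpha> K :: real and f f' f'' f''' :: "real \<Rightarrow> real"
  assumes \<alpha>: "0 < \<alpha>"
    and f: "\<And>y. (f has_real_derivative f' y) (at y)"
    and f': "\<And>y. (f' has_real_derivative f'' y) (at y)"
    and f'': "\<And>y. (f'' has_real_derivative f''' y) (at y)"
    and K: "\<And>y. \<bar>f y\<bar> \<le> K" "\<And>y. \<bar>f' y\<bar> \<le> K" "\<And>y. \<bar>f'' y\<bar> \<le> K" "\<And>y. \<bar>f''' y\<bar> \<le> K"
begin

lemma K_nonneg: "0 \<le> K"
  using K(1)[of 0] by linarith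

lemma f_continuous: "continuous_on S f" "continuous_on S f'" "continuous_on S f''"
  using DERIV_isCont[OF f] DERIV_isCont[OF f'] DERIV_isCont[OF f'']
  by (auto intro: continuous_at_imp_continuous_on)

lemma f_measurable [measurable]:
  "f \<in> borel_measurable borel" "f' \<in> borel_measurable borel" "f'' \<in> borel_measurable borel"
  by (intro borel_measurable_continuous_onI f_continuous)+

lemma f_lipschitz:
  "\<bar>f x - f y\<bar> \<le> K * \<bar>x - y\<bar>" "\<bar>f' x - f' y\<bar> \<le> K * \<bar>x - y\<bar>" "\<bar>f'' x - f'' y\<bar> \<le> K * \<bar>x - y\<bar>"
  using field_differentiable_bound[of UNIV f f' K x y] field_differentiable_bound[of UNIV f' f'' K x y]
    field_differentiable_bound[of UNIV f'' f''' K x y] f f' f'' K by auto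

text \<open>The generator minus \<alpha> applied to \<open>f\<close>, with the random drift in place
  of \<open>m\<close>.\<close>

definition drift_term :: "real \<Rightarrow> 'a \<Rightarrow> real" where
  "drift_term s w = \<sigma>\<^sup>2 / 2 * f'' (Y s w) + \<beta> s w * f' (Y s w) - \<alpha> * f (Y s w)"

text \<open>The discounted value of \<open>f\<close> minus its compensator, that is, the Dynkin
  martingale.\<close>

definition dynkin_process :: "real \<Rightarrow> 'a \<Rightarrow> real" where
  "dynkin_process t w = exp (- \<alpha> * t) * f (Y t w)
     - (LINT s:{0..t}|lborel. exp (- \<alpha> * s) * drift_term s w)"

lemma drift_term_continuous: "w \<in> space P \<Longrightarrow> continuous_on UNIV (\<lambda>s. drift_term s w)"
  unfolding drift_term_def
  by (intro continuous_intros \<beta>_cont continuous_on_compose2[OF f_continuous(1) Y_cont]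
      continuous_on_compose2[OF f_continuous(2) Y_cont] continuous_on_compose2[OF f_continuous(3) Y_cont]) auto

lemma discounted_drift_term_continuous:
  "w \<in> space P \<Longrightarrow> continuous_on UNIV (\<lambda>s. exp (- \<alpha> * s) * drift_term s w)"
  by (intro continuous_intros drift_term_continuous)

lemma drift_term_measurable [measurable]: "drift_term s \<in> borel_measurable P"
  unfolding drift_term_def by measurable

lemma dynkin_process_measurable [measurable]: "dynkin_process t \<in> borel_measurable P"
proof -
  have "(\<lambda>w. LINT s:{0..t}|lborel. exp (- \<alpha> * s) * drift_term s w) \<in> borel_measurable P"
    by (rule measurable_set_integral_process[OF _ discounted_drift_term_continuous]) measurable
  then show ?thesis
    unfolding dynkin_process_def by measurable
qed

definition drift_bound :: real where
  "drift_bound = (\<sigma>\<^sup>2 / 2 + R + \<alpha>) * K"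

lemma drift_bound_nonneg: "0 \<le> drift_bound"
  using K_nonneg R_nonneg \<alpha> by (simp add: drift_bound_def)

lemma drift_term_bound: "\<bar>drift_term s w\<bar> \<le> drift_bound"
proof -
  have "\<bar>\<sigma>\<^sup>2 / 2 * f'' (Y s w)\<bar> \<le> \<sigma>\<^sup>2 / 2 * K"
    unfolding abs_mult using K(3) by (intro mult_mono) auto
  moreover have "\<bar>\<beta> s w * f' (Y s w)\<bar> \<le> R * K"
    unfolding abs_mult using K(2) \<beta>_bound R_nonneg by (intro mult_mono) auto
  moreover have "\<bar>\<alpha> * f (Y s w)\<bar> \<le> \<alpha> * K"
    unfolding abs_mult using K(1) \<alpha> by (intro mult_mono) auto
  ultimately show ?thesis
    unfolding drift_term_def drift_bound_def by (simp add: algebra_simps abs_le_iff)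
qed

lemma dynkin_process_bound:
  assumes "w \<in> space P" "0 \<le> t" "t \<le> T"
  shows "\<bar>dynkin_process t w\<bar> \<le> K + drift_bound * T"
proof -
  have e: "exp (- \<alpha> * s) \<le> 1" if "0 \<le> s" for s
    using that \<alpha> by simp
  have "\<bar>LINT s:{0..t}|lborel. exp (- \<alpha> * s) * drift_term s w\<bar> \<le> (LINT s:{0..t}|lborel. drift_bound)"
  proof (rule set_integral_Icc_abs_le[OF discounted_drift_term_continuous[OF assms(1)]])
    show "\<bar>exp (- \<alpha> * s) * drift_term s w\<bar> \<le> drift_bound" if "s \<in> {0..t}" for s
      using mult_mono[OF e[of s] drift_term_bound[of s w]] that by (simp add: abs_mult)
  qed simp
  also have "\<dots> = drift_bound * t"
    using assms by (simp add: set_integral_Icc_const)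
  also have "\<dots> \<le> drift_bound * T"
    using assms drift_bound_nonneg by (intro mult_left_mono)
  finally have "\<bar>LINT s:{0..t}|lborel. exp (- \<alpha> * s) * drift_term s w\<bar> \<le> drift_bound * T" .
  moreover have "\<bar>exp (- \<alpha> * t) * f (Y t w)\<bar> \<le> K"
    using mult_mono[OF e[of t] K(1)[of "Y t w"]] assms by (simp add: abs_mult)
  ultimately show ?thesis
    unfolding dynkin_process_def by linarith
qed

lemma dynkin_process_continuous:
  assumes "w \<in> space P"
  shows "continuous_on {0..T} (\<lambda>t. dynkin_process t w)"
  unfolding dynkin_process_def
  by (intro continuous_intros continuous_on_set_integral discounted_drift_term_continuous[OF assms]
      continuous_on_compose2[OF f_continuous(1) continuous_on_subset[OF Y_cont[OF assms]]]) auto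

abbreviation dynkin_increment :: "real \<Rightarrow> real \<Rightarrow> 'a \<Rightarrow> real" where
  "dynkin_increment s t w \<equiv> dynkin_process t w - dynkin_process s w"

text \<open>The leading stochastic terms of the expansion over a step: the linear one, and the
  quadratic one centred by the variance \<open>d\<close>. All coefficients are known at time
  \<open>t\<close>.\<close>

definition martingale_part :: "real \<Rightarrow> real \<Rightarrow> 'a \<Rightarrow> real" where
  "martingale_part t d w = exp (- \<alpha> * t) * \<sigma> * f' (Y t w) * (W (t + d) w - W t w)
     + exp (- \<alpha> * t) * (\<sigma>\<^sup>2 / 2) * f'' (Y t w) * ((W (t + d) w - W t w)\<^sup>2 - d)"

lemma increment_bound:
  assumes w: "w \<in> space P" and t: "0 \<le> t" "t \<le> s"
  shows "\<bar>Y s w - Y t w\<bar> \<le> R * (s - t) + \<sigma> * \<bar>W s w - W t w\<bar>"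
    and "\<bar>LINT r:{t..s}|lborel. \<beta> r w\<bar> \<le> R * (s - t)"
proof -
  show 1: "\<bar>LINT r:{t..s}|lborel. \<beta> r w\<bar> \<le> R * (s - t)"
    using set_integral_Icc_abs_le[OF \<beta>_cont[OF w], of "\<lambda>_. R" t s] \<beta>_bound t
    by (simp add: set_integral_Icc_const)
  show "\<bar>Y s w - Y t w\<bar> \<le> R * (s - t) + \<sigma> * \<bar>W s w - W t w\<bar>"
    using Y_eq[OF w t] 1 \<sigma>_pos abs_triangle_ineq[of "LINT r:{t..s}|lborel. \<beta> r w" "\<sigma> * (W s w - W t w)"]
    by (simp add: abs_mult)
qed

end

lemma abs_add_cubed_le:
  fixes a b :: real
  shows "\<bar>a + b\<bar> ^ 3 \<le> 4 * \<bar>a\<bar> ^ 3 + 4 * \<bar>b\<bar> ^ 3"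
proof -
  have "\<bar>a + b\<bar> ^ 3 \<le> (\<bar>a\<bar> + \<bar>b\<bar>) ^ 3"
    by (intro power_mono) auto
  also have "\<dots> \<le> 4 * \<bar>a\<bar> ^ 3 + 4 * \<bar>b\<bar> ^ 3"
  proof -
    have "4 * \<bar>a\<bar> ^ 3 + 4 * \<bar>b\<bar> ^ 3 - (\<bar>a\<bar> + \<bar>b\<bar>) ^ 3 = 3 * (\<bar>a\<bar> + \<bar>b\<bar>) * (\<bar>a\<bar> - \<bar>b\<bar>)\<^sup>2"
      by (simp add: power2_eq_square power3_eq_cube algebra_simps)
    moreover have "0 \<le> 3 * (\<bar>a\<bar> + \<bar>b\<bar>) * (\<bar>a\<bar> - \<bar>b\<bar>)\<^sup>2"
      by simp
    ultimately show ?thesis by linarith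
  qed
  finally show ?thesis .
qed

lemma exp_neg_diff_le:
  fixes a s t :: real
  assumes "0 \<le> a" "0 \<le> t" "t \<le> s"
  shows "\<bar>exp (- a * t) - exp (- a * s)\<bar> \<le> a * (s - t)"
proof -
  have "exp (- a * t) - exp (- a * s) = exp (- a * t) * (1 - exp (- (a * (s - t))))"
    by (simp add: algebra_simps exp_diff exp_minus field_simps exp_add[symmetric])
  moreover have "1 - exp (- (a * (s - t))) \<le> a * (s - t)"
    using exp_ge_add_one_self[of "- (a * (s - t))"] by linarith
  moreover have "0 \<le> 1 - exp (- (a * (s - t)))"
    using assms by simp
  moreover have "exp (- a * t) \<le> 1"
    using assms by simp
  ultimately show ?thesis
    using mult_mono[of "exp (- a * t)" 1 "1 - exp (- (a * (s - t)))" "a * (s - t)"] by simp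
qed

lemma set_integral_exp_Icc:
  fixes a :: real
  assumes "a \<noteq> 0" "s \<le> t"
  shows "(LINT r:{s..t}|lborel. exp (- a * r)) = (exp (- a * s) - exp (- a * t)) / a"
proof -
  have "(LINT r:{s..t}|lborel. exp (- a * r)) = (LINT r|lborel. exp (- a * r) * indicator {s..t} r)"
    unfolding set_lebesgue_integral_def by (intro Bochner_Integration.integral_cong) auto
  also have "\<dots> = - exp (- a * t) / a - (- exp (- a * s) / a)"
    using assms by (intro integral_FTC_Icc_real[of _ _ "\<lambda>r. - exp (- a * r) / a"])
      (auto intro!: derivative_eq_intros continuous_intros)
  finally show ?thesis
    by (simp add: diff_divide_distrib)
qed

context bounded_drift_test_function
begin

text \<open>Second-order Taylor expansion in place of the Ito formula; each error term has expectation of order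
  \<open>d\<^bsup>3/2\<^esup>\<close>.\<close>

lemma one_step_pathwise:
  obtains c1 c2 c3 c4 where "0 \<le> c1" "0 \<le> c2" "0 \<le> c3" "0 \<le> c4"
    "\<And>w t d. w \<in> space P \<Longrightarrow> 0 \<le> t \<Longrightarrow> 0 < d \<Longrightarrow> d \<le> 1 \<Longrightarrow>
      \<bar>dynkin_increment t (t + d) w - martingale_part t d w\<bar>
        \<le> c1 * d\<^sup>2 + c2 * (d * \<bar>W (t + d) w - W t w\<bar>) + c3 * \<bar>W (t + d) w - W t w\<bar> ^ 3
          + c4 * (LINT s:{t..t + d}|lborel. \<bar>W s w - W t w\<bar>)"
proof -
  note nn = K_nonneg R_nonneg less_imp_le[OF \<sigma>_pos] less_imp_le[OF \<alpha>]
  \<comment> \<open>The \<open>b\<close> constants collect the coefficients in the bound for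
    \<open>j\<close>, the \<open>a\<close> constants those in the bounds for \<open>rem\<close> and
    \<open>q\<close>.\<close>
  define b1 where "b1 = K * (2 * \<alpha> * R + (R + \<sigma>\<^sup>2 / 2) * (\<alpha> + R))"
  define b2 where "b2 = K * \<alpha> * \<sigma>"
  define b3 where "b3 = K * \<sigma> * (\<alpha> + R + \<sigma>\<^sup>2 / 2)"
  define a1 where "a1 = K * (4 * R ^ 3 + R\<^sup>2)"
  define a2 where "a2 = K * \<sigma> * R"
  define a3 where "a3 = K * (4 * \<sigma> ^ 3)"
  have bound: "\<bar>dynkin_increment t (t + d) w - martingale_part t d w\<bar>
      \<le> (a1 + b1) * d\<^sup>2 + (a2 + b2) * (d * \<bar>W (t + d) w - W t w\<bar>) + a3 * \<bar>W (t + d) w - W t w\<bar> ^ 3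
          + b3 * (LINT s:{t..t + d}|lborel. \<bar>W s w - W t w\<bar>)"
    if w: "w \<in> space P" and t: "0 \<le> t" and d: "0 < d" "d \<le> 1" for w t d
  proof -
    define y where "y = Y t w"
    define z where "z = Y (t + d) w"
    define \<Delta> where "\<Delta> = W (t + d) w - W t w"
    define D where "D = (LINT s:{t..t+d}|lborel. \<beta> s w)"
    define e where "e = exp (- \<alpha> * t)"
    define v where "v = (\<lambda>s. \<bar>W s w - W t w\<bar>)"
    \<comment> \<open>The error of freezing the coefficients, as a density in \<open>s\<close>. The
      first and second derivative terms are frozen at the start \<open>y\<close>, but the term with
      \<alpha> at the endpoint \<open>z\<close>, because the change of the discount factor over the
      step multiplies \<open>f z\<close>.\<close>
    define j where "j = (\<lambda>s. \<alpha> * exp (- \<alpha> * s) * (f (Y s w) - f z)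
        + \<beta> s w * (e * f' y - exp (- \<alpha> * s) * f' (Y s w))
        + \<sigma>\<^sup>2 / 2 * (e * f'' y - exp (- \<alpha> * s) * f'' (Y s w)))"
    have e: "0 \<le> e" "e \<le> 1"
      using t \<alpha> by (auto simp: e_def)
    have z: "z = y + (D + \<sigma> * \<Delta>)"
      using Y_eq[OF w t, of "t + d"] d by (simp add: z_def y_def D_def \<Delta>_def)
    have D: "\<bar>D\<bar> \<le> R * d"
      using increment_bound(2)[OF w t, of "t + d"] d by (simp add: D_def)
    have zy: "\<bar>z - y\<bar> \<le> R * d + \<sigma> * \<bar>\<Delta>\<bar>"
      using increment_bound(1)[OF w t, of "t + d"] d by (simp add: z_def y_def \<Delta>_def)
    note fc = continuous_on_compose2[OF f_continuous(1) Y_cont[OF w]]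
      continuous_on_compose2[OF f_continuous(2) Y_cont[OF w]]
      continuous_on_compose2[OF f_continuous(3) Y_cont[OF w]]
    have j_cont: "continuous_on UNIV j"
      unfolding j_def by (intro continuous_intros fc \<beta>_cont[OF w]) auto
    have v_cont: "continuous_on UNIV v"
      unfolding v_def by (intro continuous_intros W_cont[OF w])
    note si = set_integrable_Icc_continuous
    have int_j: "(LINT s:{t..t+d}|lborel. j s) = (exp (- \<alpha> * (t + d)) - e) * f z + e * f' y * D
        + e * (\<sigma>\<^sup>2 / 2) * f'' y * d - (LINT s:{t..t+d}|lborel. exp (- \<alpha> * s) * drift_term s w)"
    proof -
      have "(LINT s:{t..t+d}|lborel. j s) = (LINT s:{t..t+d}|lborel. ((- \<alpha> * f z) * exp (- \<alpha> * s)
          + (e * f' y) * \<beta> s w + e * (\<sigma>\<^sup>2 / 2) * f'' y) - exp (- \<alpha> * s) * drift_term s w)"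
        unfolding j_def drift_term_def by (intro set_lebesgue_integral_cong) (auto simp: algebra_simps)
      also have "\<dots> = (LINT s:{t..t+d}|lborel. ((- \<alpha> * f z) * exp (- \<alpha> * s) + (e * f' y) * \<beta> s w + e * (\<sigma>\<^sup>2 / 2) * f'' y))
          - (LINT s:{t..t+d}|lborel. exp (- \<alpha> * s) * drift_term s w)"
        by (intro set_integral_diff si discounted_drift_term_continuous[OF w] continuous_intros \<beta>_cont[OF w])
      also have "(LINT s:{t..t+d}|lborel. ((- \<alpha> * f z) * exp (- \<alpha> * s) + (e * f' y) * \<beta> s w + e * (\<sigma>\<^sup>2 / 2) * f'' y))
          = (LINT s:{t..t+d}|lborel. ((- \<alpha> * f z) * exp (- \<alpha> * s) + (e * f' y) * \<beta> s w))
            + (LINT s:{t..t+d}|lborel. e * (\<sigma>\<^sup>2 / 2) * f'' y)"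
        by (intro set_integral_add si continuous_intros \<beta>_cont[OF w])
      also have "(LINT s:{t..t+d}|lborel. ((- \<alpha> * f z) * exp (- \<alpha> * s) + (e * f' y) * \<beta> s w))
          = (LINT s:{t..t+d}|lborel. (- \<alpha> * f z) * exp (- \<alpha> * s)) + (LINT s:{t..t+d}|lborel. (e * f' y) * \<beta> s w)"
        by (intro set_integral_add si continuous_intros \<beta>_cont[OF w])
      also have "(LINT s:{t..t+d}|lborel. (- \<alpha> * f z) * exp (- \<alpha> * s)) = (exp (- \<alpha> * (t + d)) - e) * f z"
        using \<alpha> d unfolding set_integral_mult_right
        by (subst set_integral_exp_Icc) (auto simp: e_def field_simps)
      also have "(LINT s:{t..t+d}|lborel. (e * f' y) * \<beta> s w) = e * f' y * D"
        unfolding set_integral_mult_right D_def ..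
      also have "(LINT s:{t..t+d}|lborel. e * (\<sigma>\<^sup>2 / 2) * f'' y) = e * (\<sigma>\<^sup>2 / 2) * f'' y * d"
        using d by (simp add: set_integral_Icc_const)
      finally show ?thesis .
    qed
    have j_le: "\<bar>j s\<bar> \<le> b1 * d + b2 * \<bar>\<Delta>\<bar> + b3 * v s" if s: "s \<in> {t..t+d}" for s
    proof -
      have es: "0 \<le> exp (- \<alpha> * s)" "exp (- \<alpha> * s) \<le> 1"
        using s t \<alpha> by auto
      have ys: "\<bar>Y s w - y\<bar> \<le> R * d + \<sigma> * v s"
      proof -
        have "\<bar>Y s w - y\<bar> \<le> R * (s - t) + \<sigma> * v s"
          using increment_bound(1)[OF w t, of s] s by (simp add: y_def v_def)
        moreover have "R * (s - t) \<le> R * d"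
          using s R_nonneg by (intro mult_left_mono) auto
        ultimately show ?thesis by linarith
      qed
      have "\<bar>e - exp (- \<alpha> * s)\<bar> \<le> \<alpha> * (s - t)"
        unfolding e_def using s t \<alpha> by (intro exp_neg_diff_le) auto
      also have "\<dots> \<le> \<alpha> * d"
        using s \<alpha> by (intro mult_left_mono) auto
      finally have ed: "\<bar>e - exp (- \<alpha> * s)\<bar> \<le> \<alpha> * d" .
      have diff: "\<bar>e * g y - exp (- \<alpha> * s) * g (Y s w)\<bar> \<le> K * (\<alpha> * d + R * d + \<sigma> * v s)"
        if "\<And>x. \<bar>g x\<bar> \<le> K" "\<And>x x'. \<bar>g x - g x'\<bar> \<le> K * \<bar>x - x'\<bar>" for g :: "real \<Rightarrow> real"
      proof -
        have "e * g y - exp (- \<alpha> * s) * g (Y s w) = (e - exp (- \<alpha> * s)) * g y + exp (- \<alpha> * s) * (g y - g (Y s w))"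
          by (simp add: algebra_simps)
        moreover have "\<bar>(e - exp (- \<alpha> * s)) * g y\<bar> \<le> (\<alpha> * d) * K"
          unfolding abs_mult using ed that(1) d \<alpha> by (intro mult_mono) auto
        moreover have "\<bar>exp (- \<alpha> * s) * (g y - g (Y s w))\<bar> \<le> 1 * (K * (R * d + \<sigma> * v s))"
          unfolding abs_mult
        proof (intro mult_mono)
          have "\<bar>g y - g (Y s w)\<bar> \<le> K * \<bar>Y s w - y\<bar>"
            using that(2)[of y "Y s w"] by (simp add: abs_minus_commute)
          also have "\<dots> \<le> K * (R * d + \<sigma> * v s)"
            using ys K_nonneg by (intro mult_left_mono)
          finally show "\<bar>g y - g (Y s w)\<bar> \<le> K * (R * d + \<sigma> * v s)" .
        qed (use es in auto)
        ultimately show ?thesis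
          by (simp add: algebra_simps abs_le_iff)
      qed
      have 1: "\<bar>\<alpha> * exp (- \<alpha> * s) * (f (Y s w) - f z)\<bar> \<le> (\<alpha> * 1) * (K * (2 * R * d + \<sigma> * v s + \<sigma> * \<bar>\<Delta>\<bar>))"
        unfolding abs_mult
      proof (intro mult_mono)
        have "\<bar>f (Y s w) - f z\<bar> \<le> K * \<bar>Y s w - z\<bar>"
          by (rule f_lipschitz)
        also have "\<dots> \<le> K * (2 * R * d + \<sigma> * v s + \<sigma> * \<bar>\<Delta>\<bar>)"
          using ys zy K_nonneg by (intro mult_left_mono) auto
        finally show "\<bar>f (Y s w) - f z\<bar> \<le> K * (2 * R * d + \<sigma> * v s + \<sigma> * \<bar>\<Delta>\<bar>)" .
      qed (use es \<alpha> in auto)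
      have 2: "\<bar>\<beta> s w * (e * f' y - exp (- \<alpha> * s) * f' (Y s w))\<bar> \<le> R * (K * (\<alpha> * d + R * d + \<sigma> * v s))"
        unfolding abs_mult using \<beta>_bound R_nonneg by (intro mult_mono diff K f_lipschitz) auto
      have 3: "\<bar>\<sigma>\<^sup>2 / 2 * (e * f'' y - exp (- \<alpha> * s) * f'' (Y s w))\<bar> \<le> \<sigma>\<^sup>2 / 2 * (K * (\<alpha> * d + R * d + \<sigma> * v s))"
        unfolding abs_mult by (intro mult_mono diff K f_lipschitz) auto
      have "\<bar>j s\<bar> \<le> (\<alpha> * 1) * (K * (2 * R * d + \<sigma> * v s + \<sigma> * \<bar>\<Delta>\<bar>)) + R * (K * (\<alpha> * d + R * d + \<sigma> * v s))
          + \<sigma>\<^sup>2 / 2 * (K * (\<alpha> * d + R * d + \<sigma> * v s))"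
        unfolding j_def using 1 2 3 by linarith
      also have "\<dots> = b1 * d + b2 * \<bar>\<Delta>\<bar> + b3 * v s"
        by (simp add: b1_def b2_def b3_def algebra_simps)
      finally show ?thesis .
    qed
    have "\<bar>LINT s:{t..t+d}|lborel. j s\<bar> \<le> (LINT s:{t..t+d}|lborel. (b1 * d + b2 * \<bar>\<Delta>\<bar>) + b3 * v s)"
      using j_le by (intro set_integral_Icc_abs_le[OF j_cont] continuous_intros v_cont) auto
    also have "\<dots> = (LINT s:{t..t+d}|lborel. b1 * d + b2 * \<bar>\<Delta>\<bar>) + (LINT s:{t..t+d}|lborel. b3 * v s)"
      by (intro set_integral_add si continuous_intros v_cont)
    also have "\<dots> = (b1 * d + b2 * \<bar>\<Delta>\<bar>) * d + b3 * (LINT s:{t..t+d}|lborel. v s)"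
      using d by (simp add: set_integral_Icc_const)
    finally have J: "\<bar>LINT s:{t..t+d}|lborel. j s\<bar> \<le> b1 * d\<^sup>2 + b2 * (d * \<bar>\<Delta>\<bar>) + b3 * (LINT s:{t..t+d}|lborel. v s)"
      by (simp add: algebra_simps power2_eq_square)
    define rem where "rem = f z - f y - f' y * (D + \<sigma> * \<Delta>) - f'' y * (D + \<sigma> * \<Delta>)\<^sup>2 / 2"
    have "\<bar>rem\<bar> \<le> K * \<bar>D + \<sigma> * \<Delta>\<bar> ^ 3"
      unfolding rem_def z using taylor2_bound[OF f f' f'' K(4)] .
    also have "\<dots> \<le> K * (4 * \<bar>D\<bar> ^ 3 + 4 * \<bar>\<sigma> * \<Delta>\<bar> ^ 3)"
      using abs_add_cubed_le K_nonneg by (intro mult_left_mono) auto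
    also have "\<dots> \<le> K * (4 * (R ^ 3 * d\<^sup>2) + 4 * (\<sigma> ^ 3 * \<bar>\<Delta>\<bar> ^ 3))"
    proof (intro mult_left_mono add_mono)
      have "\<bar>D\<bar> ^ 3 \<le> (R * d) ^ 3"
        using D by (intro power_mono) auto
      also have "\<dots> \<le> R ^ 3 * d\<^sup>2"
        \<comment> \<open>Here \<open>d \<le> 1\<close> lowers the power from \<open>d^3\<close> to
          \<open>d\<^sup>2\<close>.\<close>
        using d R_nonneg power_decreasing[of 2 3 d] by (auto simp: power_mult_distrib intro!: mult_left_mono)
      finally show "\<bar>D\<bar> ^ 3 \<le> R ^ 3 * d\<^sup>2" .
      show "\<bar>\<sigma> * \<Delta>\<bar> ^ 3 \<le> \<sigma> ^ 3 * \<bar>\<Delta>\<bar> ^ 3"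
        using \<sigma>_pos by (simp add: abs_mult power_mult_distrib)
    qed (use K_nonneg in auto)
    finally have rem: "\<bar>rem\<bar> \<le> K * (4 * (R ^ 3 * d\<^sup>2) + 4 * (\<sigma> ^ 3 * \<bar>\<Delta>\<bar> ^ 3))" .
    \<comment> \<open>What the quadratic Taylor term contains besides the square of the Wiener
      increment: the mixed term and the square of the drift.\<close>
    define q where "q = f'' y * (\<sigma> * D * \<Delta> + D\<^sup>2 / 2)"
    have q: "\<bar>q\<bar> \<le> K * (\<sigma> * R * (d * \<bar>\<Delta>\<bar>) + R\<^sup>2 * d\<^sup>2)"
      unfolding q_def abs_mult
    proof (intro mult_mono K)
      have "\<bar>\<sigma> * D * \<Delta>\<bar> \<le> \<sigma> * (R * d) * \<bar>\<Delta>\<bar>"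
        unfolding abs_mult using D \<sigma>_pos by (intro mult_mono) auto
      then have "\<bar>\<sigma> * D * \<Delta>\<bar> \<le> \<sigma> * R * (d * \<bar>\<Delta>\<bar>)"
        by (simp add: mult.assoc)
      moreover have "D\<^sup>2 \<le> R\<^sup>2 * d\<^sup>2"
        using D abs_le_square_iff[of D "R * d"] by (simp add: power_mult_distrib)
      moreover have "\<bar>D\<^sup>2 / 2\<bar> \<le> D\<^sup>2"
        by simp
      ultimately show "\<bar>\<sigma> * D * \<Delta> + D\<^sup>2 / 2\<bar> \<le> \<sigma> * R * (d * \<bar>\<Delta>\<bar>) + R\<^sup>2 * d\<^sup>2"
        using abs_triangle_ineq[of "\<sigma> * D * \<Delta>" "D\<^sup>2 / 2"] by linarith
    qed (use K_nonneg in auto)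
    have split: "(LINT s:{0..t+d}|lborel. exp (- \<alpha> * s) * drift_term s w)
        = (LINT s:{0..t}|lborel. exp (- \<alpha> * s) * drift_term s w)
          + (LINT s:{t..t+d}|lborel. exp (- \<alpha> * s) * drift_term s w)"
      using t d by (intro set_integral_Icc_split discounted_drift_term_continuous[OF w]) auto
    have "dynkin_increment t (t + d) w - martingale_part t d w
        = e * (rem + q) + (LINT s:{t..t+d}|lborel. j s)"
      unfolding int_j dynkin_process_def split martingale_part_def \<Delta>_def[symmetric] y_def[symmetric]
        z_def[symmetric] e_def[symmetric] rem_def q_def
      by (simp add: algebra_simps power2_eq_square add_divide_distrib diff_divide_distrib)
    also have "\<bar>\<dots>\<bar> \<le> 1 * (K * (4 * (R ^ 3 * d\<^sup>2) + 4 * (\<sigma> ^ 3 * \<bar>\<Delta>\<bar> ^ 3)) + K * (\<sigma> * R * (d * \<bar>\<Delta>\<bar>) + R\<^sup>2 * d\<^sup>2))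
        + (b1 * d\<^sup>2 + b2 * (d * \<bar>\<Delta>\<bar>) + b3 * (LINT s:{t..t+d}|lborel. v s))"
    proof (intro order.trans[OF abs_triangle_ineq] add_mono J)
      show "\<bar>e * (rem + q)\<bar> \<le> 1 * (K * (4 * (R ^ 3 * d\<^sup>2) + 4 * (\<sigma> ^ 3 * \<bar>\<Delta>\<bar> ^ 3)) + K * (\<sigma> * R * (d * \<bar>\<Delta>\<bar>) + R\<^sup>2 * d\<^sup>2))"
        unfolding abs_mult using e rem q by (intro mult_mono) auto
    qed
    also have "\<dots> = (a1 + b1) * d\<^sup>2 + (a2 + b2) * (d * \<bar>\<Delta>\<bar>) + a3 * \<bar>\<Delta>\<bar> ^ 3
          + b3 * (LINT s:{t..t + d}|lborel. v s)"
      by (simp add: a1_def a2_def a3_def algebra_simps)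
    finally show ?thesis
      by (simp add: \<Delta>_def v_def)
  qed
  show thesis
    by (rule that[OF _ _ _ _ bound])
      (use nn in \<open>auto simp: a1_def a2_def a3_def b1_def b2_def b3_def\<close>)
qed

end

section \<open>Expected time steps and Dynkin's formula at bounded stopping times\<close>

context bounded_drift_test_function
begin

lemma integrable_dynkin_process:
  assumes "0 \<le> t" shows "integrable P (dynkin_process t)"
  using dynkin_process_bound[OF _ assms order.refl]
  by (intro integrable_const_bound[where B = "K + drift_bound * t"]) auto

text \<open>Each term is a bounded factor known at time \<open>t\<close>, into which the indicator
  of \<open>A\<close> is absorbed, times a centred function of the independent increment.\<close>

lemma martingale_part_expectation:
  assumes t: "0 \<le> t" and d: "0 < d" and A: "A \<in> sets (\<F> (ennreal t))"
  shows "integrable P (\<lambda>w. indicator A w * martingale_part t d w)"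
    and "expectation (\<lambda>w. indicator A w * martingale_part t d w) = 0"
proof -
  define e where "e = exp (- \<alpha> * t)"
  have e: "0 \<le> e" "e \<le> 1"
    using t \<alpha> by (auto simp: e_def)
  have lt: "t < t + d" using d by simp
  define D where "D = (\<lambda>w. W (t + d) w - W t w)"
  have dist: "distributed P lborel D (normal_density 0 (sqrt d))"
    using W_dist[OF t lt] by (simp add: D_def)
  note M = centered_normal_moments[OF dist d]
  have [measurable]: "Y t \<in> borel_measurable (\<F> (ennreal t))" "A \<in> sets (\<F> (ennreal t))"
    using Y_adapted[OF t] A by auto
  have indep: "indep_set (sets (\<F> (ennreal t))) (sets (vimage_algebra (space P) D borel))"
    using W_indep[OF t lt] by (simp add: D_def)
  have D: "D \<in> borel_measurable P"
    unfolding D_def by measurable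
  have part: "integrable P (\<lambda>w. (indicator A w * c * g (Y t w)) * g\<^sub>2 (D w))
      \<and> expectation (\<lambda>w. (indicator A w * c * g (Y t w)) * g\<^sub>2 (D w)) = 0"
    if g [measurable]: "g \<in> borel_measurable borel" and gK: "\<And>y. \<bar>g y\<bar> \<le> K"
      and k: "g\<^sub>2 \<in> borel_measurable borel" "integrable P (\<lambda>w. g\<^sub>2 (D w))" "expectation (\<lambda>w. g\<^sub>2 (D w)) = 0"
    for g g\<^sub>2 :: "real \<Rightarrow> real" and c
  proof -
    have Z: "(\<lambda>w. indicator A w * c * g (Y t w)) \<in> borel_measurable (\<F> (ennreal t))"
      by measurable
    have Z_int: "integrable P (\<lambda>w. indicator A w * c * g (Y t w))"
    proof (rule integrable_const_bound[where B = "\<bar>c\<bar> * K"])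
      show "AE w in P. norm (indicator A w * c * g (Y t w)) \<le> \<bar>c\<bar> * K"
        using gK K_nonneg by (auto simp: abs_mult indicator_def intro!: mult_left_mono)
    qed (rule \<F>_measurable_imp[OF Z])
    show ?thesis
      using indep_set_expectation_mult[OF indep space_\<F> sub D Z Z_int k(1,2)] k(3) by simp
  qed
  have 1: "integrable P (\<lambda>w. (indicator A w * (e * \<sigma>) * f' (Y t w)) * D w)
      \<and> expectation (\<lambda>w. (indicator A w * (e * \<sigma>) * f' (Y t w)) * D w) = 0"
    using M(1,2) by (intro part[of f' "\<lambda>x. x"] K) auto
  have 2: "integrable P (\<lambda>w. (indicator A w * (e * (\<sigma>\<^sup>2 / 2)) * f'' (Y t w)) * ((D w)\<^sup>2 - d))
      \<and> expectation (\<lambda>w. (indicator A w * (e * (\<sigma>\<^sup>2 / 2)) * f'' (Y t w)) * ((D w)\<^sup>2 - d)) = 0"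
    using M(3,4) by (intro part[of f'' "\<lambda>x. x\<^sup>2 - d"] K) (auto simp: prob_space)
  have eq: "(\<lambda>w. indicator A w * martingale_part t d w)
      = (\<lambda>w. (indicator A w * (e * \<sigma>) * f' (Y t w)) * D w
         + (indicator A w * (e * (\<sigma>\<^sup>2 / 2)) * f'' (Y t w)) * ((D w)\<^sup>2 - d))"
    unfolding martingale_part_def e_def D_def by (simp add: algebra_simps)
  show "integrable P (\<lambda>w. indicator A w * martingale_part t d w)"
    "expectation (\<lambda>w. indicator A w * martingale_part t d w) = 0"
    unfolding eq using 1 2 by auto
qed

text \<open>Uniformity of \<open>C\<close> in \<open>t\<close> and \<open>A\<close> is the point: of
  the order of \<open>1 / d\<close> steps cover a bounded time interval, so their errors add up to a
  multiple of \<open>sqrt d\<close>.\<close>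

lemma one_step_expectation:
  obtains C where "0 \<le> C"
    "\<And>t d A. 0 \<le> t \<Longrightarrow> 0 < d \<Longrightarrow> d \<le> 1 \<Longrightarrow> A \<in> sets (\<F> (ennreal t)) \<Longrightarrow>
      \<bar>expectation (\<lambda>w. indicator A w * dynkin_increment t (t + d) w)\<bar> \<le> C * (d * sqrt d)"
proof -
  obtain c1 c2 c3 c4 where c: "0 \<le> c1" "0 \<le> c2" "0 \<le> c3" "0 \<le> c4"
    and path: "\<And>w t d. w \<in> space P \<Longrightarrow> 0 \<le> t \<Longrightarrow> 0 < d \<Longrightarrow> d \<le> 1 \<Longrightarrow>
      \<bar>dynkin_increment t (t + d) w - martingale_part t d w\<bar>
        \<le> c1 * d\<^sup>2 + c2 * (d * \<bar>W (t + d) w - W t w\<bar>) + c3 * \<bar>W (t + d) w - W t w\<bar> ^ 3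
          + c4 * (LINT s:{t..t + d}|lborel. \<bar>W s w - W t w\<bar>)"
    by (rule one_step_pathwise) (rule that; assumption)
  have main: "\<bar>expectation (\<lambda>w. indicator A w * dynkin_increment t (t + d) w)\<bar>
      \<le> (c1 + c2 + c3 * 2 + c4) * (d * sqrt d)"
    if t: "0 \<le> t" and d: "0 < d" "d \<le> 1" and A: "A \<in> sets (\<F> (ennreal t))" for t d A
  proof -
    have lt: "t < t + d" using d by simp
    have dist: "distributed P lborel (\<lambda>w. W (t + d) w - W t w) (normal_density 0 (sqrt d))"
      using W_dist[OF t lt] by simp
    note M = centered_normal_moments[OF dist d(1)]
    note N = integrated_increment[OF t d(1)]
    note Q = martingale_part_expectation[OF t d(1) A]
    have [measurable]: "A \<in> sets P"
      using A sub by auto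
    have int: "integrable P (\<lambda>w. indicator A w * dynkin_increment t (t + d) w)"
      using integrable_dynkin_process[of t] integrable_dynkin_process[of "t + d"] t d
      by (intro integrable_mult_indicator[where 'b = real, simplified]) auto
    define E where "E = (\<lambda>w. c1 * d\<^sup>2 + c2 * (d * \<bar>W (t + d) w - W t w\<bar>) + c3 * \<bar>W (t + d) w - W t w\<bar> ^ 3
          + c4 * (LINT s:{t..t + d}|lborel. \<bar>W s w - W t w\<bar>))"
    have E_int: "integrable P E"
      unfolding E_def using M(5,7) N(1) by auto
    have "\<bar>expectation (\<lambda>w. indicator A w * dynkin_increment t (t + d) w)\<bar>
       = \<bar>expectation (\<lambda>w. indicator A w * dynkin_increment t (t + d) w - indicator A w * martingale_part t d w)\<bar>"
      by (subst Bochner_Integration.integral_diff[OF int Q(1)]) (simp add: Q(2))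
    also have "\<dots> \<le> expectation (\<lambda>w. \<bar>indicator A w * dynkin_increment t (t + d) w - indicator A w * martingale_part t d w\<bar>)"
      by (rule integral_abs_bound)
    also have "\<dots> \<le> expectation E"
    proof (intro integral_mono E_int integrable_abs Bochner_Integration.integrable_diff int Q)
      fix w assume "w \<in> space P"
      from path[OF this t d] show "\<bar>indicator A w * dynkin_increment t (t + d) w - indicator A w * martingale_part t d w\<bar> \<le> E w"
        by (auto simp: E_def indicator_def intro: order.trans[OF abs_ge_zero])
    qed
    also have "expectation E = c1 * d\<^sup>2 + c2 * (d * expectation (\<lambda>w. \<bar>W (t + d) w - W t w\<bar>))
        + c3 * expectation (\<lambda>w. \<bar>W (t + d) w - W t w\<bar> ^ 3)
        + c4 * expectation (\<lambda>w. LINT s:{t..t + d}|lborel. \<bar>W s w - W t w\<bar>)"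
      unfolding E_def using M(5,7) N(1) by (simp add: prob_space)
    also have "\<dots> \<le> c1 * (d * sqrt d) + c2 * (d * sqrt d) + c3 * (2 * (d * sqrt d)) + c4 * (d * sqrt d)"
    proof (intro add_mono mult_left_mono M N c)
      have "d \<le> sqrt d"
        using d by (simp add: real_le_rsqrt power2_eq_square mult_left_le)
      then show "d\<^sup>2 \<le> d * sqrt d"
        using d by (simp add: power2_eq_square)
    qed (use d in auto)
    finally show ?thesis
      by (simp add: algebra_simps)
  qed
  show thesis
    by (rule that[OF _ main]) (use c in auto)
qed

text \<open>\<open>T\<close> is rounded up to a grid time \<open>S n\<close>. The process at
  \<open>S n\<close> telescopes into increments restricted to the events that \<open>T\<close> has
  not yet occurred, to which the one-step estimate applies; path continuity and bounded convergence
  then remove the rounding.\<close>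

theorem dynkin_formula:
  assumes T: "\<And>w. w \<in> space P \<Longrightarrow> 0 \<le> T w" "\<And>w. w \<in> space P \<Longrightarrow> T w \<le> real N"
    and T_stop: "\<And>t. 0 \<le> t \<Longrightarrow> {w \<in> space P. T w \<le> t} \<in> sets (\<F> (ennreal t))"
  shows "integrable P (\<lambda>w. dynkin_process (T w) w)"
    and "expectation (\<lambda>w. dynkin_process (T w) w) = expectation (dynkin_process 0)"
proof -
  obtain C where C: "0 \<le> C"
    and step: "\<And>t d A. 0 \<le> t \<Longrightarrow> 0 < d \<Longrightarrow> d \<le> 1 \<Longrightarrow> A \<in> sets (\<F> (ennreal t)) \<Longrightarrow>
      \<bar>expectation (\<lambda>w. indicator A w * dynkin_increment t (t + d) w)\<bar> \<le> C * (d * sqrt d)"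
    by (rule one_step_expectation) (rule that; assumption)
  define d where "d n = 1 / real (Suc n)" for n
  have d: "0 < d n" "d n \<le> 1" for n
    by (auto simp: d_def)
  \<comment> \<open>Rounding up makes \<open>j < k n w\<close> equivalent to
    \<open>real j * d n < T w\<close>, an event known at the start of step \<open>j\<close>.
    Rounding down would look ahead.\<close>
  define k where "k n w = nat \<lceil>T w / d n\<rceil>" for n w
  define S where "S n w = real (k n w) * d n" for n w
  \<comment> \<open>The mesh \<open>1 / Suc n\<close> divides \<open>N\<close>, so exactly this many
    steps reach time \<open>N\<close>.\<close>
  define J where "J n = N * Suc n" for n
  have Jd: "real (J n) * d n = real N" for n
    by (simp add: J_def d_def field_simps)
  have k_less: "j < k n w \<longleftrightarrow> real j * d n < T w" for j n w
  proof -
    have "j < k n w \<longleftrightarrow> real j < T w / d n"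
      unfolding k_def by (simp add: zless_nat_conj less_ceiling_iff zless_nat_eq_int_zless)
    then show ?thesis
      using d(1)[of n] by (simp add: field_simps)
  qed
  have k_le: "k n w \<le> J n" if "w \<in> space P" for n w
    using k_less[of "J n" n w] T(2)[OF that] Jd[of n] by (auto simp: not_less[symmetric])
  have S: "T w \<le> S n w" "S n w \<le> T w + d n" if "w \<in> space P" for n w
  proof -
    show "T w \<le> S n w"
      using k_less[of "k n w" n w] by (simp add: S_def)
    show "S n w \<le> T w + d n"
    proof (cases "k n w")
      case 0
      then show ?thesis using T(1)[OF that] d(1)[of n] by (simp add: S_def)
    next
      case (Suc i)
      then show ?thesis
        using k_less[of i n w] d(1)[of n] by (simp add: S_def algebra_simps)
    qed
  qed
  have S_nonneg: "0 \<le> S n w" for n w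
    using d(1)[of n] by (simp add: S_def)
  have S_le: "S n w \<le> real N + 1" if "w \<in> space P" for n w
    using S(2)[OF that] T(2)[OF that] d(2)[of n] by (meson add_mono order.trans)
  define A where "A n j = {w \<in> space P. real j * d n < T w}" for n j
  have A: "A n j \<in> sets (\<F> (ennreal (real j * d n)))" for n j
  proof -
    have "A n j = space (\<F> (ennreal (real j * d n))) - {w \<in> space P. T w \<le> real j * d n}"
      by (auto simp: A_def space_\<F>)
    then show ?thesis
      using T_stop[of "real j * d n"] d(1)[of n] by auto
  qed
  have A_P [measurable]: "A n j \<in> sets P" for n j
    using A sub by auto
  have telescope: "dynkin_process (S n w) w = dynkin_process 0 w
      + (\<Sum>j<J n. indicator (A n j) w * dynkin_increment (real j * d n) (real j * d n + d n) w)"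
    if "w \<in> space P" for n w
  proof -
    have ind: "indicator (A n j) w = (if j < k n w then 1 else 0 :: real)" for j
      using k_less[of j n w] that by (simp add: A_def indicator_def)
    have "(\<Sum>j<J n. indicator (A n j) w * dynkin_increment (real j * d n) (real j * d n + d n) w)
        = (\<Sum>j<k n w. indicator (A n j) w * dynkin_increment (real j * d n) (real j * d n + d n) w)"
      using k_le[OF that, of n] by (intro sum.mono_neutral_right) (auto simp: ind)
    also have "\<dots> = (\<Sum>j<k n w. dynkin_process (real (Suc j) * d n) w - dynkin_process (real j * d n) w)"
      by (intro sum.cong refl) (simp add: ind distrib_right add.commute)
    also have "\<dots> = dynkin_process (real (k n w) * d n) w - dynkin_process 0 w"
      by (subst sum_lessThan_telescope) simp
    finally show ?thesis by (simp add: S_def)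
  qed
  have int_term: "integrable P (\<lambda>w. indicator (A n j) w *
      dynkin_increment (real j * d n) (real j * d n + d n) w)" for n j
    using d(1)[of n] by (intro integrable_mult_indicator[where 'b = real, simplified]
        Bochner_Integration.integrable_diff integrable_dynkin_process) auto
  \<comment> \<open>Measurability at the random time is read off the telescoped sum, which involves
    deterministic times only.\<close>
  have meas_S [measurable]: "(\<lambda>w. dynkin_process (S n w) w) \<in> borel_measurable P" for n
    by (subst measurable_cong[OF telescope]) measurable
  have diff_bound: "\<bar>expectation (\<lambda>w. dynkin_process (S n w) w) - expectation (dynkin_process 0)\<bar>
      \<le> real N * C * sqrt (d n)" for n
  proof -
    have "expectation (\<lambda>w. dynkin_process (S n w) w) = expectation (\<lambda>w. dynkin_process 0 w
      + (\<Sum>j<J n. indicator (A n j) w * dynkin_increment (real j * d n) (real j * d n + d n) w))"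
      by (intro Bochner_Integration.integral_cong telescope) auto
    also have "\<dots> = expectation (dynkin_process 0) + (\<Sum>j<J n. expectation (\<lambda>w. indicator (A n j) w *
        dynkin_increment (real j * d n) (real j * d n + d n) w))"
      by (subst Bochner_Integration.integral_add)
        (simp_all only: integrable_dynkin_process order.refl Bochner_Integration.integrable_sum int_term
          Bochner_Integration.integral_sum)
    finally have "\<bar>expectation (\<lambda>w. dynkin_process (S n w) w) - expectation (dynkin_process 0)\<bar>
       = \<bar>\<Sum>j<J n. expectation (\<lambda>w. indicator (A n j) w *
        dynkin_increment (real j * d n) (real j * d n + d n) w)\<bar>"
      by simp
    also have "\<dots> \<le> (\<Sum>j<J n. C * (d n * sqrt (d n)))"
      using d[of n] A by (intro order.trans[OF sum_abs] sum_mono step) auto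
    also have "\<dots> = (real (J n) * d n) * C * sqrt (d n)"
      by simp
    finally show ?thesis by (simp add: Jd)
  qed
  have d_lim: "d \<longlonglongrightarrow> 0"
    unfolding d_def using LIMSEQ_Suc[OF lim_1_over_n] by simp
  have path_lim: "(\<lambda>n. dynkin_process (S n w) w) \<longlonglongrightarrow> dynkin_process (T w) w" if w: "w \<in> space P" for w
  proof (rule continuous_on_tendsto_compose[OF dynkin_process_continuous[OF w, of "real N + 1"]])
    show "(\<lambda>n. S n w) \<longlonglongrightarrow> T w"
    proof (rule tendsto_sandwich[where f = "\<lambda>_. T w" and h = "\<lambda>n. T w + d n"])
      show "(\<lambda>n. T w + d n) \<longlonglongrightarrow> T w"
        using tendsto_add[OF tendsto_const d_lim, of "T w"] by simp
    qed (use S[OF w] in auto)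
    show "T w \<in> {0..real N + 1}"
      using T[OF w] by simp
    show "\<forall>\<^sub>F n in sequentially. S n w \<in> {0..real N + 1}"
      using S_le[OF w] S_nonneg by simp
  qed
  have meas_T [measurable]: "(\<lambda>w. dynkin_process (T w) w) \<in> borel_measurable P"
    using path_lim meas_S by (rule borel_measurable_LIMSEQ_real)
  let ?B = "K + drift_bound * (real N + 1)"
  have bound_S: "AE w in P. norm (dynkin_process (S n w) w) \<le> ?B" for n
    using dynkin_process_bound[OF _ S_nonneg S_le] by auto
  show "integrable P (\<lambda>w. dynkin_process (T w) w)"
    using dynkin_process_bound[OF _ T] by (intro integrable_const_bound[where B = "K + drift_bound * real N"]) auto
  have "(\<lambda>n. expectation (\<lambda>w. dynkin_process (S n w) w)) \<longlonglongrightarrow> expectation (\<lambda>w. dynkin_process (T w) w)"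
    by (rule integral_dominated_convergence[where w = "\<lambda>_. ?B"]) (use path_lim bound_S in auto)
  moreover have "(\<lambda>n. expectation (\<lambda>w. dynkin_process (S n w) w)) \<longlonglongrightarrow> expectation (dynkin_process 0)"
  proof (rule LIM_zero_cancel, rule Lim_null_comparison)
    show "\<forall>\<^sub>F n in sequentially. norm (expectation (\<lambda>w. dynkin_process (S n w) w) - expectation (dynkin_process 0))
        \<le> real N * C * sqrt (d n)"
      using diff_bound by simp
    show "(\<lambda>n. real N * C * sqrt (d n)) \<longlonglongrightarrow> 0"
      using tendsto_mult_left[OF tendsto_real_sqrt[OF d_lim], of "real N * C"] by simp
  qed
  ultimately show "expectation (\<lambda>w. dynkin_process (T w) w) = expectation (dynkin_process 0)"
    by (rule LIMSEQ_unique)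
qed

end

section \<open>Cutoff functions\<close>

text \<open>Away from 0 this is a constant or a power. At 0 the exponent is at least two, so the
  difference quotient is at most \<open>\<bar>h\<bar> ^ Suc n\<close> and vanishes in the
  limit.\<close>

lemma DERIV_positive_part_power:
  "((\<lambda>t. max 0 t ^ Suc (Suc n)) has_real_derivative real (Suc (Suc n)) * max 0 t ^ Suc n) (at t)"
proof -
  consider "t < 0" | "t = 0" | "0 < t" by linarith
  then show ?thesis
  proof cases
    case 1
    have "((\<lambda>t. 0) has_real_derivative 0) (at t)" by simp
    then have "((\<lambda>t. max 0 t ^ Suc (Suc n)) has_real_derivative 0) (at t)"
      by (rule has_field_derivative_transform_within[where d = "- t"]) (use 1 in \<open>auto simp: dist_real_def max_def\<close>)
    with 1 show ?thesis by simp
  next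
    case 2
    have "((\<lambda>h::real. max 0 h ^ Suc (Suc n) / h) \<longlongrightarrow> 0) (at 0)"
    proof (rule Lim_null_comparison)
      show "\<forall>\<^sub>F h::real in at 0. norm (max 0 h ^ Suc (Suc n) / h) \<le> \<bar>h\<bar> ^ Suc n"
      proof (intro always_eventually allI)
        fix h :: real
        show "norm (max 0 h ^ Suc (Suc n) / h) \<le> \<bar>h\<bar> ^ Suc n"
        proof (cases "0 < h")
          case False
          then have "max 0 h = 0" by simp
          show ?thesis unfolding \<open>max 0 h = 0\<close> by simp
        qed (simp add: max_def)
      qed
      have "((\<lambda>h::real. \<bar>h\<bar> ^ Suc n) \<longlongrightarrow> \<bar>0\<bar> ^ Suc n) (at 0)"
        by (intro tendsto_intros)
      then show "((\<lambda>h::real. \<bar>h\<bar> ^ Suc n) \<longlongrightarrow> 0) (at 0)" by simp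
    qed
    with 2 show ?thesis by (simp add: DERIV_def)
  next
    case 3
    have "((\<lambda>t. t ^ Suc (Suc n)) has_real_derivative real (Suc (Suc n)) * t ^ Suc n) (at t)"
      using DERIV_pow[of "Suc (Suc n)" t] by simp
    then have "((\<lambda>t. max 0 t ^ Suc (Suc n)) has_real_derivative real (Suc (Suc n)) * t ^ Suc n) (at t)"
      by (rule has_field_derivative_transform_within[where d = t]) (use 3 in \<open>auto simp: dist_real_def max_def\<close>)
    with 3 show ?thesis by (simp add: max_def)
  qed
qed

lemma smooth_step:
  obtains g g' g'' g''' :: "real \<Rightarrow> real" where
    "\<And>t. (g has_real_derivative g' t) (at t)" "\<And>t. (g' has_real_derivative g'' t) (at t)"
    "\<And>t. (g'' has_real_derivative g''' t) (at t)" "continuous_on UNIV g'''"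
    "\<And>t. t \<le> 0 \<Longrightarrow> g t = 1" "\<And>t. t \<le> 0 \<Longrightarrow> g' t = 0" "\<And>t. t \<le> 0 \<Longrightarrow> g'' t = 0"
    "\<And>t. t \<ge> 1 \<Longrightarrow> g t = 0" "\<And>t. t \<ge> 1 \<Longrightarrow> g' t = 0" "\<And>t. t \<ge> 1 \<Longrightarrow> g'' t = 0" "\<And>t. t \<ge> 1 \<Longrightarrow> g''' t = 0"
proof -
  \<comment> \<open>The fourth power of the positive part is three times continuously
    differentiable. In \<open>p (1 - p t)\<close> the inner \<open>p\<close> flattens the step at
    \<open>t \<le> 0\<close>, the outer one at \<open>t \<ge> 1\<close>.\<close>
  define p p' p'' p''' :: "real \<Rightarrow> real" where
    "p t = max 0 t ^ 4" and "p' t = 4 * max 0 t ^ 3" and "p'' t = 12 * max 0 t ^ 2" and "p''' t = 24 * max 0 t" for t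
  have p: "(p has_real_derivative p' t) (at t)" for t
    using DERIV_positive_part_power[of 2 t] by (simp add: p_def[abs_def] p'_def numeral_eq_Suc)
  have p': "(p' has_real_derivative p'' t) (at t)" for t
    using DERIV_cmult[OF DERIV_positive_part_power[of 1 t], of 4] by (simp add: p'_def[abs_def] p''_def numeral_eq_Suc)
  have p'': "(p'' has_real_derivative p''' t) (at t)" for t
    using DERIV_cmult[OF DERIV_positive_part_power[of 0 t], of 12] by (simp add: p''_def[abs_def] p'''_def numeral_eq_Suc)
  have cont: "continuous_on UNIV p" "continuous_on UNIV p'" "continuous_on UNIV p''" "continuous_on UNIV p'''"
    unfolding p_def[abs_def] p'_def[abs_def] p''_def[abs_def] p'''_def[abs_def] by (intro continuous_intros)+
  note cc = continuous_on_compose2[OF cont(1)] continuous_on_compose2[OF cont(2)]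
    continuous_on_compose2[OF cont(3)] continuous_on_compose2[OF cont(4)]
  have neg: "p t = 0" "p' t = 0" "p'' t = 0" "p''' t = 0" if "t \<le> 0" for t
    using that by (auto simp: p_def p'_def p''_def p'''_def max_def)
  have ge: "1 - p t \<le> 0" if "t \<ge> 1" for t
    using that one_le_power[of t 4] by (simp add: p_def max_def)
  define q where "q t = 1 - p t" for t
  have q: "(q has_real_derivative - p' t) (at t)" for t
    unfolding q_def[abs_def] by (auto intro!: derivative_eq_intros p)
  have q_cont: "continuous_on UNIV q"
    unfolding q_def[abs_def] by (intro continuous_intros cont)
  note pq = DERIV_chain2[OF p q] DERIV_chain2[OF p' q] DERIV_chain2[OF p'' q]
  show thesis
  proof (rule that[of "\<lambda>t. p (q t)" "\<lambda>t. p' (q t) * - p' t"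
        "\<lambda>t. p'' (q t) * (p' t)\<^sup>2 - p' (q t) * p'' t"
        "\<lambda>t. - p''' (q t) * (p' t) ^ 3 + 3 * p'' (q t) * p' t * p'' t - p' (q t) * p''' t"])
    show "((\<lambda>t. p (q t)) has_real_derivative p' (q t) * - p' t) (at t)" for t
      by (rule pq)
    show "((\<lambda>t. p' (q t) * - p' t) has_real_derivative p'' (q t) * (p' t)\<^sup>2 - p' (q t) * p'' t) (at t)" for t
      by (rule DERIV_cong[OF DERIV_mult[OF pq(2) DERIV_minus[OF p']]]) (simp add: power2_eq_square algebra_simps)
    show "((\<lambda>t. p'' (q t) * (p' t)\<^sup>2 - p' (q t) * p'' t) has_real_derivative
        - p''' (q t) * (p' t) ^ 3 + 3 * p'' (q t) * p' t * p'' t - p' (q t) * p''' t) (at t)" for t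
      by (rule DERIV_cong[OF DERIV_diff[OF DERIV_mult[OF pq(3) DERIV_power[OF p', of 2]] DERIV_mult[OF pq(2) p'']]])
        (simp add: power2_eq_square power3_eq_cube algebra_simps)
    show "continuous_on UNIV (\<lambda>t. - p''' (q t) * (p' t) ^ 3 + 3 * p'' (q t) * p' t * p'' t - p' (q t) * p''' t)"
      by (intro continuous_intros cont cc q_cont) auto
  qed (use neg ge in \<open>auto simp: q_def p_def\<close>)
qed

lemma compact_support_bounded:
  fixes g :: "real \<Rightarrow> real"
  assumes "continuous_on UNIV g" and "\<And>y. L \<le> \<bar>y\<bar> \<Longrightarrow> g y = 0"
  obtains C where "0 \<le> C" "\<And>y. \<bar>g y\<bar> \<le> C"
proof -
  have "bounded (g ` {-L..L})"
    using assms(1) by (intro compact_imp_bounded compact_continuous_image) (auto intro: continuous_on_subset)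
  then obtain C where "\<forall>z\<in>g ` {-L..L}. norm z \<le> C"
    unfolding bounded_iff by blast
  then have C: "\<bar>g y\<bar> \<le> C" if "y \<in> {-L..L}" for y
    using that by auto
  show thesis
  proof (rule that[of "max C 0"])
    show "\<bar>g y\<bar> \<le> max C 0" for y
    proof (cases "L \<le> \<bar>y\<bar>")
      case False
      then have "y \<in> {-L..L}" by (auto simp: abs_le_iff)
      then show ?thesis using C by fastforce
    qed (simp add: assms(2))
  qed simp
qed

text \<open>Multiplication by a cutoff that is 1 on [-L, L] and 0 outside [-L - 1, L + 1]. The third
  derivative of \<open>V\<close> is given only with a local bound, so compactness handles every term
  except the one that contains it.\<close>

lemma localized_test_function:
  fixes V V' V'' V''' :: "real \<Rightarrow> real"
  assumes V: "\<And>y. (V has_real_derivative V' y) (at y)" and V': "\<And>y. (V' has_real_derivative V'' y) (at y)"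
    and V'': "\<And>y. (V'' has_real_derivative V''' y) (at y)" and B: "\<And>y. \<bar>y\<bar> \<le> L + 1 \<Longrightarrow> \<bar>V''' y\<bar> \<le> B"
    and L: "0 \<le> L"
  obtains f f' f'' f''' K where
    "\<And>y. (f has_real_derivative f' y) (at y)" "\<And>y. (f' has_real_derivative f'' y) (at y)"
    "\<And>y. (f'' has_real_derivative f''' y) (at y)"
    "\<And>y. \<bar>f y\<bar> \<le> K" "\<And>y. \<bar>f' y\<bar> \<le> K" "\<And>y. \<bar>f'' y\<bar> \<le> K" "\<And>y. \<bar>f''' y\<bar> \<le> K"
    "\<And>y. \<bar>y\<bar> \<le> L \<Longrightarrow> f y = V y" "\<And>y. \<bar>y\<bar> \<le> L \<Longrightarrow> f' y = V' y" "\<And>y. \<bar>y\<bar> \<le> L \<Longrightarrow> f'' y = V'' y"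
proof (rule smooth_step)
  fix g g' g'' g''' :: "real \<Rightarrow> real"
  assume g: "\<And>t. (g has_real_derivative g' t) (at t)" and g': "\<And>t. (g' has_real_derivative g'' t) (at t)"
    and g'': "\<And>t. (g'' has_real_derivative g''' t) (at t)" and g'''_cont: "continuous_on UNIV g'''"
    and g0: "\<And>t. t \<le> 0 \<Longrightarrow> g t = 1" "\<And>t. t \<le> 0 \<Longrightarrow> g' t = 0" "\<And>t. t \<le> 0 \<Longrightarrow> g'' t = 0"
    and g1: "\<And>t. t \<ge> 1 \<Longrightarrow> g t = 0" "\<And>t. t \<ge> 1 \<Longrightarrow> g' t = 0" "\<And>t. t \<ge> 1 \<Longrightarrow> g'' t = 0" "\<And>t. t \<ge> 1 \<Longrightarrow> g''' t = 0"
  define r l where "r y = y - L" and "l y = - y - L" for y :: real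
  have r: "(r has_real_derivative 1) (at y)" and l: "(l has_real_derivative - 1) (at y)" for y
    unfolding r_def[abs_def] l_def[abs_def] by (auto intro!: derivative_eq_intros)
  note gr = DERIV_chain2[OF g r] DERIV_chain2[OF g' r] DERIV_chain2[OF g'' r]
  note gl = DERIV_chain2[OF g l] DERIV_chain2[OF g' l] DERIV_chain2[OF g'' l]
  define \<theta> where "\<theta> y = g (r y) * g (l y)" for y
  define \<theta>' where "\<theta>' y = g' (r y) * g (l y) - g (r y) * g' (l y)" for y
  define \<theta>'' where "\<theta>'' y = g'' (r y) * g (l y) - 2 * g' (r y) * g' (l y) + g (r y) * g'' (l y)" for y
  define \<theta>''' where "\<theta>''' y = g''' (r y) * g (l y) - 3 * g'' (r y) * g' (l y) + 3 * g' (r y) * g'' (l y) - g (r y) * g''' (l y)" for y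
  have \<theta>: "(\<theta> has_real_derivative \<theta>' y) (at y)" for y
    unfolding \<theta>_def[abs_def] \<theta>'_def
    by (rule DERIV_cong[OF DERIV_mult[OF gr(1) gl(1)]]) (simp add: algebra_simps)
  have \<theta>': "(\<theta>' has_real_derivative \<theta>'' y) (at y)" for y
    unfolding \<theta>'_def[abs_def] \<theta>''_def
    by (rule DERIV_cong[OF DERIV_diff[OF DERIV_mult[OF gr(2) gl(1)] DERIV_mult[OF gr(1) gl(2)]]]) (simp add: algebra_simps)
  have \<theta>'': "(\<theta>'' has_real_derivative \<theta>''' y) (at y)" for y
    unfolding \<theta>''_def[abs_def] \<theta>'''_def
    by (rule DERIV_cong[OF DERIV_add[OF DERIV_diff[OF DERIV_mult[OF gr(3) gl(1)] DERIV_mult[OF DERIV_cmult[OF gr(2), of 2] gl(2)]]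
            DERIV_mult[OF gr(1) gl(3)]]]) (simp add: algebra_simps)
  have cont: "continuous_on UNIV F" if "\<And>y. (F has_real_derivative F' y) (at y)" for F F' :: "real \<Rightarrow> real"
    using DERIV_isCont[OF that] by (intro continuous_at_imp_continuous_on) auto
  note c = cont[OF \<theta>] cont[OF \<theta>'] cont[OF \<theta>''] cont[OF V] cont[OF V'] cont[OF V'']
  have \<theta>'''_cont: "continuous_on UNIV \<theta>'''"
    unfolding \<theta>'''_def[abs_def]
    by (intro continuous_intros continuous_on_compose2[OF cont[OF g]] continuous_on_compose2[OF cont[OF g']]
      continuous_on_compose2[OF cont[OF g'']] continuous_on_compose2[OF g'''_cont] cont[OF r] cont[OF l]) auto
  have inner: "\<theta> y = 1" "\<theta>' y = 0" "\<theta>'' y = 0" if "\<bar>y\<bar> \<le> L" for y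
    using that by (auto simp: \<theta>_def \<theta>'_def \<theta>''_def r_def l_def g0)
  have outer: "\<theta> y = 0 \<and> \<theta>' y = 0 \<and> \<theta>'' y = 0 \<and> \<theta>''' y = 0" if "L + 1 \<le> \<bar>y\<bar>" for y
  proof -
    have "1 \<le> r y \<or> 1 \<le> l y"
      using that by (auto simp: r_def l_def abs_if split: if_splits)
    then show ?thesis
      by (auto simp: \<theta>_def \<theta>'_def \<theta>''_def \<theta>'''_def g1)
  qed
  define f where "f y = V y * \<theta> y" for y
  define f' where "f' y = V' y * \<theta> y + V y * \<theta>' y" for y
  define f'' where "f'' y = V'' y * \<theta> y + 2 * V' y * \<theta>' y + V y * \<theta>'' y" for y
  \<comment> \<open>The continuous part of the third derivative of \<open>f\<close>; the remaining
    term \<open>V''' y * \<theta> y\<close> is estimated by \<open>B\<close> directly.\<close>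
  define e where "e y = 3 * V'' y * \<theta>' y + 3 * V' y * \<theta>'' y + V y * \<theta>''' y" for y
  have 1: "(f has_real_derivative f' y) (at y)" for y
    unfolding f_def[abs_def] f'_def
    by (rule DERIV_cong[OF DERIV_mult[OF V \<theta>]]) (simp add: algebra_simps)
  have 2: "(f' has_real_derivative f'' y) (at y)" for y
    unfolding f'_def[abs_def] f''_def
    by (rule DERIV_cong[OF DERIV_add[OF DERIV_mult[OF V' \<theta>] DERIV_mult[OF V \<theta>']]]) (simp add: algebra_simps)
  have 3: "(f'' has_real_derivative V''' y * \<theta> y + e y) (at y)" for y
    unfolding f''_def[abs_def] e_def
    by (rule DERIV_cong[OF DERIV_add[OF DERIV_add[OF DERIV_mult[OF V'' \<theta>]
            DERIV_mult[OF DERIV_cmult[OF V', of 2] \<theta>']] DERIV_mult[OF V \<theta>'']]]) (simp add: algebra_simps)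
  have e_cont: "continuous_on UNIV e"
    unfolding e_def[abs_def] by (intro continuous_intros c \<theta>'''_cont)
  obtain C0 where C0: "0 \<le> C0" "\<And>y. \<bar>f y\<bar> \<le> C0"
    by (rule compact_support_bounded[OF cont[OF 1], of "L + 1"]) (use outer in \<open>auto simp: f_def\<close>)
  obtain C1 where C1: "0 \<le> C1" "\<And>y. \<bar>f' y\<bar> \<le> C1"
    by (rule compact_support_bounded[OF cont[OF 2], of "L + 1"]) (use outer in \<open>auto simp: f'_def\<close>)
  obtain C2 where C2: "0 \<le> C2" "\<And>y. \<bar>f'' y\<bar> \<le> C2"
    by (rule compact_support_bounded[OF cont[OF 3], of "L + 1"]) (use outer in \<open>auto simp: f''_def\<close>)
  obtain C3 where C3: "0 \<le> C3" "\<And>y. \<bar>e y\<bar> \<le> C3"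
    by (rule compact_support_bounded[OF e_cont, of "L + 1"]) (use outer in \<open>auto simp: e_def\<close>)
  obtain C4 where C4: "0 \<le> C4" "\<And>y. \<bar>\<theta> y\<bar> \<le> C4"
    by (rule compact_support_bounded[OF c(1), of "L + 1"]) (use outer in auto)
  have "B \<ge> 0"
    using B[of 0] L by simp
  have b: "\<bar>V''' y * \<theta> y\<bar> \<le> B * C4" for y
  proof (cases "\<bar>y\<bar> \<le> L + 1")
    case True
    then show ?thesis
      unfolding abs_mult using B[OF True] C4 \<open>B \<ge> 0\<close> by (intro mult_mono) auto
  next
    case False
    then show ?thesis
      using outer[of y] \<open>B \<ge> 0\<close> C4(1) by simp
  qed
  have BC: "0 \<le> B * C4"
    using \<open>B \<ge> 0\<close> C4(1) by simp
  show thesis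
  proof (rule that[OF 1 2 3, of "C0 + C1 + C2 + (B * C4 + C3)"])
    show "\<bar>f y\<bar> \<le> C0 + C1 + C2 + (B * C4 + C3)" for y
      using C0(2)[of y] C1(1) C2(1) C3(1) BC by linarith
    show "\<bar>f' y\<bar> \<le> C0 + C1 + C2 + (B * C4 + C3)" for y
      using C1(2)[of y] C0(1) C2(1) C3(1) BC by linarith
    show "\<bar>f'' y\<bar> \<le> C0 + C1 + C2 + (B * C4 + C3)" for y
      using C2(2)[of y] C0(1) C1(1) C3(1) BC by linarith
    show "\<bar>V''' y * \<theta> y + e y\<bar> \<le> C0 + C1 + C2 + (B * C4 + C3)" for y
      using b[of y] C3(2)[of y] C0(1) C1(1) C2(1) by linarith
  qed (auto simp: f_def f'_def f''_def inner)
qed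

section \<open>Hitting times\<close>

text \<open>Upward passage of a level; downward passage is expressed by applying it to the negated
  process. The infimum of the empty set is \<infinity>, which encodes never hitting.\<close>

definition hitting_time :: "(real \<Rightarrow> 'a \<Rightarrow> real) \<Rightarrow> real \<Rightarrow> 'a \<Rightarrow> ennreal" where
  "hitting_time Z c w = Inf (ennreal ` {t. 0 \<le> t \<and> c \<le> Z t w})"

lemma less_hitting_timeD: "0 \<le> s \<Longrightarrow> ennreal s < hitting_time Z c w \<Longrightarrow> Z s w < c"
  unfolding hitting_time_def by (metis (mono_tags, lifting) Inf_lower imageI linorder_not_less mem_Collect_eq)

text \<open>If the level is not reached up to \<open>t\<close>, continuity keeps the path below it
  for a little longer, so the infimum exceeds \<open>t\<close> strictly.\<close>

lemma hitting_time_le_iff: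
  assumes cont: "continuous_on {0..} (\<lambda>t. Z t w)" and "0 \<le> t"
  shows "hitting_time Z c w \<le> ennreal t \<longleftrightarrow> (\<exists>s\<in>{0..t}. c \<le> Z s w)"
proof
  assume "\<exists>s\<in>{0..t}. c \<le> Z s w"
  then obtain s where s: "0 \<le> s" "s \<le> t" "c \<le> Z s w" by auto
  then have "hitting_time Z c w \<le> ennreal s"
    unfolding hitting_time_def by (intro Inf_lower) auto
  also have "\<dots> \<le> ennreal t"
    using s by (intro ennreal_leI)
  finally show "hitting_time Z c w \<le> ennreal t" .
next
  assume le: "hitting_time Z c w \<le> ennreal t"
  show "\<exists>s\<in>{0..t}. c \<le> Z s w"
  proof (rule ccontr)
    assume *: "\<not> (\<exists>s\<in>{0..t}. c \<le> Z s w)"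
    have "isCont_right": "((\<lambda>s. Z s w) \<longlongrightarrow> Z t w) (at t within {0..})"
      using cont \<open>0 \<le> t\<close> by (auto simp: continuous_on_def)
    moreover have "Z t w < c"
      using * \<open>0 \<le> t\<close> by force
    ultimately have "\<forall>\<^sub>F s in at t within {0..}. Z s w < c"
      by (rule order_tendstoD)
    then obtain d where d: "0 < d" "\<And>s. 0 \<le> s \<Longrightarrow> s \<noteq> t \<Longrightarrow> dist s t < d \<Longrightarrow> Z s w < c"
      by (auto simp: eventually_at)
    have "ennreal (t + d) \<le> hitting_time Z c w"
      unfolding hitting_time_def
    proof (rule Inf_greatest)
      fix y assume "y \<in> ennreal ` {t. 0 \<le> t \<and> c \<le> Z t w}"
      then obtain s where s: "y = ennreal s" "0 \<le> s" "c \<le> Z s w" by auto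
      have "t < s"
        using * s by force
      then have "t + d \<le> s"
        using d(2)[of s] s by (force simp: dist_real_def)
      then show "ennreal (t + d) \<le> y"
        using s by (simp add: ennreal_leI)
    qed
    with le have "ennreal (t + d) \<le> ennreal t"
      by (rule order.trans[rotated])
    then show False
      using \<open>0 \<le> t\<close> d(1) by (simp add: ennreal_le_iff)
  qed
qed

lemma hitting_time_attained:
  assumes "continuous_on {0..} (\<lambda>t. Z t w)" "0 \<le> t" "hitting_time Z c w = ennreal t"
  shows "c \<le> Z t w"
proof -
  obtain s where s: "0 \<le> s" "s \<le> t" "c \<le> Z s w"
    using hitting_time_le_iff[of Z w t c, OF assms(1,2)] assms(3) by auto
  have "ennreal t \<le> ennreal s"
    using assms(3) hitting_time_le_iff[of Z w s c, OF assms(1) s(1)] s by auto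
  then have "s = t"
    using s by (simp add: ennreal_le_iff)
  with s show ?thesis by simp
qed

text \<open>Before the hitting time the path is strictly below \<open>c\<close>, and continuity
  gives the weak inequality at that time itself. The hypothesis on \<open>Z 0\<close> covers
  immediate hitting, where there is no earlier time.\<close>

lemma le_hitting_timeD:
  assumes cont: "continuous_on {0..} (\<lambda>t. Z t w)" and Z0: "Z 0 w \<le> c"
    and s: "0 \<le> s" "ennreal s \<le> hitting_time Z c w"
  shows "Z s w \<le> c"
proof (cases "s = 0")
  case False
  then have "0 < s" using s by simp
  have cs: "continuous_on {0..s} (\<lambda>t. Z t w)"
    using cont by (rule continuous_on_subset) auto
  have lt: "Z t w \<le> c" if "t \<in> {0..<s}" for t
  proof -
    have "ennreal t < ennreal s"
      using that by (simp add: ennreal_less_iff)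
    then have "ennreal t < hitting_time Z c w"
      using s(2) by (rule order.strict_trans2)
    then show ?thesis
      using less_hitting_timeD[of t Z c w] that by simp
  qed
  have "s \<in> closure {0..<s}"
    using \<open>0 < s\<close> by (simp add: closure_atLeastLessThan)
  moreover have "closure {0..<s} \<subseteq> {0..s}"
    using \<open>0 < s\<close> by (simp add: closure_atLeastLessThan)
  ultimately show ?thesis
    using continuous_le_on_closure[of "{0..<s}" "\<lambda>t. Z t w" s c] cs \<open>0 < s\<close> lt
    by (simp add: closure_atLeastLessThan)
qed (use Z0 in simp)

text \<open>Turns an uncountable union into countable operations on times up to \<open>r\<close>.
  The slack \<open>1 / Suc n\<close> compensates for a maximum at a time that is no rational
  multiple of \<open>r\<close>; the converse uses that the maximum on \<open>{0..r}\<close> is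
  attained. Allowing \<open>q = 1\<close> includes the endpoint.\<close>

lemma hit_before_iff_rational:
  fixes z :: "real \<Rightarrow> real"
  assumes cont: "continuous_on {0..} z" and r: "0 \<le> r"
  shows "(\<exists>s\<in>{0..r}. c \<le> z s) \<longleftrightarrow> (\<forall>n::nat. \<exists>q\<in>\<rat> \<inter> {0..1}. c - 1 / real (Suc n) < z (q * r))"
proof
  assume "\<exists>s\<in>{0..r}. c \<le> z s"
  then obtain s where s: "0 \<le> s" "s \<le> r" "c \<le> z s" by auto
  show "\<forall>n::nat. \<exists>q\<in>\<rat> \<inter> {0..1}. c - 1 / real (Suc n) < z (q * r)"
  proof
    fix n :: nat
    show "\<exists>q\<in>\<rat> \<inter> {0..1}. c - 1 / real (Suc n) < z (q * r)"
    proof (cases "s = r")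
      case True
      have "c - 1 / real (Suc n) < z (1 * r)"
        using s True by (smt (verit) of_nat_0_less_iff zero_less_Suc zero_less_divide_1_iff mult_1)
      then show ?thesis
        by (intro bexI[of _ 1]) auto
    next
      case False
      then have "s < r" "0 < r" using s by auto
      have "((\<lambda>s. z s) \<longlongrightarrow> z s) (at s within {0..})"
        using cont s(1) by (auto simp: continuous_on_def)
      moreover have less: "c - 1 / real (Suc n) < z s"
        using s by (smt (verit) of_nat_0_less_iff zero_less_Suc zero_less_divide_1_iff)
      ultimately have "\<forall>\<^sub>F s in at s within {0..}. c - 1 / real (Suc n) < z s"
        by (rule order_tendstoD)
      then obtain d where d: "0 < d" "\<And>t. 0 \<le> t \<Longrightarrow> t \<noteq> s \<Longrightarrow> dist t s < d \<Longrightarrow> c - 1 / real (Suc n) < z t"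
        by (auto simp: eventually_at)
      have "s / r < min r (s + d) / r"
        using \<open>s < r\<close> \<open>0 < r\<close> d(1) by (intro divide_strict_right_mono) auto
      then obtain q where q: "q \<in> \<rat>" "s / r < q" "q < min r (s + d) / r"
        using Rats_dense_in_real by blast
      have "s < q * r" "q * r < min r (s + d)"
        using q \<open>0 < r\<close> by (auto simp: field_simps)
      moreover have "0 \<le> q"
        using zero_less_mult_pos2[of q r] \<open>s < q * r\<close> s(1) \<open>0 < r\<close> by simp
      moreover have "q \<le> 1"
        using \<open>q * r < min r (s + d)\<close> \<open>0 < r\<close> by simp
      ultimately show ?thesis
        using q(1) d(2)[of "q * r"] s(1) by (intro bexI[of _ q]) (auto simp: dist_real_def)
    qed
  qed
next
  assume *: "\<forall>n::nat. \<exists>q\<in>\<rat> \<inter> {0..1}. c - 1 / real (Suc n) < z (q * r)"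
  have "continuous_on {0..r} z"
    using cont by (rule continuous_on_subset) auto
  then obtain s where s: "s \<in> {0..r}" "\<And>t. t \<in> {0..r} \<Longrightarrow> z t \<le> z s"
    using continuous_attains_sup[of "{0..r}" z] r by auto
  have "c - 1 / real (Suc n) \<le> z s" for n :: nat
  proof -
    obtain q where "q \<in> {0..1}" "c - 1 / real (Suc n) < z (q * r)"
      using * by blast
    then show ?thesis
      using s(2)[of "q * r"] r by (auto simp: mult_left_le_one_le)
  qed
  moreover have "(\<lambda>n. c - 1 / real (Suc n)) \<longlonglongrightarrow> c - 0"
    by (intro tendsto_diff tendsto_const LIMSEQ_Suc lim_1_over_n)
  ultimately have "c - 0 \<le> z s"
    by (intro LIMSEQ_le_const2) auto
  with s show "\<exists>s\<in>{0..r}. c \<le> z s" by auto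
qed

lemma stopping_time_hitting_time:
  fixes Z :: "real \<Rightarrow> 'a \<Rightarrow> real"
  assumes filt: "filtration \<Omega> \<F>"
    and Z: "\<And>t. 0 \<le> t \<Longrightarrow> Z t \<in> borel_measurable (\<F> (ennreal t))"
    and cont: "\<And>w. w \<in> \<Omega> \<Longrightarrow> continuous_on {0..} (\<lambda>t. Z t w)"
  shows "stopping_time \<F> (hitting_time Z c)"
proof
  interpret filtration \<Omega> \<F> by (rule filt)
  fix t
  show "Measurable.pred (\<F> t) (\<lambda>w. hitting_time Z c w \<le> t)"
  proof (cases t)
    case (real r)
    have [measurable]: "Z (q * r) \<in> borel_measurable (\<F> t)" if "q \<in> \<rat> \<inter> {0..1}" for q
    proof -
      have qr: "0 \<le> q * r" "q * r \<le> r"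
        using that real by (auto simp: mult_left_le_one_le)
      then have "sets (\<F> (ennreal (q * r))) \<subseteq> sets (\<F> t)"
        unfolding real by (intro sets_F_mono ennreal_leI)
      then show ?thesis
        using Z[OF qr(1)] by (auto simp: measurable_def space_F)
    qed
    have "countable (\<rat> \<inter> {0..1::real})"
      by (intro countable_Int1 countable_rat)
    then have "Measurable.pred (\<F> t) (\<lambda>w. \<forall>n::nat. \<exists>q\<in>\<rat> \<inter> {0..1}. c - 1 / real (Suc n) < Z (q * r) w)"
      by measurable
    moreover have "hitting_time Z c w \<le> t \<longleftrightarrow>
        (\<forall>n::nat. \<exists>q\<in>\<rat> \<inter> {0..1}. c - 1 / real (Suc n) < Z (q * r) w)" if "w \<in> space (\<F> t)" for w
      using hitting_time_le_iff[of Z w r c] hit_before_iff_rational[of "\<lambda>t. Z t w" r c] cont that real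
      by (simp add: space_F)
    ultimately show ?thesis
      by (subst measurable_cong)
  qed simp
qed

section \<open>Diffusions with locally bounded drift\<close>

locale diffusion = prob_space P for P :: "'a measure" +
  fixes \<F> :: "ennreal \<Rightarrow> 'a measure" and \<sigma> x \<alpha> :: real and m :: "real \<Rightarrow> real"
    and W X :: "real \<Rightarrow> 'a \<Rightarrow> real"
  assumes \<sigma>: "0 < \<sigma>" and \<alpha>: "0 < \<alpha>" and m_cont: "\<And>y. isCont m y"
    and sde: "sde_solution P \<F> m \<sigma> W x X"
begin

lemma filtration_P: "filtration (space P) \<F>" and sets_\<F>: "sets (\<F> t) \<subseteq> sets P"
  using sde by (auto simp: sde_solution_def filtered_prob_space_def)

lemma space_\<F>: "space (\<F> t) = space P"
  using filtration_P by (simp add: filtration_def)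

lemma measurable_\<F>_mono: "s \<le> t \<Longrightarrow> Z \<in> borel_measurable (\<F> s) \<Longrightarrow> Z \<in> borel_measurable (\<F> t)"
  using filtration.sets_F_mono[OF filtration_P, of s t] by (auto simp: measurable_def space_\<F>)

lemma measurable_\<F>_imp_P: "Z \<in> borel_measurable (\<F> t) \<Longrightarrow> Z \<in> borel_measurable P"
  using sets_\<F>[of t] by (auto simp: measurable_def space_\<F>)

lemma X_adapted: "0 \<le> t \<Longrightarrow> X t \<in> borel_measurable (\<F> (ennreal t))"
  and W_adapted: "0 \<le> t \<Longrightarrow> W t \<in> borel_measurable (\<F> (ennreal t))"
  using sde by (auto simp: sde_solution_def wiener_process_def adapted_def)

lemma X_paths: "w \<in> space P \<Longrightarrow> continuous_on {0..} (\<lambda>t. X t w)"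
  and W_paths: "w \<in> space P \<Longrightarrow> continuous_on {0..} (\<lambda>t. W t w)"
  using sde by (auto simp: sde_solution_def wiener_process_def continuous_paths_def)

lemma AE_start: "AE w in P. X 0 w = x"
  using sde by (auto simp: sde_solution_def)

lemma X_max_measurable [measurable]: "X (max 0 t) \<in> borel_measurable P"
  by (rule measurable_\<F>_imp_P[OF X_adapted]) simp

lemma X_max_paths: "w \<in> space P \<Longrightarrow> continuous_on UNIV (\<lambda>t. X (max 0 t) w)"
  by (rule continuous_on_compose2[OF X_paths]) (auto intro!: continuous_intros)

lemma stopping_time_measurable: "stopping_time \<F> \<tau> \<Longrightarrow> \<tau> \<in> borel_measurable P"
  by (rule measurable_stopping_time[OF _ sets_\<F> space_\<F>])

lemma m_continuous: "continuous_on S m"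
  using m_cont by (intro continuous_at_imp_continuous_on) auto

lemma m_measurable [measurable]: "m \<in> borel_measurable borel"
  by (intro borel_measurable_continuous_onI m_continuous)

text \<open>Until \<open>X\<close> leaves an interval on which \<open>\<bar>m\<bar> \<le> R\<close>, it coincides almost surely with a process whose
  drift is bounded by \<open>R\<close>. This replaces moment estimates for \<open>X\<close>.\<close>

definition truncated_drift :: "real \<Rightarrow> real \<Rightarrow> 'a \<Rightarrow> real" where
  "truncated_drift R t w = max (- R) (min R (m (X (max 0 t) w)))"

text \<open>The drift is taken along \<open>X\<close>, so this is an explicit formula and no
  equation has to be solved. Subtracting \<open>W 0\<close> makes it start at \<open>x\<close> for
  every outcome, although \<open>W 0 = 0\<close> holds only almost surely.\<close>

definition truncated_process :: "real \<Rightarrow> real \<Rightarrow> 'a \<Rightarrow> real" where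
  "truncated_process R t w = x + (LINT s:{0..max 0 t}|lborel. truncated_drift R s w)
     + \<sigma> * (W (max 0 t) w - W 0 w)"

lemma truncated_drift_paths: "w \<in> space P \<Longrightarrow> continuous_on UNIV (\<lambda>t. truncated_drift R t w)"
  unfolding truncated_drift_def
  by (intro continuous_intros continuous_on_compose2[OF m_continuous X_max_paths]) auto

lemma bounded_drift_process_truncated:
  assumes R: "0 \<le> R"
  shows "bounded_drift_process P \<F> \<sigma> R (\<lambda>t. W (max 0 t)) (truncated_process R) (truncated_drift R)"
proof (intro bounded_drift_process.intro bounded_drift_process_axioms.intro)
  show "prob_space P" by unfold_locales
  show "filtration (space P) \<F>" by (rule filtration_P)
  show "sets (\<F> t) \<subseteq> sets P" for t by (rule sets_\<F>)
  show "0 < \<sigma>" by (rule \<sigma>)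
  show W_meas [measurable]: "W (max 0 t) \<in> borel_measurable P" for t
    by (rule measurable_\<F>_imp_P[OF W_adapted]) simp
  show W_cont: "continuous_on UNIV (\<lambda>t. W (max 0 t) w)" if "w \<in> space P" for w
    by (rule continuous_on_compose2[OF W_paths[OF that]]) (auto intro!: continuous_intros)
  show "distributed P lborel (\<lambda>w. W (max 0 t) w - W (max 0 s) w) (normal_density 0 (sqrt (t - s)))"
    if "0 \<le> s" "s < t" for s t
    using sde that by (auto simp: sde_solution_def wiener_process_def max_def)
  show "indep_set (sets (\<F> (ennreal s)))
      (sets (vimage_algebra (space P) (\<lambda>w. W (max 0 t) w - W (max 0 s) w) borel))"
    if "0 \<le> s" "s < t" for s t
    using sde that by (auto simp: sde_solution_def wiener_process_def max_def)
  show \<beta>_meas [measurable]: "truncated_drift R t \<in> borel_measurable P" for t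
    unfolding truncated_drift_def by measurable
  show \<beta>_cont: "continuous_on UNIV (\<lambda>t. truncated_drift R t w)" if "w \<in> space P" for w
    by (rule truncated_drift_paths[OF that])
  show "\<bar>truncated_drift R t w\<bar> \<le> R" for t w
    using R by (auto simp: truncated_drift_def)
  show Y_adapted: "truncated_process R t \<in> borel_measurable (\<F> (ennreal t))" if t: "0 \<le> t" for t
  proof -
    \<comment> \<open>Freezing time at \<open>t\<close> makes the integrand measurable at time
      \<open>t\<close> for every \<open>s\<close>, without changing the integral over
      \<open>{0..t}\<close>.\<close>
    have [measurable]: "X (max 0 (min s t)) \<in> borel_measurable (\<F> (ennreal t))" for s
      by (rule measurable_\<F>_mono[OF _ X_adapted]) (use t in \<open>auto intro: ennreal_leI\<close>)
    have [measurable]: "W t \<in> borel_measurable (\<F> (ennreal t))" "W 0 \<in> borel_measurable (\<F> (ennreal t))"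
      using t by (auto intro!: measurable_\<F>_mono[OF _ W_adapted] ennreal_leI)
    have [measurable]: "(\<lambda>w. LINT s:{0..t}|lborel. max (- R) (min R (m (X (max 0 (min s t)) w))))
        \<in> borel_measurable (\<F> (ennreal t))"
    proof (rule measurable_set_integral_process)
      show "continuous_on UNIV (\<lambda>s. max (- R) (min R (m (X (max 0 (min s t)) w))))"
        if "w \<in> space (\<F> (ennreal t))" for w
        using that unfolding space_\<F>
        by (intro continuous_intros continuous_on_compose2[OF m_continuous] continuous_on_compose2[OF X_paths]) auto
    qed measurable
    have "truncated_process R t = (\<lambda>w. x + (LINT s:{0..t}|lborel. max (- R) (min R (m (X (max 0 (min s t)) w))))
       + \<sigma> * (W t w - W 0 w))"
      unfolding truncated_process_def[abs_def] truncated_drift_def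
      using t by (auto intro!: ext set_lebesgue_integral_cong simp: min_def max_def)
    then show ?thesis by simp
  qed
  show "truncated_process R t \<in> borel_measurable P" for t
  proof -
    have "truncated_process R t = truncated_process R (max 0 t)"
      by (simp add: truncated_process_def fun_eq_iff)
    then show ?thesis
      using measurable_\<F>_imp_P[OF Y_adapted[of "max 0 t"]] by simp
  qed
  show Y_eq: "truncated_process R t w - truncated_process R s w
      = (LINT r:{s..t}|lborel. truncated_drift R r w) + \<sigma> * (W (max 0 t) w - W (max 0 s) w)"
    if "w \<in> space P" "0 \<le> s" "s \<le> t" for w s t
    using set_integral_Icc_split[OF \<beta>_cont[OF that(1)] that(2,3)] that
    by (simp add: truncated_process_def max_def algebra_simps)
  show "continuous_on UNIV (\<lambda>t. truncated_process R t w)" if w: "w \<in> space P" for w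
  proof -
    have c: "continuous_on {0..} (\<lambda>t. LINT s:{0..t}|lborel. truncated_drift R s w)"
      unfolding continuous_on_eq_continuous_within
    proof
      fix t :: real assume t: "t \<in> {0..}"
      have "continuous (at t within {0..t + 1}) (\<lambda>t. LINT s:{0..t}|lborel. truncated_drift R s w)"
        using continuous_on_set_integral[OF \<beta>_cont[OF w], of "t + 1"] t
        by (auto simp: continuous_on_eq_continuous_within)
      moreover have "at t within {0..t + 1} = at t within {0..}"
        by (rule at_within_nhd[of _ "{..<t + 1}"]) (use t in auto)
      ultimately show "continuous (at t within {0..}) (\<lambda>t. LINT s:{0..t}|lborel. truncated_drift R s w)"
        by simp
    qed
    show ?thesis
      unfolding truncated_process_def
      by (intro continuous_intros continuous_on_compose2[OF c] W_cont[OF w]) auto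
  qed
qed

lemma AE_truncated_process_eq:
  assumes "\<And>y. \<bar>y\<bar> \<le> L \<Longrightarrow> \<bar>m y\<bar> \<le> R"
  shows "AE w in P. \<forall>t\<ge>0. (\<forall>s\<in>{0..t}. \<bar>X s w\<bar> \<le> L) \<longrightarrow>
    truncated_process R t w = X t w \<and> truncated_drift R t w = m (X t w)"
proof -
  have "AE w in P. \<forall>t\<ge>0. X t w = X 0 w + (LINT s:{0..t}|lborel. m (X s w)) + \<sigma> * W t w"
    "AE w in P. W 0 w = 0"
    using sde by (auto simp: sde_solution_def wiener_process_def)
  with AE_start show ?thesis
  proof eventually_elim
    case (elim w)
    show ?case
    proof (intro allI impI)
      fix t :: real assume t: "0 \<le> t" and XL: "\<forall>s\<in>{0..t}. \<bar>X s w\<bar> \<le> L"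
      have eq: "truncated_drift R s w = m (X s w)" if "s \<in> {0..t}" for s
        using assms[of "X s w"] XL that by (auto simp: truncated_drift_def max_def min_def abs_le_iff)
      have "(LINT s:{0..t}|lborel. truncated_drift R s w) = (LINT s:{0..t}|lborel. m (X s w))"
        by (intro set_lebesgue_integral_cong) (auto simp: eq)
      moreover have "X t w = x + (LINT s:{0..t}|lborel. m (X s w)) + \<sigma> * W t w"
        using elim(2)[rule_format, OF t] elim(1) by (simp only:)
      moreover have "max 0 t = t"
        using t by simp
      ultimately have "truncated_process R t w = X t w"
        unfolding truncated_process_def elim(3) by simp
      with eq[of t] t show "truncated_process R t w = X t w \<and> truncated_drift R t w = m (X t w)"
        by simp
    qed
  qed
qed

text \<open>\<open>Z\<close> is the Dynkin process for the clipped drift and the cut-off version of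
  \<open>V\<close>, taken at time \<open>T\<close>. Neither replacement is visible while
  \<open>X\<close> stays in [-L, L]. As the identification holds almost surely only, the expectation
  is attached to \<open>Z\<close>.\<close>

lemma localized_dynkin:
  fixes V V' V'' V''' :: "real \<Rightarrow> real" and N :: nat
  assumes V: "\<And>y. (V has_real_derivative V' y) (at y)" "\<And>y. (V' has_real_derivative V'' y) (at y)"
      "\<And>y. (V'' has_real_derivative V''' y) (at y)"
    and B: "\<And>y. \<bar>y\<bar> \<le> L + 1 \<Longrightarrow> \<bar>V''' y\<bar> \<le> B" and L: "\<bar>x\<bar> \<le> L"
    and T: "\<And>w. w \<in> space P \<Longrightarrow> 0 \<le> T w" "\<And>w. w \<in> space P \<Longrightarrow> T w \<le> real N"
    and T_stop: "\<And>t. 0 \<le> t \<Longrightarrow> {w \<in> space P. T w \<le> t} \<in> sets (\<F> (ennreal t))"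
    and XL: "AE w in P. \<forall>s\<in>{0..T w}. \<bar>X s w\<bar> \<le> L"
  obtains Z where "integrable P Z" "expectation Z = V x"
    "AE w in P. Z w = exp (- \<alpha> * T w) * V (X (T w) w)
      - (LINT s:{0..T w}|lborel. exp (- \<alpha> * s)
          * (\<sigma>\<^sup>2 / 2 * V'' (X s w) + m (X s w) * V' (X s w) - \<alpha> * V (X s w)))"
proof -
  have L0: "0 \<le> L" using L by simp
  have "bounded (m ` {-L..L})"
    by (intro compact_imp_bounded compact_continuous_image m_continuous) auto
  then obtain R where R: "\<forall>z\<in>m ` {-L..L}. norm z \<le> R"
    unfolding bounded_iff by blast
  have mR: "\<bar>m y\<bar> \<le> R" if "\<bar>y\<bar> \<le> L" for y
    using R that by (auto simp: abs_le_iff)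
  have R0: "0 \<le> R"
    using mR[of 0] L0 by simp
  show thesis
  proof (rule localized_test_function[OF V B L0])
    fix f f' f'' f''' K
    assume f: "\<And>y. (f has_real_derivative f' y) (at y)" "\<And>y. (f' has_real_derivative f'' y) (at y)"
      "\<And>y. (f'' has_real_derivative f''' y) (at y)"
      and K: "\<And>y. \<bar>f y\<bar> \<le> K" "\<And>y. \<bar>f' y\<bar> \<le> K" "\<And>y. \<bar>f'' y\<bar> \<le> K" "\<And>y. \<bar>f''' y\<bar> \<le> K"
      and fV: "\<And>y. \<bar>y\<bar> \<le> L \<Longrightarrow> f y = V y" "\<And>y. \<bar>y\<bar> \<le> L \<Longrightarrow> f' y = V' y" "\<And>y. \<bar>y\<bar> \<le> L \<Longrightarrow> f'' y = V'' y"
    interpret Y: bounded_drift_process P \<F> \<sigma> R "\<lambda>t. W (max 0 t)" "truncated_process R" "truncated_drift R"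
      by (rule bounded_drift_process_truncated[OF R0])
    interpret Y: bounded_drift_test_function P \<F> \<sigma> R "\<lambda>t. W (max 0 t)" "truncated_process R" "truncated_drift R"
      \<alpha> K f f' f'' f'''
      by unfold_locales (use \<alpha> f K in auto)
    note D = Y.dynkin_formula[OF T T_stop]
    have zero: "(LINT s:{0::real}|lborel. g s) = (0::real)" for g
      unfolding set_lebesgue_integral_def
    proof (rule integral_eq_zero_AE)
      show "AE s in lborel. indicator {0} s *\<^sub>R g s = 0"
        using AE_lborel_singleton[of 0] by eventually_elim simp
    qed
    have "Y.dynkin_process 0 = (\<lambda>w. V x)"
      using fV(1)[OF L] by (simp add: fun_eq_iff Y.dynkin_process_def truncated_process_def zero)
    then have E: "expectation (\<lambda>w. Y.dynkin_process (T w) w) = V x"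
      using D(2) by (simp add: prob_space)
    have process_eq: "AE w in P. \<forall>t\<ge>0. (\<forall>s\<in>{0..t}. \<bar>X s w\<bar> \<le> L) \<longrightarrow>
        truncated_process R t w = X t w \<and> truncated_drift R t w = m (X t w)"
      by (rule AE_truncated_process_eq) (rule mR)
    show thesis
    proof (rule that[OF D(1) E])
      show "AE w in P. Y.dynkin_process (T w) w = exp (- \<alpha> * T w) * V (X (T w) w)
        - (LINT s:{0..T w}|lborel. exp (- \<alpha> * s)
          * (\<sigma>\<^sup>2 / 2 * V'' (X s w) + m (X s w) * V' (X s w) - \<alpha> * V (X s w)))"
        using process_eq XL AE_space
      proof eventually_elim
        case (elim w)
        have eq: "truncated_process R s w = X s w" "truncated_drift R s w = m (X s w)" "\<bar>X s w\<bar> \<le> L"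
          if "s \<in> {0..T w}" for s
          using elim that by auto
        have "T w \<in> {0..T w}"
          using T(1)[OF elim(3)] by simp
        moreover have "(LINT s:{0..T w}|lborel. exp (- \<alpha> * s) * Y.drift_term s w)
          = (LINT s:{0..T w}|lborel. exp (- \<alpha> * s)
              * (\<sigma>\<^sup>2 / 2 * V'' (X s w) + m (X s w) * V' (X s w) - \<alpha> * V (X s w)))"
          by (intro set_lebesgue_integral_cong) (auto simp: Y.drift_term_def eq fV)
        ultimately show ?case
          by (simp add: Y.dynkin_process_def eq fV)
      qed
    qed
  qed
qed

end

section \<open>Discount factors and stopped time intervals\<close>

lemma
  fixes a :: real
  assumes "0 < a"
  shows set_integrable_exp_atLeast: "set_integrable lborel {0..} (\<lambda>s. exp (- a * s))"
    and set_integral_exp_atLeast: "(LINT s:{0..}|lborel. exp (- a * s)) = 1 / a"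
proof -
  have F: "((\<lambda>s. - exp (- a * s) / a) has_real_derivative exp (- a * y)) (at y)" for y
    using assms by (auto intro!: derivative_eq_intros)
  have "filterlim (\<lambda>s. a * s) at_top at_top"
    using assms by (intro filterlim_tendsto_pos_mult_at_top[OF tendsto_const]) (auto simp: filterlim_ident)
  then have "filterlim (\<lambda>s. - a * s) at_bot at_top"
    by (simp add: filterlim_uminus_at_bot)
  then have "((\<lambda>s. exp (- a * s)) \<longlongrightarrow> 0) at_top"
    by (rule filterlim_compose[OF exp_at_bot])
  from tendsto_divide[OF tendsto_minus[OF this] tendsto_const[of a]]
  have lim: "((\<lambda>s. - exp (- a * s) / a) \<longlongrightarrow> 0) at_top"
    using assms by simp
  have cont: "isCont (\<lambda>s. exp (- a * s)) y" for y by simp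
  from integral_FTC_at_top_nonneg[OF F cont _ lim, of 0]
  show "set_integrable lborel {0..} (\<lambda>s. exp (- a * s))" "(LINT s:{0..}|lborel. exp (- a * s)) = 1 / a"
    by auto
qed

lemma stopped_interval: "{s. 0 \<le> s \<and> ennreal s \<le> t} = (if t = \<infinity> then {0..} else {0..enn2real t})"
proof (cases t)
  case (real r)
  then show ?thesis by (auto simp: ennreal_le_iff)
qed auto

text \<open>The discounted reward of the constant 1. Thus subtracting a constant from the reward
  changes the Gittins numerator by a multiple of the denominator.\<close>

lemma set_integral_exp_stopped:
  assumes "0 < a"
  shows "(LINT s:{s. 0 \<le> s \<and> ennreal s \<le> t}|lborel. exp (- a * s)) = (1 - discount a t) / a"
  using assms by (simp add: stopped_interval discount_def set_integral_exp_atLeast[simplified] set_integral_exp_Icc[simplified])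

lemma discount_bounds: "0 < a \<Longrightarrow> 0 \<le> discount a t" "0 < a \<Longrightarrow> discount a t \<le> 1"
  by (auto simp: discount_def)

lemma discount_measurable:
  assumes [measurable]: "\<tau> \<in> borel_measurable M"
  shows "(\<lambda>w. discount a (\<tau> w)) \<in> borel_measurable M"
  unfolding discount_def by measurable

lemma discount_antimono: "0 < a \<Longrightarrow> s \<le> t \<Longrightarrow> discount a t \<le> discount a s"
  by (cases s; cases t) (auto simp: discount_def ennreal_le_iff top_unique)

section \<open>Exhaustion by bounded stopping times\<close>

context diffusion
begin

text \<open>The exit from a bounded interval permits clipping and cutoff; the cap at time
  \<open>n\<close> provides the bounded stopping time required by Dynkin's formula.\<close>

definition exhaustion :: "nat \<Rightarrow> 'a \<Rightarrow> ennreal" where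
  "exhaustion n w = min (hitting_time (\<lambda>t w. \<bar>X t w\<bar>) (real n) w) (ennreal (real n))"

lemma stopping_time_exhaustion: "stopping_time \<F> (exhaustion n)"
proof -
  have "stopping_time \<F> (hitting_time (\<lambda>t w. \<bar>X t w\<bar>) (real n))"
  proof (rule stopping_time_hitting_time[OF filtration_P])
    show "(\<lambda>w. \<bar>X t w\<bar>) \<in> borel_measurable (\<F> (ennreal t))" if "0 \<le> t" for t
      using X_adapted[OF that] by measurable
    show "continuous_on {0..} (\<lambda>t. \<bar>X t w\<bar>)" if "w \<in> space P" for w
      by (intro continuous_intros X_paths[OF that])
  qed
  then show ?thesis
    unfolding exhaustion_def[abs_def] by (rule stopping_time_min[OF _ stopping_time_const])
qed

text \<open>A continuous path is bounded on \<open>{0..K}\<close>, so for large \<open>n\<close>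
  neither the level \<open>n\<close> nor the cap is met by time \<open>K\<close>.\<close>

lemma eventually_exhaustion:
  assumes w: "w \<in> space P" and K: "0 \<le> K"
  shows "eventually (\<lambda>n. ennreal K < exhaustion n w) sequentially"
proof -
  have cont: "continuous_on {0..} (\<lambda>t. \<bar>X t w\<bar>)"
    by (intro continuous_intros X_paths[OF w])
  have "bounded ((\<lambda>t. \<bar>X t w\<bar>) ` {0..K})"
    by (intro compact_imp_bounded compact_continuous_image continuous_on_subset[OF cont]) auto
  then obtain C where C: "\<forall>z\<in>(\<lambda>t. \<bar>X t w\<bar>) ` {0..K}. norm z \<le> C"
    unfolding bounded_iff by blast
  obtain N where N: "max C K < real N"
    using reals_Archimedean2 by blast
  have "eventually (\<lambda>n. max C K < real n) sequentially"
    by (rule eventually_sequentiallyI[of N]) (use N in auto)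
  then show ?thesis
  proof eventually_elim
    case (elim n)
    have "\<not> hitting_time (\<lambda>t w. \<bar>X t w\<bar>) (real n) w \<le> ennreal K"
      using hitting_time_le_iff[of "\<lambda>t w. \<bar>X t w\<bar>" w K "real n", OF cont K] C elim by force
    then show ?case
      using elim K by (simp add: exhaustion_def ennreal_less_iff)
  qed
qed

lemma exhaustion_finite: "exhaustion n w < \<infinity>"
  by (simp add: exhaustion_def min_less_iff_disj)

lemma discount_exhaustion_tendsto:
  assumes "w \<in> space P"
  shows "(\<lambda>n. discount \<alpha> (exhaustion n w)) \<longlonglongrightarrow> 0"
proof (rule order_tendstoI)
  fix e :: real assume "0 < e"
  \<comment> \<open>A nonnegative time strictly beyond the one at which the discount factor equals
    \<open>e\<close>.\<close>
  define K where "K = max 0 (- ln e / \<alpha>) + 1"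
  have "exp (- \<alpha> * K) < e"
  proof -
    have "- ln e / \<alpha> < K" by (simp add: K_def)
    then have "- \<alpha> * K < ln e"
      using \<alpha> by (simp add: field_simps)
    then show ?thesis
      using \<open>0 < e\<close> by (metis exp_less_mono exp_ln)
  qed
  have "eventually (\<lambda>n. ennreal K < exhaustion n w) sequentially"
    by (rule eventually_exhaustion[OF assms]) (simp add: K_def)
  then show "eventually (\<lambda>n. discount \<alpha> (exhaustion n w) < e) sequentially"
  proof eventually_elim
    case (elim n)
    have "discount \<alpha> (exhaustion n w) \<le> discount \<alpha> (ennreal K)"
      using elim by (intro discount_antimono \<alpha>) auto
    also have "\<dots> < e"
    proof -
      have "0 \<le> K" by (simp add: K_def)
      with \<open>exp (- \<alpha> * K) < e\<close> show ?thesis by (simp add: discount_def)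
    qed
    finally show ?case .
  qed
next
  fix e :: real assume "e < 0"
  then show "eventually (\<lambda>n. e < discount \<alpha> (exhaustion n w)) sequentially"
  proof (intro always_eventually allI)
    fix n show "e < discount \<alpha> (exhaustion n w)"
      using \<open>e < 0\<close> discount_bounds(1)[OF \<alpha>] by (rule order.strict_trans2)
  qed
qed

lemma AE_bounded_before_exhaustion:
  assumes "\<bar>x\<bar> \<le> real n"
  shows "AE w in P. \<forall>s\<ge>0. ennreal s \<le> exhaustion n w \<longrightarrow> \<bar>X s w\<bar> \<le> real n"
  using AE_start AE_space
proof eventually_elim
  case (elim w)
  have "continuous_on {0..} (\<lambda>t. \<bar>X t w\<bar>)"
    by (intro continuous_intros X_paths elim)
  then show ?case
    using le_hitting_timeD[of "\<lambda>t w. \<bar>X t w\<bar>" w "real n"] elim assms by (auto simp: exhaustion_def)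
qed

text \<open>The replacement of \<open>s\<close> by \<open>max 0 s\<close> is invisible under the
  indicator, but gives a path that is continuous on the whole line.\<close>

abbreviation running_reward :: "(real \<Rightarrow> real) \<Rightarrow> ennreal \<Rightarrow> 'a \<Rightarrow> real \<Rightarrow> real" where
  "running_reward g t w s \<equiv> indicator {s. 0 \<le> s \<and> ennreal s \<le> t} s * (g (X (max 0 s) w) * exp (- \<alpha> * s))"

abbreviation stopped :: "('a \<Rightarrow> ennreal) \<Rightarrow> nat \<Rightarrow> 'a \<Rightarrow> ennreal" where
  "stopped \<tau> n \<equiv> \<lambda>w. min (\<tau> w) (exhaustion n w)"

lemma discounted_reward_alt:
  "discounted_reward g \<alpha> X \<tau> w
    = (\<integral>s. running_reward g (\<tau> w) w s \<partial>lborel)"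
  unfolding discounted_reward_def set_lebesgue_integral_def
  by (intro Bochner_Integration.integral_cong) (auto simp: indicator_def)

section \<open>Discounted rewards of bounded continuous functions\<close>

context
  fixes g :: "real \<Rightarrow> real" and G :: real
  assumes g_cont: "\<And>y. isCont g y" and g_bound: "\<And>y. \<bar>g y\<bar> \<le> G"
begin

lemma g_measurable [measurable]: "g \<in> borel_measurable borel"
  using g_cont by (intro borel_measurable_continuous_onI continuous_at_imp_continuous_on) auto

lemma reward_path_measurable:
  assumes "w \<in> space P"
  shows "(\<lambda>s. g (X (max 0 s) w) * exp (- \<alpha> * s)) \<in> borel_measurable borel"
proof -
  have [measurable]: "(\<lambda>s. X (max 0 s) w) \<in> borel_measurable borel"
    by (rule borel_measurable_continuous_onI[OF X_max_paths[OF assms]])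
  show ?thesis by measurable
qed

lemma reward_envelope:
  "\<bar>running_reward g t w s\<bar>
    \<le> G * (indicator {0..} s * exp (- \<alpha> * s))"
  using g_bound[of "X (max 0 s) w"] order.trans[OF abs_ge_zero g_bound]
  by (auto simp: indicator_def abs_mult)

lemma envelope_integrable: "integrable lborel (\<lambda>s. G * (indicator {0..} s * exp (- \<alpha> * s)))"
  and envelope_integral: "(\<integral>s. G * (indicator {0..} s * exp (- \<alpha> * s)) \<partial>lborel) = G / \<alpha>"
  using set_integrable_exp_atLeast[OF \<alpha>] set_integral_exp_atLeast[OF \<alpha>]
  by (auto simp: set_integrable_def set_lebesgue_integral_def)

lemma reward_integrable:
  assumes "w \<in> space P"
  shows "integrable lborel (\<lambda>s. running_reward g t w s)"
proof (rule Bochner_Integration.integrable_bound[OF envelope_integrable])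
  have [measurable]: "(\<lambda>s. g (X (max 0 s) w) * exp (- \<alpha> * s)) \<in> borel_measurable borel"
    by (rule reward_path_measurable[OF assms])
  show "(\<lambda>s. running_reward g t w s) \<in> borel_measurable lborel"
    by measurable
  show "AE s in lborel. norm (running_reward g t w s)
      \<le> norm (G * (indicator {0..} s * exp (- \<alpha> * s)))"
    using reward_envelope[of t _ w] by (auto intro!: AE_I2 order.trans[OF _ abs_ge_self])
qed

lemma discounted_reward_bound: "w \<in> space P \<Longrightarrow> \<bar>discounted_reward g \<alpha> X \<tau> w\<bar> \<le> G / \<alpha>"
  unfolding discounted_reward_alt envelope_integral[symmetric]
  using reward_envelope
  by (intro order.trans[OF integral_abs_bound] integral_mono integrable_abs reward_integrable envelope_integrable) auto

lemma discounted_reward_measurable: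
  assumes [measurable]: "\<tau> \<in> borel_measurable P"
  shows "discounted_reward g \<alpha> X \<tau> \<in> borel_measurable P"
proof -
  have [measurable]: "(\<lambda>p. X (max 0 (snd p)) (fst p)) \<in> borel_measurable (P \<Otimes>\<^sub>M borel)"
    by (rule measurable_continuous_process[OF X_max_measurable X_max_paths])
  have [measurable]: "Measurable.pred (P \<Otimes>\<^sub>M borel) (\<lambda>p. snd p \<in> {s. 0 \<le> s \<and> ennreal s \<le> \<tau> (fst p)})"
    unfolding mem_Collect_eq by measurable
  have "(\<lambda>p. indicator {s. 0 \<le> s \<and> ennreal s \<le> \<tau> (fst p)} (snd p) * (g (X (max 0 (snd p)) (fst p)) * exp (- \<alpha> * snd p)))
      \<in> borel_measurable (P \<Otimes>\<^sub>M borel)"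
    by measurable
  then show ?thesis
    unfolding discounted_reward_alt[abs_def]
    by (intro lborel.borel_measurable_lebesgue_integral) (simp add: split_beta')
qed

lemma discounted_reward_integrable:
  assumes "\<tau> \<in> borel_measurable P"
  shows "integrable P (discounted_reward g \<alpha> X \<tau>)"
  using discounted_reward_bound discounted_reward_measurable[OF assms]
  by (intro integrable_const_bound[where B = "G / \<alpha>"]) auto

lemma discounted_reward_shift:
  assumes "w \<in> space P"
  shows "discounted_reward (\<lambda>y. g y - c) \<alpha> X \<tau> w
    = discounted_reward g \<alpha> X \<tau> w - c * ((1 - discount \<alpha> (\<tau> w)) / \<alpha>)"
proof -
  let ?A = "{s. 0 \<le> s \<and> ennreal s \<le> \<tau> w}"
  have int: "integrable lborel (\<lambda>s. c * (indicator ?A s * exp (- \<alpha> * s)))"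
  proof -
    have "set_integrable lborel ?A (\<lambda>s. exp (- \<alpha> * s))"
      by (rule set_integrable_subset[OF set_integrable_exp_atLeast[OF \<alpha>]]) (auto simp: stopped_interval)
    then show ?thesis by (simp add: set_integrable_def)
  qed
  have "discounted_reward (\<lambda>y. g y - c) \<alpha> X \<tau> w
    = (\<integral>s. indicator ?A s * (g (X (max 0 s) w) * exp (- \<alpha> * s)) - c * (indicator ?A s * exp (- \<alpha> * s)) \<partial>lborel)"
    unfolding discounted_reward_alt by (intro Bochner_Integration.integral_cong) (auto simp: algebra_simps)
  also have "\<dots> = discounted_reward g \<alpha> X \<tau> w - (\<integral>s. c * (indicator ?A s * exp (- \<alpha> * s)) \<partial>lborel)"
    unfolding discounted_reward_alt
    by (rule Bochner_Integration.integral_diff[OF reward_integrable[OF assms] int])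
  also have "(\<integral>s. c * (indicator ?A s * exp (- \<alpha> * s)) \<partial>lborel) = c * ((1 - discount \<alpha> (\<tau> w)) / \<alpha>)"
    using set_integral_exp_stopped[OF \<alpha>, of "\<tau> w"] by (simp add: set_lebesgue_integral_def)
  finally show ?thesis .
qed

text \<open>Dominated convergence twice: in \<open>s\<close> with the exponential envelope, then
  over outcomes with \<open>G / \<alpha>\<close>. At a fixed \<open>s\<close> the indicator is
  eventually constant, because the exhaustion passes \<open>s\<close>.\<close>

lemma expectation_discounted_reward_tendsto:
  assumes \<tau>: "\<tau> \<in> borel_measurable P"
  shows "(\<lambda>n. expectation (discounted_reward g \<alpha> X (stopped \<tau> n)))
    \<longlonglongrightarrow> expectation (discounted_reward g \<alpha> X \<tau>)"
proof (rule integral_dominated_convergence[where w = "\<lambda>_. G / \<alpha>"])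
  have [measurable]: "\<tau> \<in> borel_measurable P" "exhaustion n \<in> borel_measurable P" for n
    using \<tau> stopping_time_measurable[OF stopping_time_exhaustion] by auto
  show "discounted_reward g \<alpha> X (stopped \<tau> n) \<in> borel_measurable P" for n
    by (rule discounted_reward_measurable) measurable
  show "discounted_reward g \<alpha> X \<tau> \<in> borel_measurable P"
    by (rule discounted_reward_measurable) measurable
  show "AE w in P. norm (discounted_reward g \<alpha> X (stopped \<tau> n) w) \<le> G / \<alpha>" for n
    using discounted_reward_bound by auto
  show "AE w in P. (\<lambda>n. discounted_reward g \<alpha> X (stopped \<tau> n) w)
      \<longlonglongrightarrow> discounted_reward g \<alpha> X \<tau> w"
  proof (rule AE_I2)
    fix w assume w: "w \<in> space P"
    show "(\<lambda>n. discounted_reward g \<alpha> X (stopped \<tau> n) w) \<longlonglongrightarrow> discounted_reward g \<alpha> X \<tau> w"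
      unfolding discounted_reward_alt
    proof (rule integral_dominated_convergence[OF _ _ envelope_integrable])
      show "AE s in lborel. norm (running_reward g (stopped \<tau> n w) w s) \<le> G * (indicator {0..} s * exp (- \<alpha> * s))" for n
        unfolding real_norm_def using reward_envelope by (intro AE_I2)
      show "AE s in lborel. (\<lambda>n. running_reward g (stopped \<tau> n w) w s)
        \<longlonglongrightarrow> running_reward g (\<tau> w) w s"
      proof (rule AE_I2)
        fix s :: real
        show "(\<lambda>n. running_reward g (stopped \<tau> n w) w s)
          \<longlonglongrightarrow> running_reward g (\<tau> w) w s"
        proof (cases "0 \<le> s")
          case True
          show ?thesis
            by (rule tendsto_eventually, rule eventually_mono[OF eventually_exhaustion[OF w True]])
              (auto simp: indicator_def)
        qed simp
      qed
    qed (rule borel_measurable_integrable[OF reward_integrable[OF w]])+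
  qed
qed simp

end

end

section \<open>Verification\<close>

context diffusion
begin

lemma discount_integrable:
  assumes "\<tau> \<in> borel_measurable P"
  shows "integrable P (\<lambda>w. discount \<alpha> (\<tau> w))"
  using discount_bounds[OF \<alpha>] discount_measurable[OF assms]
  by (intro integrable_const_bound[where B = 1]) auto

lemma expectation_discount_le_1: "\<tau> \<in> borel_measurable P \<Longrightarrow> expectation (\<lambda>w. discount \<alpha> (\<tau> w)) \<le> 1"
  using discount_bounds[OF \<alpha>] discount_integrable[of \<tau>] by (intro integral_le_const) auto

lemma expectation_discounted_reward_shift:
  assumes "\<And>y. isCont g y" "\<And>y. \<bar>g y\<bar> \<le> G" and \<tau>: "\<tau> \<in> borel_measurable P"
  shows "expectation (discounted_reward (\<lambda>y. g y - c) \<alpha> X \<tau>)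
    = expectation (discounted_reward g \<alpha> X \<tau>) - c / \<alpha> * (1 - expectation (\<lambda>w. discount \<alpha> (\<tau> w)))"
proof -
  have "expectation (discounted_reward (\<lambda>y. g y - c) \<alpha> X \<tau>)
    = expectation (\<lambda>w. discounted_reward g \<alpha> X \<tau> w - c / \<alpha> * (1 - discount \<alpha> (\<tau> w)))"
    using discounted_reward_shift[OF assms(1,2)] by (intro Bochner_Integration.integral_cong) auto
  also have "\<dots> = expectation (discounted_reward g \<alpha> X \<tau>) - expectation (\<lambda>w. c / \<alpha> * (1 - discount \<alpha> (\<tau> w)))"
    by (intro Bochner_Integration.integral_diff discounted_reward_integrable[OF assms(1,2)]
        integrable_mult_right Bochner_Integration.integrable_diff discount_integrable \<tau>) auto
  also have "expectation (\<lambda>w. c / \<alpha> * (1 - discount \<alpha> (\<tau> w)))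
    = c / \<alpha> * (1 - expectation (\<lambda>w. discount \<alpha> (\<tau> w)))"
    using discount_integrable[OF \<tau>] by (simp add: prob_space)
  finally show ?thesis .
qed

text \<open>Comparing the quotient with \<open>c / \<alpha>\<close> becomes a question about the
  sign of the expected reward for \<open>g - c\<close>.\<close>

lemma gittins_quotient:
  assumes g: "\<And>y. isCont g y" "\<And>y. \<bar>g y\<bar> \<le> G" and \<tau>: "\<tau> \<in> borel_measurable P"
    and nz: "1 - expectation (\<lambda>w. discount \<alpha> (\<tau> w)) \<noteq> 0"
  shows "expectation (discounted_reward g \<alpha> X \<tau>) / (1 - expectation (\<lambda>w. discount \<alpha> (\<tau> w)))
    = c / \<alpha> + expectation (discounted_reward (\<lambda>y. g y - c) \<alpha> X \<tau>) / (1 - expectation (\<lambda>w. discount \<alpha> (\<tau> w)))"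
  using nz unfolding expectation_discounted_reward_shift[OF g \<tau>] by (simp add: field_simps)

end

text \<open>Here \<open>lam\<close> stands for \<alpha> times the index at a threshold. The
  threshold is left open, since the two bounds require \<open>V\<close> to vanish at different
  points.\<close>

locale diffusion_value = diffusion +
  fixes m' h h' V V' :: "real \<Rightarrow> real" and B H H' lam :: real
  assumes m': "\<And>y. (m has_real_derivative m' y) (at y)" "\<And>y. \<bar>m' y\<bar> \<le> B"
    and h': "\<And>y. (h has_real_derivative h' y) (at y)" "\<And>y. \<bar>h' y\<bar> \<le> H'" and h_bound: "\<And>y. \<bar>h y\<bar> \<le> H"
    and V: "\<And>y. (V has_real_derivative V' y) (at y)"
    and V': "\<And>y. (V' has_real_derivative 2 / \<sigma>\<^sup>2 * (\<alpha> * V y - m y * V' y + lam - h y)) (at y)"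
    and V_nonneg: "\<And>y. 0 \<le> V y"
begin

definition V'' :: "real \<Rightarrow> real" where
  "V'' y = 2 / \<sigma>\<^sup>2 * (\<alpha> * V y - m y * V' y + lam - h y)"

text \<open>The differential equation differentiated once more; the Taylor remainder in Dynkin's
  formula needs this derivative.\<close>

definition V''' :: "real \<Rightarrow> real" where
  "V''' y = 2 / \<sigma>\<^sup>2 * (\<alpha> * V' y - (m' y * V' y + m y * V'' y) - h' y)"

lemma V'': "(V'' has_real_derivative V''' y) (at y)"
proof -
  have "((\<lambda>y. 2 / \<sigma>\<^sup>2 * (\<alpha> * V y - m y * V' y + lam - h y)) has_real_derivative
      2 / \<sigma>\<^sup>2 * (\<alpha> * V' y - (m' y * V' y + V'' y * m y) + 0 - h' y)) (at y)"
    unfolding V''_def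
    by (intro DERIV_cmult DERIV_diff DERIV_add DERIV_mult V V' m' h' DERIV_const)
  then show ?thesis
    by (simp add: V''_def[abs_def] V'''_def mult.commute)
qed

lemma V_isCont: "isCont V y" "isCont V' y" "isCont V'' y" "isCont h y"
  by (rule DERIV_isCont[OF V] DERIV_isCont[OF V'] DERIV_isCont[OF V''] DERIV_isCont[OF h'(1)])+

lemma V_measurable [measurable]: "V \<in> borel_measurable borel"
  using V_isCont by (intro borel_measurable_continuous_onI continuous_at_imp_continuous_on) auto

lemma V'''_locally_bounded: obtains C where "\<And>y. \<bar>y\<bar> \<le> L \<Longrightarrow> \<bar>V''' y\<bar> \<le> C"
proof -
  \<comment> \<open>A continuous majorant, in which \<open>m'\<close> and \<open>h'\<close> are
    replaced by their bounds.\<close>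
  define k where "k y = 2 / \<sigma>\<^sup>2 * (\<alpha> * \<bar>V' y\<bar> + (B * \<bar>V' y\<bar> + \<bar>m y\<bar> * \<bar>V'' y\<bar>) + H')" for y
  have "continuous_on {-L..L} k"
    unfolding k_def using V_isCont m_continuous
    by (intro continuous_intros) (auto intro!: continuous_at_imp_continuous_on)
  then have "bounded (k ` {-L..L})"
    by (intro compact_imp_bounded compact_continuous_image) auto
  then obtain C where C: "\<forall>z\<in>k ` {-L..L}. norm z \<le> C"
    unfolding bounded_iff by blast
  have V'''_le: "\<bar>V''' y\<bar> \<le> k y" for y
  proof -
    have "\<bar>m' y * V' y\<bar> \<le> B * \<bar>V' y\<bar>"
      unfolding abs_mult by (intro mult_right_mono m') auto
    moreover have "\<bar>\<alpha> * V' y\<bar> = \<alpha> * \<bar>V' y\<bar>" "\<bar>m y * V'' y\<bar> = \<bar>m y\<bar> * \<bar>V'' y\<bar>"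
      using \<alpha> by (auto simp: abs_mult)
    ultimately have "\<bar>\<alpha> * V' y - (m' y * V' y + m y * V'' y) - h' y\<bar>
        \<le> \<alpha> * \<bar>V' y\<bar> + (B * \<bar>V' y\<bar> + \<bar>m y\<bar> * \<bar>V'' y\<bar>) + H'"
      using h'(2)[of y] by linarith
    then have "2 / \<sigma>\<^sup>2 * \<bar>\<alpha> * V' y - (m' y * V' y + m y * V'' y) - h' y\<bar> \<le> k y"
      unfolding k_def by (intro mult_left_mono) auto
    then show ?thesis
      unfolding V'''_def abs_mult by simp
  qed
  show thesis
  proof (rule that[of C])
    fix y :: real assume "\<bar>y\<bar> \<le> L"
    then have "k y \<le> C"
      using C by (force simp: abs_le_iff)
    with V'''_le show "\<bar>V''' y\<bar> \<le> C"
      by (rule order.trans)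
  qed
qed

abbreviation excess_reward :: "('a \<Rightarrow> ennreal) \<Rightarrow> 'a \<Rightarrow> real" where
  "excess_reward \<equiv> discounted_reward (\<lambda>y. h y - lam) \<alpha> X"

abbreviation terminal_value :: "('a \<Rightarrow> ennreal) \<Rightarrow> 'a \<Rightarrow> real" where
  "terminal_value \<rho> \<equiv> \<lambda>w. discount \<alpha> (\<rho> w) * V (X (enn2real (\<rho> w)) w)"

lemma excess_reward_bounded: "isCont (\<lambda>y. h y - lam) y" "\<bar>h y - lam\<bar> \<le> H + \<bar>lam\<bar>"
  using V_isCont(4)[of y] h_bound[of y] by auto

text \<open>The equation for \<open>V\<close> says that the generator minus \<alpha> maps
  \<open>V\<close> to \<open>lam - h\<close>. The compensator in Dynkin's formula is therefore the
  negative of the excess reward.\<close>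

lemma stopped_reward_identity:
  assumes \<tau>: "stopping_time \<F> \<tau>" and n: "\<bar>x\<bar> \<le> real n"
  defines "\<rho> \<equiv> stopped \<tau> n"
  shows "integrable P (terminal_value \<rho>)"
    and "expectation (excess_reward \<rho>)
      = V x - expectation (terminal_value \<rho>)"
proof -
  define T where "T w = enn2real (\<rho> w)" for w
  have \<rho>_stop: "stopping_time \<F> \<rho>"
    unfolding \<rho>_def by (rule stopping_time_min[OF \<tau> stopping_time_exhaustion])
  have [measurable]: "\<rho> \<in> borel_measurable P"
    by (rule stopping_time_measurable[OF \<rho>_stop])
  have \<rho>_le: "\<rho> w \<le> exhaustion n w" "\<rho> w \<le> ennreal (real n)" for w
    by (auto simp: \<rho>_def exhaustion_def min_le_iff_disj)
  have fin: "\<rho> w \<noteq> \<infinity>" for w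
    using \<rho>_le(2)[of w] by (auto simp: top_unique)
  have T: "ennreal (T w) = \<rho> w" "0 \<le> T w" for w
    using fin[of w] by (auto simp: T_def less_top)
  have T_le: "T w \<le> real n" for w
    using \<rho>_le(2)[of w] unfolding T(1)[symmetric] by (simp add: ennreal_le_iff)
  have T_stop: "{w \<in> space P. T w \<le> t} \<in> sets (\<F> (ennreal t))" if "0 \<le> t" for t
  proof -
    have "{w \<in> space P. T w \<le> t} = {w \<in> space (\<F> (ennreal t)). \<rho> w \<le> ennreal t}"
      using that T by (auto simp: space_\<F> ennreal_le_iff T(1)[symmetric])
    then show ?thesis
      using stopping_timeD[OF \<rho>_stop, of "ennreal t"] by (simp add: pred_def)
  qed
  have XL: "AE w in P. \<forall>s\<in>{0..T w}. \<bar>X s w\<bar> \<le> real n"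
    using AE_bounded_before_exhaustion[OF n]
  proof eventually_elim
    case (elim w)
    show ?case
    proof
      fix s assume "s \<in> {0..T w}"
      then have "0 \<le> s" "ennreal s \<le> \<rho> w"
        unfolding T(1)[symmetric] by (auto intro: ennreal_leI)
      with elim \<rho>_le(1)[of w] show "\<bar>X s w\<bar> \<le> real n"
        by (meson order.trans)
    qed
  qed
  obtain C where C: "\<And>y. \<bar>y\<bar> \<le> real n + 1 \<Longrightarrow> \<bar>V''' y\<bar> \<le> C"
    using V'''_locally_bounded by blast
  have disc: "discount \<alpha> (\<rho> w) = exp (- \<alpha> * T w)" for w
    using fin[of w] by (simp add: discount_def T_def)
  have V'_DERIV: "(V' has_real_derivative V'' y) (at y)" for y
    using V' by (simp add: V''_def)
  let ?R = "excess_reward \<rho>"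
  have R_int: "integrable P ?R"
    by (rule discounted_reward_integrable[OF excess_reward_bounded]) measurable
  have [measurable]: "(\<lambda>p. X (max 0 (snd p)) (fst p)) \<in> borel_measurable (P \<Otimes>\<^sub>M borel)"
    by (rule measurable_continuous_process[OF X_max_measurable X_max_paths])
  \<comment> \<open>\<open>X\<close> at the random time is a jointly measurable map composed with
    \<open>w\<close> mapped to \<open>(w, T w)\<close>.\<close>
  have "(\<lambda>w. (\<lambda>p. X (max 0 (snd p)) (fst p)) (w, T w)) \<in> borel_measurable P"
    unfolding T_def by measurable
  then have [measurable]: "(\<lambda>w. X (T w) w) \<in> borel_measurable P"
    using T(2) by (simp add: max_def)
  have [measurable]: "(\<lambda>w. discount \<alpha> (\<rho> w)) \<in> borel_measurable P"
    by (rule discount_measurable) measurable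
  show "integrable P (terminal_value \<rho>)"
    and "expectation ?R = V x - expectation (terminal_value \<rho>)"
  proof (atomize (full), rule localized_dynkin[OF V V'_DERIV V'' C n T(2) T_le T_stop XL])
    fix Z assume Z: "integrable P Z" "expectation Z = V x"
      and Z_eq: "AE w in P. Z w = exp (- \<alpha> * T w) * V (X (T w) w)
        - (LINT s:{0..T w}|lborel. exp (- \<alpha> * s)
          * (\<sigma>\<^sup>2 / 2 * V'' (X s w) + m (X s w) * V' (X s w) - \<alpha> * V (X s w)))"
    have gen: "\<sigma>\<^sup>2 / 2 * V'' y + m y * V' y - \<alpha> * V y = lam - h y" for y
      using \<sigma> by (simp add: V''_def field_simps)
    have R_eq: "?R w = - (LINT s:{0..T w}|lborel. exp (- \<alpha> * s) * (lam - h (X s w)))" for w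
    proof -
      have "{s. 0 \<le> s \<and> ennreal s \<le> \<rho> w} = {0..T w}"
        using fin[of w] by (simp add: stopped_interval T_def)
      then show ?thesis
        unfolding discounted_reward_def set_lebesgue_integral_def
        by (simp flip: Bochner_Integration.integral_minus) (simp add: algebra_simps)
    qed
    have eq: "AE w in P. terminal_value \<rho> w = Z w - ?R w"
      using Z_eq
    proof eventually_elim
      case (elim w)
      then show ?case
        unfolding gen disc R_eq T_def[symmetric] by linarith
    qed
    have int: "integrable P (\<lambda>w. Z w - ?R w)"
      using Z R_int by simp
    have meas: "(terminal_value \<rho>) \<in> borel_measurable P"
      unfolding T_def[symmetric] by measurable
    have "integrable P (terminal_value \<rho>)"
      using integrable_cong_AE[OF meas borel_measurable_integrable[OF int] eq] int by simp
    moreover have "expectation (terminal_value \<rho>) = expectation (\<lambda>w. Z w - ?R w)"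
      by (rule integral_cong_AE[OF meas borel_measurable_integrable[OF int] eq])
    ultimately show "integrable P (terminal_value \<rho>) \<and>
        expectation ?R = V x - expectation (terminal_value \<rho>)"
      using Z R_int by simp
  qed
qed

text \<open>The initial value is zero and the terminal value nonnegative, so every stopped excess
  reward is at most zero in expectation. Only the sign of \<open>V\<close> enters, which matters
  because \<open>V\<close> is bounded only above the threshold.\<close>

lemma expectation_reward_nonpos:
  assumes "stopping_time \<F> \<tau>" "V x = 0"
  shows "expectation (excess_reward \<tau>) \<le> 0"
proof (rule LIMSEQ_le_const2[OF expectation_discounted_reward_tendsto[OF excess_reward_bounded]])
  show "\<tau> \<in> borel_measurable P"
    by (rule stopping_time_measurable[OF assms(1)])
  obtain N where N: "\<bar>x\<bar> \<le> real N"
    using real_arch_simple by blast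
  show "\<exists>N. \<forall>n\<ge>N. expectation (excess_reward (stopped \<tau> n)) \<le> 0"
  proof (intro exI[of _ N] allI impI)
    fix n assume "N \<le> n"
    then have "\<bar>x\<bar> \<le> real n" using N by linarith
    note S = stopped_reward_identity[OF assms(1) this]
    have "0 \<le> expectation (terminal_value (stopped \<tau> n))"
      using V_nonneg discount_bounds(1)[OF \<alpha>] by (intro integral_nonneg_AE) auto
    then show "expectation (excess_reward (stopped \<tau> n)) \<le> 0"
      unfolding S(2) assms(2) by simp
  qed
qed

definition exit_below :: "real \<Rightarrow> 'a \<Rightarrow> ennreal" where
  "exit_below a = hitting_time (\<lambda>t w. - X t w) (- a)"

lemma stopping_time_exit_below: "stopping_time \<F> (exit_below a)"
  unfolding exit_below_def
proof (rule stopping_time_hitting_time[OF filtration_P])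
  show "(\<lambda>w. - X t w) \<in> borel_measurable (\<F> (ennreal t))" if "0 \<le> t" for t
    using X_adapted[OF that] by measurable
  show "continuous_on {0..} (\<lambda>t. - X t w)" if "w \<in> space P" for w
    by (intro continuous_intros X_paths[OF that])
qed

text \<open>If the passage to \<open>a\<close> comes first, the terminal value vanishes because
  \<open>V a = 0\<close>. Otherwise \<open>X\<close> is still above \<open>a\<close>, and the
  terminal value is at most \<open>C\<close> times a discount factor whose expectation tends to 0.
  The initial value \<open>V x\<close> is nonnegative.\<close>

lemma expectation_reward_exit_below_nonneg:
  assumes a: "a < x" and Va: "V a = 0" and C: "\<And>y. a \<le> y \<Longrightarrow> V y \<le> C"
  shows "0 \<le> expectation (excess_reward (exit_below a))"
proof (rule LIMSEQ_le[OF _ expectation_discounted_reward_tendsto[OF excess_reward_bounded]])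
  have C0: "0 \<le> C"
    using C[of a] Va by simp
  show "exit_below a \<in> borel_measurable P"
    by (rule stopping_time_measurable[OF stopping_time_exit_below])
  have exh [measurable]: "exhaustion n \<in> borel_measurable P" for n
    by (rule stopping_time_measurable[OF stopping_time_exhaustion])
  have "(\<lambda>n. expectation (\<lambda>w. discount \<alpha> (exhaustion n w))) \<longlonglongrightarrow> expectation (\<lambda>w. 0)"
    by (rule integral_dominated_convergence[where w = "\<lambda>_. 1"])
      (use discount_measurable[OF exh] discount_exhaustion_tendsto discount_bounds[OF \<alpha>] in auto)
  from tendsto_mult_left[OF this, of "- C"]
  show "(\<lambda>n. - C * expectation (\<lambda>w. discount \<alpha> (exhaustion n w))) \<longlonglongrightarrow> 0"
    by simp
  obtain N where N: "\<bar>x\<bar> \<le> real N"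
    using real_arch_simple by blast
  show "\<exists>N. \<forall>n\<ge>N. - C * expectation (\<lambda>w. discount \<alpha> (exhaustion n w))
      \<le> expectation (excess_reward (stopped (exit_below a) n))"
  proof (intro exI[of _ N] allI impI)
    fix n assume "N \<le> n"
    then have n: "\<bar>x\<bar> \<le> real n" using N by linarith
    define \<rho> where "\<rho> w = min (exit_below a w) (exhaustion n w)" for w
    note S = stopped_reward_identity[OF stopping_time_exit_below n, of a, folded \<rho>_def]
    have "AE w in P. terminal_value \<rho> w \<le> C * discount \<alpha> (exhaustion n w)"
      using AE_start AE_space
    proof eventually_elim
      case (elim w)
      define t where "t = enn2real (\<rho> w)"
      have "\<rho> w < \<infinity>"
        using exhaustion_finite[of n w] by (simp add: \<rho>_def min_less_iff_disj)
      then have t: "ennreal t = \<rho> w" "0 \<le> t"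
        by (auto simp: t_def)
      have cont: "continuous_on {0..} (\<lambda>t. - X t w)"
        by (intro continuous_intros X_paths[OF elim(2)])
      have "a \<le> X t w"
        using le_hitting_timeD[of "\<lambda>t w. - X t w" w "- a" t, OF cont] a elim(1) t
        by (simp add: \<rho>_def exit_below_def)
      show ?case
      proof (cases "exit_below a w \<le> exhaustion n w")
        case True
        then have "hitting_time (\<lambda>t w. - X t w) (- a) w = ennreal t"
          using t by (simp add: \<rho>_def exit_below_def)
        from hitting_time_attained[of "\<lambda>t w. - X t w", OF cont t(2) this]
        have "X t w = a"
          using \<open>a \<le> X t w\<close> by simp
        then show ?thesis
          using Va C0 discount_bounds(1)[OF \<alpha>] by (simp add: t_def)
      next
        case False
        then have "\<rho> w = exhaustion n w"
          by (simp add: \<rho>_def)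
        then show ?thesis
          using C[OF \<open>a \<le> X t w\<close>] discount_bounds(1)[OF \<alpha>, of "exhaustion n w"]
            mult_left_mono[of "V (X t w)" C "discount \<alpha> (exhaustion n w)"] by (simp add: t_def mult.commute)
      qed
    qed
    then have "expectation (terminal_value \<rho>)
        \<le> expectation (\<lambda>w. C * discount \<alpha> (exhaustion n w))"
      by (intro integral_mono_AE S(1) integrable_mult_right discount_integrable) measurable
    then have "- C * expectation (\<lambda>w. discount \<alpha> (exhaustion n w)) \<le> expectation (excess_reward \<rho>)"
      unfolding S(2) using V_nonneg[of x] by simp
    then show "- C * expectation (\<lambda>w. discount \<alpha> (exhaustion n w))
      \<le> expectation (excess_reward (stopped (exit_below a) n))"
      by (simp add: \<rho>_def[abs_def])
  qed
qed

text \<open>Starting strictly above \<open>a\<close>, the passage takes positive time almost surely.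
  This makes it an admissible competitor in the supremum.\<close>

lemma expectation_discount_exit_below:
  assumes "a < x"
  shows "expectation (\<lambda>w. discount \<alpha> (exit_below a w)) < 1"
proof -
  have meas: "exit_below a \<in> borel_measurable P"
    by (rule stopping_time_measurable[OF stopping_time_exit_below])
  have "AE w in P. discount \<alpha> (exit_below a w) < 1"
    using AE_start AE_space
  proof eventually_elim
    case (elim w)
    have cont: "continuous_on {0..} (\<lambda>t. - X t w)"
      by (intro continuous_intros X_paths[OF elim(2)])
    have "exit_below a w \<noteq> 0"
      using hitting_time_le_iff[of "\<lambda>t w. - X t w" w 0 "- a", OF cont] assms elim(1)
      by (auto simp: exit_below_def)
    then show ?case
      using \<alpha> by (cases "exit_below a w") (auto simp: discount_def)
  qed
  then have "expectation (\<lambda>w. discount \<alpha> (exit_below a w)) < expectation (\<lambda>w. 1)"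
    by (intro integral_less_AE_space discount_integrable meas) (auto simp: emeasure_space_1)
  then show ?thesis
    by (simp add: prob_space)
qed

end

section \<open>Identification of the Gittins index\<close>

lemma (in decreasing_solution) gittins_index_eq_index:
  assumes diffusion: "diffusion (P x) \<F> \<sigma> x \<alpha> m W X" and h'_bound: "\<And>y. \<bar>h' y\<bar> \<le> H'"
  shows "gittins_index P \<F> X h \<alpha> x = ereal (index x)"
proof (rule antisym)
  interpret X: diffusion "P x" \<F> \<sigma> x \<alpha> m W X
    by (rule diffusion)
  have value_locale: "diffusion_value (P x) \<F> \<sigma> x \<alpha> m W X m' h h' V V' B H H' (\<alpha> * index a)"
    if "\<And>y. (V has_real_derivative V' y) (at y)"
      "\<And>y. (V' has_real_derivative 2 / \<sigma>\<^sup>2 * (\<alpha> * V y - m y * V' y + \<alpha> * index a - h y)) (at y)"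
      "\<And>y. 0 \<le> V y" for V V' a
    \<comment> \<open>The construction of \<open>V\<close> depends on the threshold
      \<open>a\<close>, whereas the process keeps its own starting point \<open>x\<close>.\<close>
    by unfold_locales (use that m m'_bound h h'_bound h_bound in auto)
  have \<alpha>_index: "\<alpha> * index a / \<alpha> = index a" for a
    using \<alpha> by simp
  show "gittins_index P \<F> X h \<alpha> x \<le> ereal (index x)"
    unfolding gittins_index_def
  proof (rule SUP_least)
    fix \<tau> assume "\<tau> \<in> {\<tau>. stopping_time \<F> \<tau> \<and> 1 - (\<integral>w. discount \<alpha> (\<tau> w) \<partial>P x) \<noteq> 0}"
    then have \<tau>: "stopping_time \<F> \<tau>" and nz: "1 - (\<integral>w. discount \<alpha> (\<tau> w) \<partial>P x) \<noteq> 0"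
      by auto
    note meas = X.stopping_time_measurable[OF \<tau>]
    show "ereal ((\<integral>w. discounted_reward h \<alpha> X \<tau> w \<partial>P x) / (1 - (\<integral>w. discount \<alpha> (\<tau> w) \<partial>P x)))
        \<le> ereal (index x)"
    proof (rule value_function[of x])
      fix V V' C
      assume V: "\<And>y. (V has_real_derivative V' y) (at y)"
        "\<And>y. (V' has_real_derivative 2 / \<sigma>\<^sup>2 * (\<alpha> * V y - m y * V' y + \<alpha> * index x - h y)) (at y)"
        "V x = 0" "\<And>y. 0 \<le> V y"
      interpret V: diffusion_value "P x" \<F> \<sigma> x \<alpha> m W X m' h h' V V' B H H' "\<alpha> * index x"
        by (rule value_locale[OF V(1,2,4)])
      have "X.expectation (discounted_reward (\<lambda>y. h y - \<alpha> * index x) \<alpha> X \<tau>)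
          / (1 - X.expectation (\<lambda>w. discount \<alpha> (\<tau> w))) \<le> 0"
        using V.expectation_reward_nonpos[OF \<tau> V(3)] X.expectation_discount_le_1[OF meas]
        by (intro divide_nonpos_nonneg) auto
      then show ?thesis
        using X.gittins_quotient[OF isCont(5) h_bound meas nz, of "\<alpha> * index x"] by (simp add: \<alpha>_index)
    qed
  qed
  have lower: "ereal (index a) \<le> gittins_index P \<F> X h \<alpha> x" if a: "a < x" for a
  proof (rule value_function[of a])
    fix V V' C
    assume V: "\<And>y. (V has_real_derivative V' y) (at y)"
      "\<And>y. (V' has_real_derivative 2 / \<sigma>\<^sup>2 * (\<alpha> * V y - m y * V' y + \<alpha> * index a - h y)) (at y)"
      "V a = 0" "\<And>y. 0 \<le> V y" "\<And>y. a \<le> y \<Longrightarrow> V y \<le> C"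
    interpret V: diffusion_value "P x" \<F> \<sigma> x \<alpha> m W X m' h h' V V' B H H' "\<alpha> * index a"
      by (rule value_locale[OF V(1,2,4)])
    let ?\<tau> = "V.exit_below a"
    note \<tau> = V.stopping_time_exit_below[of a]
    note meas = X.stopping_time_measurable[OF \<tau>]
    have pos: "0 < 1 - X.expectation (\<lambda>w. discount \<alpha> (?\<tau> w))"
      using V.expectation_discount_exit_below[OF a] by simp
    then have nz: "1 - X.expectation (\<lambda>w. discount \<alpha> (?\<tau> w)) \<noteq> 0"
      by simp
    have "0 \<le> X.expectation (discounted_reward (\<lambda>y. h y - \<alpha> * index a) \<alpha> X ?\<tau>)
        / (1 - X.expectation (\<lambda>w. discount \<alpha> (?\<tau> w)))"
      using V.expectation_reward_exit_below_nonneg[OF a V(3,5)] pos by (intro divide_nonneg_pos)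
    then have "index a \<le> X.expectation (discounted_reward h \<alpha> X ?\<tau>)
        / (1 - X.expectation (\<lambda>w. discount \<alpha> (?\<tau> w)))"
      using X.gittins_quotient[OF isCont(5) h_bound meas nz, of "\<alpha> * index a"] by (simp add: \<alpha>_index)
    then show ?thesis
      unfolding gittins_index_def using \<tau> nz by (intro SUP_upper2[of ?\<tau>]) auto
  qed
  show "ereal (index x) \<le> gittins_index P \<F> X h \<alpha> x"
  proof (rule tendsto_upperbound)
    have "(index \<longlongrightarrow> index x) (at_left x)"
      using isCont_index[of x] by (auto simp: isCont_def intro: tendsto_within_subset)
    then show "((\<lambda>a. ereal (index a)) \<longlongrightarrow> ereal (index x)) (at_left x)"
      by simp
    show "\<forall>\<^sub>F a in at_left x. ereal (index a) \<le> gittins_index P \<F> X h \<alpha> x"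
      using lower by (auto simp: eventually_at_filter)
  qed simp
qed

section \<open>Return to the original data\<close>

lemma homogeneous_solution_combination:
  assumes f: "homogeneous_solution \<sigma> \<mu> \<gamma> f" and g: "homogeneous_solution \<sigma> \<mu> \<gamma> g"
  shows "homogeneous_solution \<sigma> \<mu> \<gamma> (\<lambda>y. p * f y + q * g y)"
proof -
  have d: "(f has_real_derivative deriv f y) (at y)" "(g has_real_derivative deriv g y) (at y)"
    "(deriv f has_real_derivative deriv (deriv f) y) (at y)" "(deriv g has_real_derivative deriv (deriv g) y) (at y)" for y
    using f g by (simp_all add: homogeneous_solution_def DERIV_deriv_iff_real_differentiable)
  have 1: "((\<lambda>y. p * f y + q * g y) has_real_derivative p * deriv f y + q * deriv g y) (at y)" for y
    by (intro DERIV_add DERIV_cmult d)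
  then have eq: "deriv (\<lambda>y. p * f y + q * g y) = (\<lambda>y. p * deriv f y + q * deriv g y)"
    by (intro ext DERIV_imp_deriv)
  have 2: "((\<lambda>y. p * deriv f y + q * deriv g y) has_real_derivative p * deriv (deriv f) y + q * deriv (deriv g) y) (at y)" for y
    by (intro DERIV_add DERIV_cmult d)
  then have eq2: "deriv (\<lambda>y. p * deriv f y + q * deriv g y) = (\<lambda>y. p * deriv (deriv f) y + q * deriv (deriv g) y)"
    by (intro ext DERIV_imp_deriv)
  have "generator \<sigma> \<mu> \<gamma> (\<lambda>y. p * f y + q * g y) y = p * generator \<sigma> \<mu> \<gamma> f y + q * generator \<sigma> \<mu> \<gamma> g y" for y
    unfolding generator_def eq eq2 by (simp add: algebra_simps add_divide_distrib)
  then show ?thesis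
    using f g 1 2 unfolding homogeneous_solution_def eq
    by (auto simp: real_differentiable_def)
qed

theorem theorem3p1:
  fixes \<sigma> \<Gamma> \<alpha> k K p q \<alpha>\<^sub>0 b x :: real
    and h \<mu> m F\<^sub>\<Gamma> :: "real \<Rightarrow> real"
    and \<phi> \<eta> :: "real \<Rightarrow> real \<Rightarrow> real"
    and P :: "real \<Rightarrow> 'a measure"
    and \<F> :: "ennreal \<Rightarrow> 'a measure"
    and W X :: "real \<Rightarrow> 'a \<Rightarrow> real"
  assumes "\<sigma> > 0" and "\<Gamma> > 0" and "\<alpha> > 0"
    and "admissible_reward h \<alpha> k K"
    and "\<mu> C1_differentiable_on UNIV"
    and "\<And>\<gamma>. \<gamma> \<in> {\<Gamma>, \<alpha> + \<Gamma>} \<Longrightarrow> homogeneous_system \<sigma> \<mu> \<gamma> (\<phi> \<gamma>) (\<eta> \<gamma>)"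
    and "F\<^sub>\<Gamma> = (\<lambda>y. p * \<phi> \<Gamma> y + q * \<eta> \<Gamma> y)"
    and "\<And>y. F\<^sub>\<Gamma> y > 0"
    and "m = (\<lambda>y. \<mu> y + \<sigma>\<^sup>2 * deriv (\<lambda>z. ln (F\<^sub>\<Gamma> z)) y)"
    and "\<And>y. sde_solution (P y) \<F> m \<sigma> W y X"
    and "\<alpha>\<^sub>0 > 0" and "b > 0"
    and "\<And>y. \<alpha>\<^sub>0 < \<alpha> - deriv m y \<and> \<alpha> - deriv m y < b"
  shows "wronskian (\<phi> (\<alpha> + \<Gamma>)) F\<^sub>\<Gamma> x \<noteq> 0 \<and>
    set_integrable lborel {x..}
      (\<lambda>s. 2 * h s * \<phi> (\<alpha> + \<Gamma>) s * F\<^sub>\<Gamma> s / (\<sigma>\<^sup>2 * wronskian (\<phi> (\<alpha> + \<Gamma>)) (\<eta> (\<alpha> + \<Gamma>)) s)) \<and>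
    gittins_index P \<F> X h \<alpha> x =
      ereal (wronskian (\<phi> (\<alpha> + \<Gamma>)) (\<eta> (\<alpha> + \<Gamma>)) x / wronskian (\<phi> (\<alpha> + \<Gamma>)) F\<^sub>\<Gamma> x *
        (LINT s:{x..}|lborel. 2 * h s * \<phi> (\<alpha> + \<Gamma>) s * F\<^sub>\<Gamma> s
           / (\<sigma>\<^sup>2 * wronskian (\<phi> (\<alpha> + \<Gamma>)) (\<eta> (\<alpha> + \<Gamma>)) s)))"
proof -
  have sys: "homogeneous_system \<sigma> \<mu> (\<alpha> + \<Gamma>) (\<phi> (\<alpha> + \<Gamma>)) (\<eta> (\<alpha> + \<Gamma>))"
    and "homogeneous_system \<sigma> \<mu> \<Gamma> (\<phi> \<Gamma>) (\<eta> \<Gamma>)"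
    using assms(6) by auto
  then have F_sol: "homogeneous_solution \<sigma> \<mu> \<Gamma> F\<^sub>\<Gamma>"
    unfolding assms(7) by (intro homogeneous_solution_combination) (auto simp: homogeneous_system_def)
  interpret T: transformed_system \<sigma> \<Gamma> \<alpha> \<mu> F\<^sub>\<Gamma> "\<phi> (\<alpha> + \<Gamma>)" "\<eta> (\<alpha> + \<Gamma>)"
    by unfold_locales (use assms sys F_sol in auto)
  have m_eq: "m = T.drift"
  proof
    fix y
    have "((\<lambda>z. ln (F\<^sub>\<Gamma> z)) has_real_derivative deriv F\<^sub>\<Gamma> y / F\<^sub>\<Gamma> y) (at y)"
      using assms(8)[of y] by (auto intro!: derivative_eq_intros T.DF)
    then show "m y = T.drift y"
      unfolding assms(9) T.drift_def by (simp add: DERIV_imp_deriv)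
  qed
  \<comment> \<open>As \<open>deriv\<close> is total, the hypothesis on \<open>deriv m\<close> does
    not by itself give differentiability. It comes from that of \<mu> and from the second-order
    equation for \<open>F\<^sub>\<Gamma>\<close>.\<close>
  have m: "(m has_real_derivative deriv m y) (at y)" for y
  proof -
    obtain D where "\<And>y. (\<mu> has_real_derivative D y) (at y)"
      using assms(5) by (auto simp: C1_differentiable_on_def has_real_derivative_iff_has_vector_derivative)
    then have "(T.drift has_real_derivative D y + \<sigma>\<^sup>2 * ((2 / \<sigma>\<^sup>2 * (\<Gamma> * F\<^sub>\<Gamma> y - \<mu> y * deriv F\<^sub>\<Gamma> y)) * F\<^sub>\<Gamma> y
        - deriv F\<^sub>\<Gamma> y * deriv F\<^sub>\<Gamma> y) / (F\<^sub>\<Gamma> y * F\<^sub>\<Gamma> y)) (at y)"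
      unfolding T.drift_def[abs_def] times_divide_eq_right[symmetric]
      by (intro DERIV_add DERIV_cmult DERIV_divide T.DF) auto
    then show ?thesis
      unfolding m_eq by (simp add: DERIV_imp_deriv)
  qed
  have m_bound: "\<bar>deriv m y\<bar> \<le> \<alpha> + b" for y
    using assms(13)[of y] assms(3,11,12) by (auto simp: abs_le_iff)
  have h: "(h has_real_derivative deriv h y) (at y)" for y
    using assms(4) by (simp add: admissible_reward_def DERIV_deriv_iff_real_differentiable)
  obtain H' where H': "\<And>y. \<bar>deriv h y\<bar> \<le> H'"
    using assms(4) by (auto simp: admissible_reward_def bounded_iff)
  have h_bound: "\<bar>h y\<bar> \<le> \<bar>\<alpha> * k\<bar> + \<bar>\<alpha> * K\<bar>" for y
  proof -
    have "h y \<in> {\<alpha> * k..\<alpha> * K}"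
      using assms(4) rangeI[of h y] unfolding admissible_reward_def by blast
    then show ?thesis by auto
  qed
  have h_mono: "mono h"
    using assms(4) by (auto simp: admissible_reward_def intro: strict_mono_mono)
  interpret D: decreasing_solution \<sigma> \<alpha> "\<alpha> + b" "\<bar>\<alpha> * k\<bar> + \<bar>\<alpha> * K\<bar>" m "deriv m" T.u T.u' T.s h "deriv h"
    by unfold_locales
      (use assms(1,3) m m_bound T.u T.u' T.s T.u_pos T.u'_neg T.s_pos h h_mono h_bound in \<open>auto simp: m_eq\<close>)
  have "diffusion (P x) \<F> \<sigma> x \<alpha> m W X"
    using assms(1,3,10) DERIV_isCont[OF m]
    by (auto simp: diffusion_def diffusion_axioms_def sde_solution_def filtered_prob_space_def)
  then have gittins: "gittins_index P \<F> X h \<alpha> x = ereal (D.index x)"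
    by (rule D.gittins_index_eq_index[OF _ H'])
  \<comment> \<open>The signs chosen to make \<open>u\<close> and \<open>s\<close> positive. They
    appear as \<open>c / d\<close> in the integrand and as \<open>d / c\<close> in the
    prefactor.\<close>
  define c where "c = sgn (\<phi> (\<alpha> + \<Gamma>) 0)"
  define d where "d = sgn (wronskian (\<phi> (\<alpha> + \<Gamma>)) (\<eta> (\<alpha> + \<Gamma>)) 0)"
  have cd: "c * c = 1" "d * d = 1" "c \<noteq> 0" "d \<noteq> 0"
    using T.\<phi>_nz[of 0] T.W_nz[of 0] by (auto simp: c_def d_def sgn_if)
  have "2 * h s * \<phi> (\<alpha> + \<Gamma>) s * F\<^sub>\<Gamma> s / (\<sigma>\<^sup>2 * wronskian (\<phi> (\<alpha> + \<Gamma>)) (\<eta> (\<alpha> + \<Gamma>)) s)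
      = c / d * (h s * D.speed s)" for s
    unfolding T.wronskian_\<phi>_\<eta>[of s] T.\<phi>_eq[of s] c_def[symmetric] d_def[symmetric] D.speed_def
    using cd T.F_nz[of s] by (simp add: field_simps power2_eq_square)
  then have integrand: "(\<lambda>s. 2 * h s * \<phi> (\<alpha> + \<Gamma>) s * F\<^sub>\<Gamma> s / (\<sigma>\<^sup>2 * wronskian (\<phi> (\<alpha> + \<Gamma>)) (\<eta> (\<alpha> + \<Gamma>)) s))
      = (\<lambda>s. c / d * (h s * D.speed s))"
    by (rule ext)
  have factor: "wronskian (\<phi> (\<alpha> + \<Gamma>)) (\<eta> (\<alpha> + \<Gamma>)) x / wronskian (\<phi> (\<alpha> + \<Gamma>)) F\<^sub>\<Gamma> x
      = d / c * (T.s x / (- T.u' x))"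
    unfolding T.wronskian_\<phi>_\<eta>[of x] T.wronskian_\<phi>_F[of x] c_def[symmetric] d_def[symmetric]
    using cd T.F_nz[of x] by (simp add: field_simps)
  have "wronskian (\<phi> (\<alpha> + \<Gamma>)) F\<^sub>\<Gamma> x \<noteq> 0"
    unfolding T.wronskian_\<phi>_F c_def[symmetric] using cd T.F_nz[of x] T.u'_neg[of x] by simp
  moreover have "set_integrable lborel {x..} (\<lambda>s. c / d * (h s * D.speed s))"
    using D.set_integrable_h_speed[of x] by (intro set_integrable_mult_right)
  moreover have "D.index x = d / c * (T.s x / (- T.u' x)) * (LINT s:{x..}|lborel. c / d * (h s * D.speed s))"
    using cd by (simp add: D.index_def)
  ultimately show ?thesis
    unfolding integrand factor gittins by simp
qed

end
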